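(* Let $(\bar N,g_{\bar N})$ be a quaternionic Kähler manifold in the image of the q-map, defined by a homogeneous cubic polynomial $h$ in $n$ variables, and let $\bar M$ be the corresponding projective special Kähler manifold obtained by the r-map. The squared pointwise norm of the Riemann curvature tensor $R$ of $\bar N$ is $$\|R\|^2=64(n+1)(4n+3)+160\,scal_{\bar M}+6\|R_{\bar M}\|^2+128\sum_{a,b,c,d=1}^n(S_{abcd})^2 .$$
   Context: Products of one-forms: $\alpha\beta=\frac12(\alpha\otimes\beta+\beta\otimes\alpha)$. r-map: $\mathcal{H}\subset\mathbb{R}^n$ is a projective special real manifold, i.e. a hypersurface contained in $\{h=1\}$ with $-\partial^2h|_{T\mathcal{H}\times T\mathcal{H}}>0$; $U=\mathbb{R}^{>0}\cdot\mathcal{H}$; $\bar M=\mathbb{R}^n+iU$ with holomorphic coordinates $X^\mu=y^\mu+ix^\mu$, $x\in U$; $\mathcal{K}=-\log8h(x)$, $\mathcal{K}_{\mu\bar\nu}=\partial^2\mathcal{K}/\partial X^\mu\partial\bar X^\nu$, $g_{\bar M}=\sum\mathcal{K}_{\mu\bar\nu}dX^\mu d\bar X^\nu$; $(\mathcal{K}^{\mu\nu})$ denotes the inverse of the (real symmetric) matrix $(\mathcal{K}_{\mu\bar\nu})$. c-map: $F(z^0,\ldots,z^n)=h(z^1,\ldots,z^n)/z^0$, $F_{IJ}=\partial^2F/\partial z^I\partial z^J$, $N_{IJ}=2\,\mathrm{Im}F_{IJ}$, $\mathcal{R}_{IJ}+i\mathcal{I}_{IJ}=\bar F_{IJ}+i\frac{\sum_KN_{IK}z^K\sum_LN_{JL}z^L}{\sum_{K,L}N_{KL}z^Kz^L}$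 at $z=(1,X^1,\ldots,X^n)$, $(\mathcal{I}^{IJ})=(\mathcal{I}_{IJ})^{-1}$. The q-map metric on $\bar N=\bar M\times\mathbb{R}^{>0}\times\mathbb{R}^{2n+3}$, with coordinates $(\rho,\tilde\phi,\tilde\zeta_I,\zeta^I)_{I=0,\ldots,n}$ on the last factors, is $$g_{\bar N}=g_{\bar M}+\tfrac{1}{4\rho^2}d\rho^2+\tfrac{1}{4\rho^2}\big(d\tilde\phi+\sum_I(\zeta^Id\tilde\zeta_I-\tilde\zeta_Id\zeta^I)\big)^2+\tfrac{1}{2\rho}\sum\mathcal{I}_{IJ}d\zeta^Id\zeta^J+\tfrac{1}{2\rho}\sum\mathcal{I}^{IJ}(d\tilde\zeta_I+\mathcal{R}_{IK}d\zeta^K)(d\tilde\zeta_J+\mathcal{R}_{JL}d\zeta^L).$$ With $h_\mu,h_{\mu\nu},h_{\mu\nu\sigma}$ the partial derivatives of $h$ at $x=\mathrm{Im}X$: (1) $scal_{\bar M}$ denotes the function $scal_{\bar M}=-2n(n+1)+\frac{1}{32h^2}\sum h_{\alpha\beta\gamma}\mathcal{K}^{\alpha\alpha'}\mathcal{K}^{\beta\beta'}\mathcal{K}^{\gamma\gamma'}h_{\alpha'\beta'\gamma'}$. (2) $\|R_{\bar M}\|^2$ is the squared pointwise norm (full contraction, $R_{ijkl}R^{ijkl}$) of the Riemann curvature tensor of $g_{\bar M}$; $\|R\|^2$ is likewise the full contraction for $g_{\bar N}$. (3) Let $(e^a_\mu)$ be a real matrix-valued function with $\sum_ae^a_\mu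 e^a_\nu=\mathcal{K}_{\mu\bar\nu}$, $(e^\mu_a)$ its inverse, $\tilde h_a=\sum e^\mu_ah_\mu$, $\tilde h_{ab}=\sum e^\mu_ae^\nu_bh_{\mu\nu}$, $\tilde h_{abc}=\sum e^\mu_ae^\nu_be^\sigma_ch_{\mu\nu\sigma}$. Then (summing over $f=1,\ldots,n$) $$S_{abcd}=-\tfrac12e^{2\mathcal{K}}\big((\tilde h_{bcf}\tilde h_{fad}-4\tilde h_{bc}\tilde h_{ad})+(\tilde h_{acf}\tilde h_{fbd}-4\tilde h_{ac}\tilde h_{bd})+(\tilde h_{abf}\tilde h_{fcd}-4\tilde h_{ab}\tilde h_{cd})+4\tilde h_a\tilde h_{bcd}+4\tilde h_b\tilde h_{cda}+4\tilde h_c\tilde h_{dab}+4\tilde h_d\tilde h_{abc}\big).$$ *)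

theory Defs
  imports "HOL-Analysis.Analysis"
begin

section \<open>Riemannian geometry on open subsets of a Euclidean space\<close>

definition dderiv :: "'a \<Rightarrow> ('a::real_normed_vector \<Rightarrow> 'b::real_normed_vector) \<Rightarrow> 'a \<Rightarrow> 'b"
  where "dderiv v f x = frechet_derivative f (at x) v"

text \<open>A metric is a map \<open>g\<close> sending a point to a bilinear form on the ambient space; the vectors
  in \<^term>\<open>Basis\<close> serve as the coordinate indices. For nondegenerate \<open>g p\<close>, the map
  \<open>v \<mapsto> (\<Sum>b\<in>Basis. g p v b *\<^sub>R b)\<close> is the linear map whose matrix is \<open>(g\<^sub>i\<^sub>j)\<close>,
  so \<open>metric_inv g p i j\<close> is the entry \<open>g\<^sup>i\<^sup>j\<close> of the inverse matrix.\<close>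

type_synonym 'a metric = "'a \<Rightarrow> 'a \<Rightarrow> 'a \<Rightarrow> real"

definition metric_inv :: "'a::euclidean_space metric \<Rightarrow> 'a \<Rightarrow> 'a \<Rightarrow> 'a \<Rightarrow> real"
  where "metric_inv g p i j = inv (\<lambda>v. \<Sum>b\<in>Basis. g p v b *\<^sub>R b) i \<bullet> j"

text \<open>\<open>christoffel g k i j p\<close> is \<open>\<Gamma>\<^sup>k\<^sub>i\<^sub>j\<close> at \<open>p\<close>.\<close>

definition christoffel :: "'a::euclidean_space metric \<Rightarrow> 'a \<Rightarrow> 'a \<Rightarrow> 'a \<Rightarrow> 'a \<Rightarrow> real"
  where "christoffel g k i j p =
    (\<Sum>l\<in>Basis. metric_inv g p k l *
      (dderiv i (\<lambda>q. g q j l) p + dderiv j (\<lambda>q. g q i l) p - dderiv l (\<lambda>q. g q i j) p)) / 2"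

text \<open>\<open>riemann_up g l k i j p\<close> is the component \<open>R\<^sup>l\<^sub>k\<^sub>i\<^sub>j\<close>, i.e. \<open>R(\<partial>\<^sub>i,\<partial>\<^sub>j)\<partial>\<^sub>k = (\<Sum>l. R\<^sup>l\<^sub>k\<^sub>i\<^sub>j \<partial>\<^sub>l)\<close>
  for the Levi-Civita connection.\<close>

definition riemann_up ::
    "'a::euclidean_space metric \<Rightarrow> 'a \<Rightarrow> 'a \<Rightarrow> 'a \<Rightarrow> 'a \<Rightarrow> 'a \<Rightarrow> real"
  where "riemann_up g l k i j p =
    dderiv i (christoffel g l j k) p - dderiv j (christoffel g l i k) p +
    (\<Sum>m\<in>Basis. christoffel g l i m p * christoffel g m j k p -
                christoffel g l j m p * christoffel g m i k p)"

definition riemann ::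
    "'a::euclidean_space metric \<Rightarrow> 'a \<Rightarrow> 'a \<Rightarrow> 'a \<Rightarrow> 'a \<Rightarrow> 'a \<Rightarrow> real"
  where "riemann g l k i j p = (\<Sum>m\<in>Basis. g p l m * riemann_up g m k i j p)"

definition riemann_norm_sq :: "'a::euclidean_space metric \<Rightarrow> 'a \<Rightarrow> real"
  where "riemann_norm_sq g p =
    (\<Sum>i\<in>Basis. \<Sum>j\<in>Basis. \<Sum>k\<in>Basis. \<Sum>l\<in>Basis.
     \<Sum>i'\<in>Basis. \<Sum>j'\<in>Basis. \<Sum>k'\<in>Basis. \<Sum>l'\<in>Basis.
       riemann g i j k l p * riemann g i' j' k' l' p *
       metric_inv g p i i' * metric_inv g p j j' * metric_inv g p k k' * metric_inv g p l l')"

text \<open>The product \<open>\<alpha>\<beta> = (\<alpha> \<otimes> \<beta> + \<beta> \<otimes> \<alpha>) / 2\<close> of one-forms.\<close>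

definition form_prod :: "('a \<Rightarrow> 'b::field) \<Rightarrow> ('a \<Rightarrow> 'b) \<Rightarrow> 'a \<Rightarrow> 'a \<Rightarrow> 'b"
  where "form_prod \<alpha> \<beta> v w = (\<alpha> v * \<beta> w + \<beta> v * \<alpha> w) / 2"


section \<open>Hypersurfaces\<close>

text \<open>\<open>C\<^sup>\<infinity>\<close> functions on an open set: all iterated partial derivatives exist and are differentiable
  (hence continuous).\<close>

coinductive smooth_on :: "'a::euclidean_space set \<Rightarrow> ('a \<Rightarrow> real) \<Rightarrow> bool" for V where
  "(\<And>x. x \<in> V \<Longrightarrow> f differentiable (at x)) \<Longrightarrow> (\<And>b. b \<in> Basis \<Longrightarrow> smooth_on V (dderiv b f)) \<Longrightarrow>
    smooth_on V f"

text \<open>Smooth embedded submanifolds of codimension one, as local zero sets of submersions.\<close>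

definition hypersurface :: "'a::euclidean_space set \<Rightarrow> bool"
  where "hypersurface H \<longleftrightarrow>
    (\<forall>p\<in>H. \<exists>V f. open V \<and> p \<in> V \<and> smooth_on V f \<and>
      (\<forall>x\<in>V. \<exists>v. dderiv v f x \<noteq> 0) \<and> H \<inter> V = {x\<in>V. f x = 0})"

text \<open>Velocities at time \<open>0\<close> of curves in \<open>H\<close> through \<open>p\<close>. For a submanifold \<open>H\<close>, requiring the
  curves to be differentiable at \<open>0\<close> only gives the same vectors as smooth curves do.\<close>

definition tangent_space :: "'a::real_normed_vector set \<Rightarrow> 'a \<Rightarrow> 'a set"
  where "tangent_space H p =
    {v. \<exists>\<gamma>. \<gamma> 0 = p \<and> (\<forall>\<^sub>F t in nhds (0::real). \<gamma> t \<in> H) \<and> (\<gamma> has_vector_derivative v) (at 0)}"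


section \<open>The r-map\<close>

text \<open>The homogeneous cubic polynomial with coefficients \<open>c\<close>, evaluated at real or complex
  arguments. Every homogeneous cubic polynomial is of this form; \<open>c\<close> need not be symmetric.\<close>

definition cubic :: "('n::finite \<Rightarrow> 'n \<Rightarrow> 'n \<Rightarrow> real) \<Rightarrow> 'a::real_normed_field ^ 'n \<Rightarrow> 'a"
  where "cubic c x = (\<Sum>i\<in>UNIV. \<Sum>j\<in>UNIV. \<Sum>k\<in>UNIV. of_real (c i j k) * x $ i * x $ j * x $ k)"

definition cubic1 :: "('n::finite \<Rightarrow> 'n \<Rightarrow> 'n \<Rightarrow> real) \<Rightarrow> 'n \<Rightarrow> real ^ 'n \<Rightarrow> real"
  where "cubic1 c \<mu> = dderiv (axis \<mu> 1) (cubic c)"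

definition cubic2 :: "('n::finite \<Rightarrow> 'n \<Rightarrow> 'n \<Rightarrow> real) \<Rightarrow> 'n \<Rightarrow> 'n \<Rightarrow> real ^ 'n \<Rightarrow> real"
  where "cubic2 c \<mu> \<nu> = dderiv (axis \<mu> 1) (cubic1 c \<nu>)"

definition cubic3 :: "('n::finite \<Rightarrow> 'n \<Rightarrow> 'n \<Rightarrow> real) \<Rightarrow> 'n \<Rightarrow> 'n \<Rightarrow> 'n \<Rightarrow> real ^ 'n \<Rightarrow> real"
  where "cubic3 c \<mu> \<nu> \<sigma> = dderiv (axis \<mu> 1) (cubic2 c \<nu> \<sigma>)"

definition projective_special_real ::
    "('n::finite \<Rightarrow> 'n \<Rightarrow> 'n \<Rightarrow> real) \<Rightarrow> (real ^ 'n) set \<Rightarrow> bool"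
  where "projective_special_real c H \<longleftrightarrow>
    hypersurface H \<and> H \<subseteq> {x. cubic c x = 1} \<and>
    (\<forall>p\<in>H. \<forall>v\<in>tangent_space H p. v \<noteq> 0 \<longrightarrow> - dderiv v (dderiv v (cubic c)) p > 0)"

definition cone :: "(real ^ 'n) set \<Rightarrow> (real ^ 'n) set"
  where "cone H = {r *\<^sub>R p | r p. r > 0 \<and> p \<in> H}"

definition Im_vec :: "complex ^ 'n \<Rightarrow> real ^ 'n"
  where "Im_vec X = (\<chi> \<mu>. Im (X $ \<mu>))"

definition r_manifold :: "(real ^ 'n) set \<Rightarrow> (complex ^ 'n) set"
  where "r_manifold H = {X. Im_vec X \<in> cone H}"

definition kaehler_potential :: "('n::finite \<Rightarrow> 'n \<Rightarrow> 'n \<Rightarrow> real) \<Rightarrow> complex ^ 'n \<Rightarrow> real"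
  where "kaehler_potential c X = - ln (8 * cubic c (Im_vec X))"

text \<open>The Wirtinger operators \<open>\<partial>/\<partial>X\<^sup>\<mu> = (\<partial>/\<partial>y\<^sup>\<mu> - \<i> \<partial>/\<partial>x\<^sup>\<mu>) / 2\<close> and
  its conjugate, where \<open>X\<^sup>\<mu> = y\<^sup>\<mu> + \<i> x\<^sup>\<mu>\<close>.\<close>

definition wirtinger :: "'n::finite \<Rightarrow> (complex ^ 'n \<Rightarrow> complex) \<Rightarrow> complex ^ 'n \<Rightarrow> complex"
  where "wirtinger \<mu> f X = (dderiv (axis \<mu> 1) f X - \<i> * dderiv (axis \<mu> \<i>) f X) / 2"

definition wirtinger_bar :: "'n::finite \<Rightarrow> (complex ^ 'n \<Rightarrow> complex) \<Rightarrow> complex ^ 'n \<Rightarrow> complex"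
  where "wirtinger_bar \<mu> f X = (dderiv (axis \<mu> 1) f X + \<i> * dderiv (axis \<mu> \<i>) f X) / 2"

text \<open>The matrix \<open>\<partial>\<^sup>2\<K>/\<partial>X\<^sup>\<mu>\<partial>X\<^sup>\<nu>\<close> (second derivative conjugated) is real because \<open>\<K>\<close> depends
  on the imaginary parts of the coordinates only.\<close>

definition kaehler_matrix :: "('n::finite \<Rightarrow> 'n \<Rightarrow> 'n \<Rightarrow> real) \<Rightarrow> complex ^ 'n \<Rightarrow> real ^ 'n ^ 'n"
  where "kaehler_matrix c X =
    (\<chi> \<mu> \<nu>. Re (wirtinger \<mu> (wirtinger_bar \<nu> (\<lambda>Y. complex_of_real (kaehler_potential c Y))) X))"

text \<open>Single terms of the sum need not be real-valued on tangent vectors, but the sum is, by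
  symmetry of the matrix.\<close>

definition r_metric :: "('n::finite \<Rightarrow> 'n \<Rightarrow> 'n \<Rightarrow> real) \<Rightarrow> (complex ^ 'n) metric"
  where "r_metric c X v w =
    Re (\<Sum>\<mu>\<in>UNIV. \<Sum>\<nu>\<in>UNIV. of_real (kaehler_matrix c X $ \<mu> $ \<nu>) *
      form_prod (\<lambda>v. v $ \<mu>) (\<lambda>v. cnj (v $ \<nu>)) v w)"

definition r_scal :: "('n::finite \<Rightarrow> 'n \<Rightarrow> 'n \<Rightarrow> real) \<Rightarrow> complex ^ 'n \<Rightarrow> real"
  where "r_scal c X =
    (let n = real CARD('n); x = Im_vec X; K' = matrix_inv (kaehler_matrix c X) in
      - 2 * n * (n + 1) + 1 / (32 * (cubic c x)\<^sup>2) *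
        (\<Sum>\<alpha>\<in>UNIV. \<Sum>\<beta>\<in>UNIV. \<Sum>\<gamma>\<in>UNIV. \<Sum>\<alpha>'\<in>UNIV. \<Sum>\<beta>'\<in>UNIV. \<Sum>\<gamma>'\<in>UNIV.
          cubic3 c \<alpha> \<beta> \<gamma> x * K' $ \<alpha> $ \<alpha>' * K' $ \<beta> $ \<beta>' * K' $ \<gamma> $ \<gamma>' * cubic3 c \<alpha>' \<beta>' \<gamma>' x))"


section \<open>The q-map\<close>

text \<open>The index set \<open>{0,\<dots>,n}\<close> is \<^typ>\<open>'n option\<close>, with \<^term>\<open>None\<close> in the role of \<open>0\<close>.\<close>

definition cpartial :: "'m::finite \<Rightarrow> (complex ^ 'm \<Rightarrow> complex) \<Rightarrow> complex ^ 'm \<Rightarrow> complex"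
  where "cpartial I f z = deriv (\<lambda>t. f (z + t *s axis I 1)) 0"

definition prepotential ::
    "('n::finite \<Rightarrow> 'n \<Rightarrow> 'n \<Rightarrow> real) \<Rightarrow> complex ^ ('n option) \<Rightarrow> complex"
  where "prepotential c z = cubic c (\<chi> \<mu>. z $ Some \<mu>) / z $ None"

definition prepotential2 ::
    "('n::finite \<Rightarrow> 'n \<Rightarrow> 'n \<Rightarrow> real) \<Rightarrow> complex ^ ('n option) \<Rightarrow> 'n option \<Rightarrow> 'n option \<Rightarrow> complex"
  where "prepotential2 c z I J = cpartial I (cpartial J (prepotential c)) z"

definition inhom_point :: "complex ^ 'n::finite \<Rightarrow> complex ^ ('n option)"
  where "inhom_point X = (\<chi> I. case I of None \<Rightarrow> 1 | Some \<mu> \<Rightarrow> X $ \<mu>)"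

text \<open>\<open>period_matrix\<close> is \<open>\<R> + \<i> \<I>\<close>.\<close>

definition period_matrix ::
    "('n::finite \<Rightarrow> 'n \<Rightarrow> 'n \<Rightarrow> real) \<Rightarrow> complex ^ 'n \<Rightarrow> complex ^ ('n option) ^ ('n option)"
  where "period_matrix c X =
    (let z = inhom_point X;
         N = (\<lambda>I J. complex_of_real (2 * Im (prepotential2 c z I J)))
     in \<chi> I J. cnj (prepotential2 c z I J) +
          \<i> * ((\<Sum>K\<in>UNIV. N I K * z $ K) * (\<Sum>L\<in>UNIV. N J L * z $ L)) /
            (\<Sum>K\<in>UNIV. \<Sum>L\<in>UNIV. N K L * z $ K * z $ L))"

definition period_re ::
    "('n::finite \<Rightarrow> 'n \<Rightarrow> 'n \<Rightarrow> real) \<Rightarrow> complex ^ 'n \<Rightarrow> real ^ ('n option) ^ ('n option)"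
  where "period_re c X = (\<chi> I J. Re (period_matrix c X $ I $ J))"

definition period_im ::
    "('n::finite \<Rightarrow> 'n \<Rightarrow> 'n \<Rightarrow> real) \<Rightarrow> complex ^ 'n \<Rightarrow> real ^ ('n option) ^ ('n option)"
  where "period_im c X = (\<chi> I J. Im (period_matrix c X $ I $ J))"

text \<open>Points, and tangent vectors, are tuples in the order
  \<open>(X, \<rho>, \<phi>, \<zeta>\<^sub>I, \<zeta>\<^sup>I)\<close>, where \<open>\<phi>\<close> and \<open>\<zeta>\<^sub>I\<close> are the coordinates carrying a tilde.\<close>

type_synonym 'n q_space =
  "(complex ^ 'n) \<times> real \<times> real \<times> (real ^ ('n option)) \<times> (real ^ ('n option))"

definition q_manifold :: "(real ^ 'n::finite) set \<Rightarrow> 'n q_space set"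
  where "q_manifold H = r_manifold H \<times> {0<..} \<times> UNIV \<times> UNIV \<times> UNIV"

definition dX :: "'n::finite q_space \<Rightarrow> complex ^ 'n"
  where "dX = (\<lambda>(X, \<rho>, \<phi>, \<zeta>t, \<zeta>). X)"

definition d\<rho> :: "'n::finite q_space \<Rightarrow> real"
  where "d\<rho> = (\<lambda>(X, \<rho>, \<phi>, \<zeta>t, \<zeta>). \<rho>)"

definition d\<phi> :: "'n::finite q_space \<Rightarrow> real"
  where "d\<phi> = (\<lambda>(X, \<rho>, \<phi>, \<zeta>t, \<zeta>). \<phi>)"

definition d\<zeta>t :: "'n option \<Rightarrow> 'n::finite q_space \<Rightarrow> real"
  where "d\<zeta>t I = (\<lambda>(X, \<rho>, \<phi>, \<zeta>t, \<zeta>). \<zeta>t $ I)"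

definition d\<zeta> :: "'n option \<Rightarrow> 'n::finite q_space \<Rightarrow> real"
  where "d\<zeta> I = (\<lambda>(X, \<rho>, \<phi>, \<zeta>t, \<zeta>). \<zeta> $ I)"

definition q_metric :: "('n::finite \<Rightarrow> 'n \<Rightarrow> 'n \<Rightarrow> real) \<Rightarrow> 'n q_space metric"
  where "q_metric c = (\<lambda>(X, \<rho>, \<phi>, \<zeta>t, \<zeta>) v w.
    (let R = period_re c X; I = period_im c X; I' = matrix_inv I;
         \<eta> = (\<lambda>u. d\<phi> u + (\<Sum>A\<in>UNIV. \<zeta> $ A * d\<zeta>t A u - \<zeta>t $ A * d\<zeta> A u));
         \<theta> = (\<lambda>A u. d\<zeta>t A u + (\<Sum>K\<in>UNIV. R $ A $ K * d\<zeta> K u))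
     in r_metric c X (dX v) (dX w) +
        1 / (4 * \<rho>\<^sup>2) * form_prod d\<rho> d\<rho> v w +
        1 / (4 * \<rho>\<^sup>2) * form_prod \<eta> \<eta> v w +
        1 / (2 * \<rho>) * (\<Sum>A\<in>UNIV. \<Sum>B\<in>UNIV. I $ A $ B * form_prod (d\<zeta> A) (d\<zeta> B) v w) +
        1 / (2 * \<rho>) * (\<Sum>A\<in>UNIV. \<Sum>B\<in>UNIV. I' $ A $ B * form_prod (\<theta> A) (\<theta> B) v w)))"


section \<open>The tensor \<open>S\<close>\<close>

text \<open>For a frame \<open>e\<close>, the entry \<open>e $ a $ \<mu>\<close> is \<open>e\<^sup>a\<^sub>\<mu>\<close>, and \<open>matrix_inv e $ \<mu> $ a\<close> is \<open>e\<^sup>\<mu>\<^sub>a\<close>.\<close>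

definition frame1 ::
    "('n::finite \<Rightarrow> 'n \<Rightarrow> 'n \<Rightarrow> real) \<Rightarrow> real ^ 'n ^ 'n \<Rightarrow> real ^ 'n \<Rightarrow> 'n \<Rightarrow> real"
  where "frame1 c e x a = (\<Sum>\<mu>\<in>UNIV. matrix_inv e $ \<mu> $ a * cubic1 c \<mu> x)"

definition frame2 ::
    "('n::finite \<Rightarrow> 'n \<Rightarrow> 'n \<Rightarrow> real) \<Rightarrow> real ^ 'n ^ 'n \<Rightarrow> real ^ 'n \<Rightarrow> 'n \<Rightarrow> 'n \<Rightarrow> real"
  where "frame2 c e x a b =
    (\<Sum>\<mu>\<in>UNIV. \<Sum>\<nu>\<in>UNIV. matrix_inv e $ \<mu> $ a * matrix_inv e $ \<nu> $ b * cubic2 c \<mu> \<nu> x)"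

definition frame3 ::
    "('n::finite \<Rightarrow> 'n \<Rightarrow> 'n \<Rightarrow> real) \<Rightarrow> real ^ 'n ^ 'n \<Rightarrow> real ^ 'n \<Rightarrow> 'n \<Rightarrow> 'n \<Rightarrow> 'n \<Rightarrow> real"
  where "frame3 c e x a b d =
    (\<Sum>\<mu>\<in>UNIV. \<Sum>\<nu>\<in>UNIV. \<Sum>\<sigma>\<in>UNIV.
      matrix_inv e $ \<mu> $ a * matrix_inv e $ \<nu> $ b * matrix_inv e $ \<sigma> $ d * cubic3 c \<mu> \<nu> \<sigma> x)"

definition S_tensor ::
    "('n::finite \<Rightarrow> 'n \<Rightarrow> 'n \<Rightarrow> real) \<Rightarrow> real ^ 'n ^ 'n \<Rightarrow> complex ^ 'n \<Rightarrow> 'n \<Rightarrow> 'n \<Rightarrow> 'n \<Rightarrow> 'n \<Rightarrow> real"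
  where "S_tensor c e X i j k l =
    (let h1 = frame1 c e (Im_vec X); h2 = frame2 c e (Im_vec X); h3 = frame3 c e (Im_vec X) in
      - (1 / 2) * exp (2 * kaehler_potential c X) *
      (((\<Sum>f\<in>UNIV. h3 j k f * h3 f i l) - 4 * h2 j k * h2 i l) +
       ((\<Sum>f\<in>UNIV. h3 i k f * h3 f j l) - 4 * h2 i k * h2 j l) +
       ((\<Sum>f\<in>UNIV. h3 i j f * h3 f k l) - 4 * h2 i j * h2 k l) +
       4 * h1 i * h3 j k l + 4 * h1 j * h3 k l i + 4 * h1 k * h3 l i j + 4 * h1 l * h3 i j k))"

end

theory Submission imports Defs begin

text \<open>
  Below, \<open>N\<close> is the manifold in the image of the q-map and \<open>M\<close> the one in the image of the r-map.
  Every tensor in the statement is determined, in a suitable frame, by \<open>x = Im X\<close>, and is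
  polynomial in three pieces of data on \<open>\<real>\<^sup>n\<close>: the scalar product \<open>K\<close> given by \<open>\<K>\<^sub>\<mu>\<^sub>\<nu>\<close>, the
  commutative product \<open>m\<close> that comes from the third derivatives of \<open>h\<close> by raising an index with \<open>K\<close>,
  and the vector \<open>x\<close> itself. Homogeneity of \<open>h\<close> is the pair of relations \<open>K(x,x) = 3/4\<close> and
  \<open>m(x,u) = 2K(x,u)x - u/2\<close>. The locale \<open>cubic_jet\<close> collects these data; nothing else is needed for the
  curvature at a point.

  The proof uses Cartan's method of moving frames. A frame \<open>e\<^sub>q\<close> identifies the tangent space of
  \<open>N\<close> at \<open>q\<close> with \<open>W\<^sup>4\<close>, where \<open>W = \<real> \<oplus> \<real>\<^sup>n\<close> carries the scalar product
  \<open>u\<^sub>0v\<^sub>0 + K(u,v)\<close>. It is chosen such that the metric becomes the orthogonal sum of four copies of this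
  scalar product, and such that the Levi-Civita connection is quaternionic: it is built from
  endomorphisms of \<open>W\<close>, combined with left multiplication by the units of the quaternions, plus right
  multiplication by imaginary quaternions (the \<open>sp(1)\<close> part). That such a
  connection \<open>conn\<close> is the Levi-Civita connection amounts to two facts: it is metric
  (\<open>conn_compatible\<close>) and the frame has torsion zero with respect to it
  (\<open>torsion_qframe\<close>). The lemma \<open>riemann_norm_sq_eq\<close> then turns the norm of the Riemann tensor
  of the statement, which is defined through Christoffel symbols in coordinates, into a sum of squares
  of components of the curvature of \<open>conn\<close>.

  The curvature between different slots of \<open>W\<^sup>4\<close> is again a left unit times an endomorphism
  of \<open>W\<close>, plus a right unit times the scalar product; between equal slots it is an endomorphism of \<open>W\<close> (\<open>curv_frame_sectors\<close>). There are four
  types of endomorphisms, \<open>curv0\<close> to \<open>curv3\<close>. The right units are orthogonal to the left ones and contribute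
  \<open>48(n+1)\<^sup>2\<close>; the endomorphisms contribute sixteen times their squared norms. The restrictions of
  \<open>curv0\<close> and \<open>curv1\<close> to \<open>\<real>\<^sup>n\<close> are, up to a multiple of the identity,
  the two blocks of the curvature tensor of
  \<open>M\<close>, which is obtained from the same method with the frame \<open>\<real>\<^sup>n \<oplus> \<real>\<^sup>n\<close>.
  The restrictions of \<open>curv2\<close> and \<open>curv3\<close> are \<open>\<kappa> \<plusminus> \<sigma>\<close>. Here \<open>\<kappa>\<close> has the
  components \<open>K(m(f\<^sub>a,f\<^sub>b), m(f\<^sub>c,f\<^sub>d))\<close>, and \<open>\<sigma>\<close> is the totally symmetric tensor
  \<open>-2S\<close>. The mixed terms cancel in \<open>|\<kappa> + \<sigma>|\<^sup>2 + |\<kappa> - \<sigma>|\<^sup>2\<close>, and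
  \<open>|\<kappa>|\<^sup>2\<close> is absorbed into \<open>\<parallel>R\<^sub>M\<parallel>\<^sup>2\<close>, because the blocks of that tensor are sums of
  permutations of \<open>\<kappa>\<close> and products of Kronecker deltas. What remains is a polynomial in \<open>n\<close> and the
  squared norm of the cubic form, and the latter is expressed by \<open>scal\<close> (\<open>frame_norm_formula\<close>).

  The geometry enters at three more places: on the cone over a projective special real
  manifold \<open>K\<close> is positive definite (\<open>cone_subset_regular\<close>); the period matrix has a closed form
  (\<open>period_matrix_eq\<close>), from which the pullback of the metric by the frame is computed
  (\<open>q_metric_qframe\<close>); and \<open>S\<close> in an orthonormal frame is \<open>-\<sigma>/2\<close> (\<open>S_tensor_frame\<close>).
\<close>

section \<open>Derivatives of families of linear maps\<close>

text \<open>Uniqueness of derivatives transports linearity from the maps \<open>L q\<close> to their derivative.\<close>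
lemma has_derivative_linear_family_linear:
  fixes L :: "'a::euclidean_space \<Rightarrow> 'b::euclidean_space \<Rightarrow> 'c::real_normed_vector"
  assumes O: "open Op" "p \<in> Op" and lin: "\<And>q. q \<in> Op \<Longrightarrow> linear (L q)"
    and D: "\<And>u. ((\<lambda>q. L q u) has_derivative (\<lambda>v. DL v u)) (at p)"
  shows "linear (DL v)"
proof
  fix a b :: 'b and r :: real
  have "((\<lambda>q. L q a + L q b) has_derivative (\<lambda>v. DL v a + DL v b)) (at p)"
    by (intro derivative_intros D)
  then have "((\<lambda>q. L q (a + b)) has_derivative (\<lambda>v. DL v a + DL v b)) (at p)"
    by (rule has_derivative_transform_within_open[OF _ O]) (simp add: linear_add[OF lin])
  from has_derivative_unique[OF this D] show "DL v (a + b) = DL v a + DL v b" by metis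
  have "((\<lambda>q. r *\<^sub>R L q a) has_derivative (\<lambda>v. r *\<^sub>R DL v a)) (at p)"
    by (intro derivative_intros D)
  then have "((\<lambda>q. L q (r *\<^sub>R a)) has_derivative (\<lambda>v. r *\<^sub>R DL v a)) (at p)"
    by (rule has_derivative_transform_within_open[OF _ O]) (simp add: linear_scale[OF lin])
  from has_derivative_unique[OF this D] show "DL v (r *\<^sub>R a) = r *\<^sub>R DL v a" by metis
qed

text \<open>Pointwise differentiability of \<open>q \<mapsto> L q u\<close> is enough for the product rule, since \<open>L q (f q)\<close> is
  a finite sum of products after expansion of \<open>f q\<close> in a basis.\<close>
lemma has_derivative_linear_family:
  fixes L :: "'a::euclidean_space \<Rightarrow> 'b::euclidean_space \<Rightarrow> 'c::real_normed_vector"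
  assumes O: "open Op" "p \<in> Op" and lin: "\<And>q. q \<in> Op \<Longrightarrow> linear (L q)"
    and D: "\<And>u. ((\<lambda>q. L q u) has_derivative (\<lambda>v. DL v u)) (at p)"
    and f: "(f has_derivative Df) (at p)"
  shows "((\<lambda>q. L q (f q)) has_derivative (\<lambda>v. DL v (f p) + L p (Df v))) (at p)"
proof -
  note linD = has_derivative_linear_family_linear[OF O lin D]
  have expand: "T u = (\<Sum>b\<in>Basis. (u \<bullet> b) *\<^sub>R T b)" if "linear T" for T :: "'b \<Rightarrow> 'c" and u
    by (subst euclidean_representation[of u, symmetric])
       (simp only: linear_sum[OF that] linear_scale[OF that])
  have "((\<lambda>q. \<Sum>b\<in>Basis. (f q \<bullet> b) *\<^sub>R L q b) has_derivative
      (\<lambda>v. \<Sum>b\<in>Basis. (f p \<bullet> b) *\<^sub>R DL v b + (Df v \<bullet> b) *\<^sub>R L p b)) (at p)"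
    by (intro has_derivative_sum has_derivative_scaleR D has_derivative_inner_left f)
  then have "((\<lambda>q. \<Sum>b\<in>Basis. (f q \<bullet> b) *\<^sub>R L q b) has_derivative
      (\<lambda>v. DL v (f p) + L p (Df v))) (at p)"
    by (simp add: sum.distrib expand[OF linD, of _ "f p"] expand[OF lin[OF O(2)], of "Df _"])
  then show ?thesis
    by (rule has_derivative_transform_within_open[OF _ O]) (simp add: expand[OF lin, symmetric])
qed

lemma has_derivative_bilinear_family:
  fixes B :: "'a::euclidean_space \<Rightarrow> 'b::euclidean_space \<Rightarrow> 'c::euclidean_space \<Rightarrow> 'd::real_normed_vector"
  assumes O: "open Op" "p \<in> Op" and bil: "\<And>q. q \<in> Op \<Longrightarrow> bilinear (B q)"
    and D: "\<And>u w. ((\<lambda>q. B q u w) has_derivative (\<lambda>v. DB v u w)) (at p)"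
    and f: "(f has_derivative Df) (at p)" and g: "(g has_derivative Dg) (at p)"
  shows "((\<lambda>q. B q (f q) (g q)) has_derivative
    (\<lambda>v. DB v (f p) (g p) + B p (Df v) (g p) + B p (f p) (Dg v))) (at p)"
proof -
  have "((\<lambda>q. B q (f q) w) has_derivative (\<lambda>v. DB v (f p) w + B p (Df v) w)) (at p)" for w
    by (rule has_derivative_linear_family[OF O, of "\<lambda>q u. B q u w"])
       (use bil D f in \<open>auto simp: bilinear_def\<close>)
  from has_derivative_linear_family[where L = "\<lambda>q. B q (f q)", OF O _ this g]
  show ?thesis using bil by (simp add: bilinear_def add.assoc)
qed

text \<open>The formula \<open>d(L\<^sup>-\<^sup>1) = - L\<^sup>-\<^sup>1 (dL) L\<^sup>-\<^sup>1\<close>. The derivative of \<open>q \<mapsto> L q u\<close> controls \<open>L q - L p\<close>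
  uniformly on the unit ball, because it does so on a basis; hence the inverses are bounded near \<open>p\<close>,
  and the remainder of \<open>N q w\<close> is \<open>N q\<close> applied to the remainder of \<open>L q (N p w)\<close>, up to a term of
  second order.\<close>
lemma has_derivative_inverse_family:
  fixes L :: "'a::euclidean_space \<Rightarrow> 'b::euclidean_space \<Rightarrow> 'c::euclidean_space"
  assumes O: "open Op" "p \<in> Op" and lin: "\<And>q. q \<in> Op \<Longrightarrow> linear (L q)"
    and NL: "\<And>q u. q \<in> Op \<Longrightarrow> N q (L q u) = u" and LN: "\<And>q w. q \<in> Op \<Longrightarrow> L q (N q w) = w"
    and D: "\<And>u. ((\<lambda>q. L q u) has_derivative (\<lambda>v. DL v u)) (at p)"
  shows "((\<lambda>q. N q w) has_derivative (\<lambda>v. - N p (DL v (N p w)))) (at p)"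
proof -
  have linN: "linear (N q)" if "q \<in> Op" for q
  proof
    fix x y :: 'c and r :: real
    have "L q (N q x + N q y) = x + y" "L q (r *\<^sub>R N q x) = r *\<^sub>R x"
      by (simp_all add: linear_add[OF lin[OF that]] linear_scale[OF lin[OF that]] LN[OF that])
    then show "N q (x + y) = N q x + N q y" "N q (r *\<^sub>R x) = r *\<^sub>R N q x"
      by (metis NL[OF that])+
  qed
  obtain B where B: "B > 0" "\<And>w. norm (N p w) \<le> B * norm w"
    using linear_bounded_pos[OF linN[OF O(2)]] by blast
  \<comment> \<open>This sum over the basis bounds the operator norm of \<open>L q - L p\<close>.\<close>
  define \<delta> where "\<delta> q = (\<Sum>b\<in>Basis. norm (L q b - L p b))" for q
  have \<delta>0: "\<delta> q \<ge> 0" for q by (simp add: \<delta>_def sum_nonneg)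
  have \<delta>: "norm (L q u - L p u) \<le> norm u * \<delta> q" if q: "q \<in> Op" for q u
  proof -
    have e: "T u = (\<Sum>b\<in>Basis. (u \<bullet> b) *\<^sub>R T b)" if "linear T" for T :: "'b \<Rightarrow> 'c"
      by (subst euclidean_representation[of u, symmetric])
         (simp only: linear_sum[OF that] linear_scale[OF that])
    have "L q u - L p u = (\<Sum>b\<in>Basis. (u \<bullet> b) *\<^sub>R (L q b - L p b))"
      by (simp add: scaleR_diff_right sum_subtractf e[OF lin[OF q], symmetric]
        e[OF lin[OF O(2)], symmetric])
    also have "norm \<dots> \<le> (\<Sum>b\<in>Basis. norm u * norm (L q b - L p b))"
      by (rule sum_norm_le) (simp add: Basis_le_norm mult_right_mono)
    finally show ?thesis by (simp add: \<delta>_def sum_distrib_left)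
  qed
  have cont: "(\<lambda>q. L q u) \<midarrow>p\<rightarrow> L p u" for u
    using has_derivative_continuous[OF D, of u] by (simp add: isCont_def continuous_def)
  have "((\<lambda>q. \<delta> q) \<longlongrightarrow> (\<Sum>b\<in>(Basis::'b set). norm (L p b - L p b))) (at p)"
    unfolding \<delta>_def by (intro tendsto_intros cont)
  then have \<delta>lim: "(\<delta> \<longlongrightarrow> 0) (at p)" by simp
  then have "\<forall>\<^sub>F q in at p. \<delta> q < 1 / (2 * B)"
    using B(1) by (intro order_tendstoD) auto
  moreover have evO: "\<forall>\<^sub>F q in at p. q \<in> Op"
    using O eventually_at_in_open' by blast
  ultimately have bound: "\<forall>\<^sub>F q in at p. q \<in> Op \<and> (\<forall>w. norm (N q w) \<le> 2 * B * norm w)"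
  proof eventually_elim
    case (elim q)
    have "norm (N q w) \<le> 2 * B * norm w" for w
    proof -
      let ?u = "N q w"
      have "norm ?u = norm (N p (L p ?u))" using NL[OF O(2)] by simp
      also have "\<dots> \<le> B * norm (L p ?u)" by (rule B)
      also have "norm (L p ?u) \<le> norm (L q ?u) + norm (L q ?u - L p ?u)"
        using norm_triangle_sub[of "L p ?u" "L q ?u"] by (simp add: norm_minus_commute)
      also have "\<dots> \<le> norm w + norm ?u * \<delta> q"
        using \<delta>[OF elim(2), of ?u] LN[OF elim(2)] by simp
      also have "norm ?u * \<delta> q \<le> norm ?u * (1 / (2 * B))"
        using elim(1) by (intro mult_left_mono) auto
      finally show ?thesis using B(1) by (simp add: field_simps)
    qed
    then show ?case using elim(2) by blast
  qed
  define y where "y = N p w"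
  define Dg where "Dg v = DL v y" for v
  have Dg: "((\<lambda>q. L q y) has_derivative Dg) (at p)" unfolding Dg_def[abs_def] by (rule D)
  from Dg have blDg: "bounded_linear Dg" by (rule has_derivative_bounded_linear)
  then obtain B' where B': "\<And>v. norm (Dg v) \<le> norm v * B'" "B' > 0"
    using bounded_linear.pos_bounded by blast
  define rem where "rem q = L q y - L p y - Dg (q - p)" for q
  have remlim: "((\<lambda>q. norm (rem q) / norm (q - p)) \<longlongrightarrow> 0) (at p)"
    using Dg by (simp add: has_derivative_iff_norm rem_def)
  have "((\<lambda>q. norm (N q w - N p w - (- N p (Dg (q - p)))) / norm (q - p)) \<longlongrightarrow> 0) (at p)"
  proof (rule Lim_null_comparison)
    show "((\<lambda>q. 2 * B * (norm (rem q) / norm (q - p)) + 2 * B * (B * B') * \<delta> q) \<longlongrightarrow> 0) (at p)"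
      by (intro tendsto_add_zero tendsto_mult_right_zero remlim \<delta>lim)
    show "\<forall>\<^sub>F q in at p. norm (norm (N q w - N p w - (- N p (Dg (q - p)))) / norm (q - p))
        \<le> 2 * B * (norm (rem q) / norm (q - p)) + 2 * B * (B * B') * \<delta> q"
      using bound eventually_neq_at_within[of p]
    proof eventually_elim
      case (elim q)
      then have q: "q \<in> Op" and bq: "\<And>w. norm (N q w) \<le> 2 * B * norm w" and ne: "norm (q - p) > 0"
        by auto
      let ?z = "Dg (q - p)"
      have 1: "N q w - N p w = - N q (rem q) - N q ?z"
      proof -
        have "N q w = N q (L q y) - N q (rem q + ?z)"
          by (simp flip: linear_diff[OF linN[OF q]]) (simp add: rem_def y_def LN[OF O(2)])
        then show ?thesis by (simp add: NL[OF q] linear_add[OF linN[OF q]] y_def)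
      qed
      have 2: "N p ?z - N q ?z = N q (L q (N p ?z) - L p (N p ?z))"
        by (simp add: linear_diff[OF linN[OF q]] NL[OF q] LN[OF O(2)])
      have "norm (N q w - N p w - (- N p ?z)) = norm (N q (L q (N p ?z) - L p (N p ?z)) - N q (rem q))"
        by (simp only: 1 2[symmetric]) (simp add: algebra_simps)
      also have "\<dots> \<le> norm (N q (L q (N p ?z) - L p (N p ?z))) + norm (N q (rem q))"
        by (rule norm_triangle_ineq4)
      also have "\<dots> \<le> 2 * B * (norm (N p ?z) * \<delta> q) + 2 * B * norm (rem q)"
        using B(1) by (intro add_mono order_trans[OF bq] mult_left_mono \<delta>[OF q]) auto
      also have "norm (N p ?z) \<le> B * (norm (q - p) * B')"
        using B by (intro order_trans[OF B(2)] mult_left_mono B') auto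
      finally have "norm (N q w - N p w - (- N p ?z)) \<le>
          2 * B * (B * (norm (q - p) * B') * \<delta> q) + 2 * B * norm (rem q)"
        using B(1) \<delta>0[of q] by (simp add: mult_left_mono mult_right_mono)
      then have "norm (N q w - N p w - (- N p ?z)) / norm (q - p) \<le>
          (2 * B * (B * (norm (q - p) * B') * \<delta> q) + 2 * B * norm (rem q)) / norm (q - p)"
        by (rule divide_right_mono) simp
      also have "\<dots> = 2 * B * (norm (rem q) / norm (q - p)) + 2 * B * (B * B') * \<delta> q"
        using ne by (simp add: field_simps)
      finally show ?case by simp
    qed
  qed
  moreover have "bounded_linear (\<lambda>v. - N p (Dg v))"
    using bounded_linear_compose[OF _ blDg, of "N p"] linN[OF O(2)]
    by (intro bounded_linear_minus) (simp add: linear_conv_bounded_linear)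
  ultimately show ?thesis
    by (simp add: has_derivative_iff_norm Dg_def y_def)
qed

section \<open>The Riemann tensor in a moving frame\<close>

lemma dderiv_eq: "(f has_derivative D) (at x) \<Longrightarrow> dderiv v f x = D v"
  unfolding dderiv_def by (metis frechet_derivative_at)

lemma linear_Basis_expand:
  fixes T :: "'a::euclidean_space \<Rightarrow> 'b::real_vector"
  assumes "linear T"
  shows "T u = (\<Sum>b\<in>Basis. (u \<bullet> b) *\<^sub>R T b)"
  by (subst euclidean_representation[of u, symmetric])
     (simp only: linear_sum[OF assms] linear_scale[OF assms])

text \<open>A symmetric nondegenerate form of arbitrary signature, which is what the Levi-Civita connection requires.\<close>
definition scalar_product :: "('a::real_vector \<Rightarrow> 'a \<Rightarrow> real) \<Rightarrow> bool"
  where "scalar_product B \<longleftrightarrow>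
    bilinear B \<and> (\<forall>v w. B v w = B w v) \<and> (\<forall>v. (\<forall>w. B v w = 0) \<longrightarrow> v = 0)"

text \<open>Lowering of an index: \<open>flat_map B v\<close> represents the linear form \<open>B v\<close>. The inverse metric of the
  coordinate definitions is the matrix of the inverse of this map.\<close>
definition flat_map :: "('a::euclidean_space \<Rightarrow> 'a \<Rightarrow> real) \<Rightarrow> 'a \<Rightarrow> 'a"
  where "flat_map B v = (\<Sum>b\<in>Basis. B v b *\<^sub>R b)"

lemma flat_map_inner:
  assumes "bilinear B" shows "flat_map B v \<bullet> w = B v w"
proof -
  have "flat_map B v \<bullet> w = (\<Sum>b\<in>Basis. (w \<bullet> b) * B v b)"
    unfolding flat_map_def inner_sum_left by (simp add: inner_commute mult.commute)
  also have "\<dots> = B v w"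
    using assms linear_Basis_expand[of "B v" w] by (simp add: bilinear_def)
  finally show ?thesis .
qed

lemma metric_inv_flat_map:
  assumes g: "scalar_product (g p)"
  shows "metric_inv g p i j = inv (flat_map (g p)) i \<bullet> j"
    and "flat_map (g p) (inv (flat_map (g p)) i) = i"
proof -
  show "metric_inv g p i j = inv (flat_map (g p)) i \<bullet> j"
    by (simp add: metric_inv_def flat_map_def[abs_def])
  have bil: "bilinear (g p)" and nondeg: "(\<And>w. g p v w = 0) \<Longrightarrow> v = 0" for v
    using g by (auto simp: scalar_product_def)
  have lin: "linear (flat_map (g p))"
    using bil unfolding flat_map_def[abs_def] bilinear_def
    by (intro linear_compose_sum ballI linear_compose[OF _ linear_scaleR_left, unfolded o_def]) auto
  have "inj (flat_map (g p))"
    unfolding linear_injective_0[OF lin] using nondeg flat_map_inner[OF bil] by (metis inner_zero_left)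
  then have "surj (flat_map (g p))" using lin by (simp add: linear_injective_imp_surjective)
  then show "flat_map (g p) (inv (flat_map (g p)) i) = i" by (rule surj_f_inv_f)
qed

lemma sum_metric_inv_mult:
  assumes g: "scalar_product (g p)"
  shows "(\<Sum>l\<in>Basis. metric_inv g p k l * g p Y l) = Y \<bullet> k"
proof -
  have bil: "bilinear (g p)" and sym: "g p v w = g p w v" for v w
    using g by (auto simp: scalar_product_def)
  let ?y = "inv (flat_map (g p)) k"
  have "(\<Sum>l\<in>Basis. metric_inv g p k l * g p Y l) = (\<Sum>l\<in>Basis. (?y \<bullet> l) * g p Y l)"
    by (simp add: metric_inv_flat_map(1)[where g = g, OF g])
  also have "\<dots> = g p Y ?y"
    using bil linear_Basis_expand[of "g p Y" ?y] by (simp add: bilinear_def)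
  also have "\<dots> = flat_map (g p) ?y \<bullet> Y" by (simp add: flat_map_inner[OF bil] sym)
  finally show ?thesis by (simp add: metric_inv_flat_map(2)[where g = g, OF g] inner_commute)
qed

text \<open>The inverse metric is \<open>\<Sum>\<^sub>\<alpha> f\<^sub>\<alpha> \<otimes> f\<^sub>\<alpha>\<close> for every family with the completeness property of an
  orthonormal basis.\<close>
lemma metric_inv_complete_family:
  assumes g: "scalar_product (g p)"
    and complete: "\<And>v. (\<Sum>\<alpha>\<in>A. g p v (f \<alpha>) *\<^sub>R f \<alpha>) = v"
  shows "metric_inv g p i j = (\<Sum>\<alpha>\<in>A. (f \<alpha> \<bullet> i) * (f \<alpha> \<bullet> j))"
proof -
  have bil: "bilinear (g p)" using g by (auto simp: scalar_product_def)
  let ?y = "inv (flat_map (g p)) i"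
  have "?y = (\<Sum>\<alpha>\<in>A. g p ?y (f \<alpha>) *\<^sub>R f \<alpha>)" by (simp add: complete)
  also have "\<dots> = (\<Sum>\<alpha>\<in>A. (f \<alpha> \<bullet> i) *\<^sub>R f \<alpha>)"
    by (simp add: metric_inv_flat_map(2)[where g = g, OF g] inner_commute flip: flat_map_inner[OF bil])
  finally have "?y \<bullet> j = (\<Sum>\<alpha>\<in>A. (f \<alpha> \<bullet> i) *\<^sub>R f \<alpha>) \<bullet> j" by simp
  then show ?thesis
    by (simp add: metric_inv_flat_map(1)[where g = g, OF g] inner_sum_left)
qed

lemma sum_quadruple:
  "(\<Sum>i\<in>B. \<Sum>j\<in>B. \<Sum>k\<in>B. \<Sum>l\<in>B. F i j k l) = (\<Sum>(i,j,k,l)\<in>B\<times>B\<times>B\<times>B. F i j k l)"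
  by (simp add: sum.cartesian_product)

text \<open>Inserting \<open>\<Sum>\<^sub>\<alpha> f\<^sub>\<alpha> \<otimes> f\<^sub>\<alpha>\<close> for the inverse metric in each of the four slots turns the full contraction
  into a sum of squares.\<close>
lemma riemann_norm_sq_complete_family:
  fixes T :: "'a::euclidean_space \<Rightarrow> 'a \<Rightarrow> 'a \<Rightarrow> 'a \<Rightarrow> real"
  assumes g: "scalar_product (g p)"
    and complete: "\<And>v. (\<Sum>\<alpha>\<in>A. g p v (f \<alpha>) *\<^sub>R f \<alpha>) = v"
    and T: "\<And>i j k l. i \<in> Basis \<Longrightarrow> j \<in> Basis \<Longrightarrow> k \<in> Basis \<Longrightarrow> l \<in> Basis \<Longrightarrow>
      riemann g i j k l p = T i j k l"
    and lin: "\<And>j k l. linear (\<lambda>i. T i j k l)" "\<And>i k l. linear (\<lambda>j. T i j k l)"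
      "\<And>i j l. linear (\<lambda>k. T i j k l)" "\<And>i j k. linear (T i j k)"
  shows "riemann_norm_sq g p =
    (\<Sum>\<alpha>\<in>A. \<Sum>\<beta>\<in>A. \<Sum>\<gamma>\<in>A. \<Sum>\<delta>\<in>(A::'b set). (T (f \<alpha>) (f \<beta>) (f \<gamma>) (f \<delta>))\<^sup>2)"
proof -
  let ?B = "Basis :: 'a set"
  define c where "c = (\<lambda>(\<alpha>,\<beta>,\<gamma>,\<delta>) (i,j,k,l). (f \<alpha> \<bullet> i) * (f \<beta> \<bullet> j) * (f \<gamma> \<bullet> k) * (f \<delta> \<bullet> l))"
  define T' where "T' = (\<lambda>(i,j,k,l). T i j k l)"
  have m: "metric_inv g p i j = (\<Sum>\<alpha>\<in>A. (f \<alpha> \<bullet> i) * (f \<alpha> \<bullet> j))" for i j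
    by (rule metric_inv_complete_family[where g = g, OF g complete])
  have mm: "metric_inv g p i i' * metric_inv g p j j' * metric_inv g p k k' * metric_inv g p l l'
      = (\<Sum>t\<in>A\<times>A\<times>A\<times>A. c t (i,j,k,l) * c t (i',j',k',l'))" for i j k l i' j' k' l'
  proof -
    have prod4: "(\<Sum>\<alpha>\<in>A. a \<alpha>) * (\<Sum>\<beta>\<in>A. b \<beta>) * (\<Sum>\<gamma>\<in>A. c \<gamma>) * (\<Sum>\<delta>\<in>A. d \<delta>) =
        (\<Sum>(\<alpha>,\<beta>,\<gamma>,\<delta>)\<in>A\<times>A\<times>A\<times>A. a \<alpha> * b \<beta> * c \<gamma> * d \<delta>)" for a b c d :: "'b \<Rightarrow> real"
      by (simp flip: sum.cartesian_product sum_distrib_left sum_distrib_right)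
    show ?thesis
      unfolding m prod4 c_def by (simp add: case_prod_unfold mult_ac)
  qed
  have Tf: "(\<Sum>s\<in>?B\<times>?B\<times>?B\<times>?B. T' s * c (\<alpha>,\<beta>,\<gamma>,\<delta>) s) = T (f \<alpha>) (f \<beta>) (f \<gamma>) (f \<delta>)" for \<alpha> \<beta> \<gamma> \<delta>
  proof -
    have ex: "T (f \<alpha>) j k l = (\<Sum>i\<in>?B. (f \<alpha> \<bullet> i) * T i j k l)"
      "T i (f \<beta>) k l = (\<Sum>j\<in>?B. (f \<beta> \<bullet> j) * T i j k l)"
      "T i j (f \<gamma>) l = (\<Sum>k\<in>?B. (f \<gamma> \<bullet> k) * T i j k l)"
      "T i j k (f \<delta>) = (\<Sum>l\<in>?B. (f \<delta> \<bullet> l) * T i j k l)" for i j k l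
      by (rule linear_Basis_expand[OF lin(1), where u = "f \<alpha>", unfolded real_scaleR_def],
          rule linear_Basis_expand[OF lin(2), where u = "f \<beta>", unfolded real_scaleR_def],
          rule linear_Basis_expand[OF lin(3), where u = "f \<gamma>", unfolded real_scaleR_def],
          rule linear_Basis_expand[OF lin(4), where u = "f \<delta>", unfolded real_scaleR_def])
    have "T (f \<alpha>) (f \<beta>) (f \<gamma>) (f \<delta>) = (\<Sum>i\<in>?B. (f \<alpha> \<bullet> i) * (\<Sum>j\<in>?B. (f \<beta> \<bullet> j) *
        (\<Sum>k\<in>?B. (f \<gamma> \<bullet> k) * (\<Sum>l\<in>?B. (f \<delta> \<bullet> l) * T i j k l))))"
      by (simp only: ex(1), simp only: ex(2), simp only: ex(3), simp only: ex(4))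
    also have "\<dots> = (\<Sum>i\<in>?B. \<Sum>j\<in>?B. \<Sum>k\<in>?B. \<Sum>l\<in>?B.
        T i j k l * ((f \<alpha> \<bullet> i) * (f \<beta> \<bullet> j) * (f \<gamma> \<bullet> k) * (f \<delta> \<bullet> l)))"
      by (simp only: sum_distrib_left mult_ac)
    finally show ?thesis
      unfolding sum_quadruple c_def T'_def by (simp add: case_prod_unfold)
  qed
  have "riemann_norm_sq g p = (\<Sum>i\<in>?B. \<Sum>j\<in>?B. \<Sum>k\<in>?B. \<Sum>l\<in>?B.
      \<Sum>i'\<in>?B. \<Sum>j'\<in>?B. \<Sum>k'\<in>?B. \<Sum>l'\<in>?B.
        T i j k l * T i' j' k' l' * (\<Sum>t\<in>A\<times>A\<times>A\<times>A. c t (i,j,k,l) * c t (i',j',k',l')))"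
    unfolding riemann_norm_sq_def mm[symmetric] mult.assoc[symmetric]
    by (intro sum.cong refl) (simp only: T)
  also have "\<dots> = (\<Sum>s\<in>?B\<times>?B\<times>?B\<times>?B. \<Sum>s'\<in>?B\<times>?B\<times>?B\<times>?B.
      T' s * T' s' * (\<Sum>t\<in>A\<times>A\<times>A\<times>A. c t s * c t s'))"
    unfolding sum_quadruple T'_def by (simp only: case_prod_unfold prod.collapse)
  also have "\<dots> = (\<Sum>s\<in>?B\<times>?B\<times>?B\<times>?B. \<Sum>s'\<in>?B\<times>?B\<times>?B\<times>?B. \<Sum>t\<in>A\<times>A\<times>A\<times>A.
      (T' s * c t s) * (T' s' * c t s'))"
    by (simp only: sum_distrib_left mult_ac)
  also have "\<dots> = (\<Sum>t\<in>A\<times>A\<times>A\<times>A. \<Sum>s\<in>?B\<times>?B\<times>?B\<times>?B. \<Sum>s'\<in>?B\<times>?B\<times>?B\<times>?B.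
      (T' s * c t s) * (T' s' * c t s'))"
    by (rule trans[OF sum.cong[OF refl sum.swap] sum.swap])
  also have "\<dots> = (\<Sum>t\<in>A\<times>A\<times>A\<times>A. (\<Sum>s\<in>?B\<times>?B\<times>?B\<times>?B. T' s * c t s)\<^sup>2)"
    by (simp add: power2_eq_square sum_product)
  also have "\<dots> = (\<Sum>\<alpha>\<in>A. \<Sum>\<beta>\<in>A. \<Sum>\<gamma>\<in>A. \<Sum>\<delta>\<in>A. (T (f \<alpha>) (f \<beta>) (f \<gamma>) (f \<delta>))\<^sup>2)"
    unfolding sum_quadruple by (simp only: Tf[symmetric] case_prod_unfold prod.collapse)
  finally show ?thesis .
qed

text \<open>A moving frame \<open>e\<close> with coframe \<open>\<theta>\<close>. It identifies the tangent spaces with a fixed vector space,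
  whose scalar product \<open>G q\<close> may vary with the point. Cartan's structure equations are stated
  without brackets of vector fields: \<open>De q v u\<close> is the derivative of \<open>e q u\<close> in
  direction \<open>v\<close>, so that the left-hand side of \<open>torsion_free\<close> is the bracket of the fields \<open>e u\<close> and
  \<open>e v\<close>. The symmetric second derivative \<open>D2e\<close> is required at \<open>p\<close> only.\<close>
locale metric_frame =
  fixes g :: "'a::euclidean_space metric" and Op :: "'a set" and p :: 'a
    and e :: "'a \<Rightarrow> 'f::euclidean_space \<Rightarrow> 'a" and De :: "'a \<Rightarrow> 'a \<Rightarrow> 'f \<Rightarrow> 'a"
    and D2e :: "'a \<Rightarrow> 'a \<Rightarrow> 'f \<Rightarrow> 'a"
    and \<theta> :: "'a \<Rightarrow> 'a \<Rightarrow> 'f" and G :: "'a \<Rightarrow> 'f \<Rightarrow> 'f \<Rightarrow> real"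
    and W :: "'a \<Rightarrow> 'f \<Rightarrow> 'f \<Rightarrow> 'f" and DW :: "'a \<Rightarrow> 'f \<Rightarrow> 'f \<Rightarrow> 'f"
  assumes O: "open Op" "p \<in> Op"
    and lin_e: "\<And>q. q \<in> Op \<Longrightarrow> linear (e q)"
    and \<theta>_e: "\<And>q u. q \<in> Op \<Longrightarrow> \<theta> q (e q u) = u"
    and e_\<theta>: "\<And>q v. q \<in> Op \<Longrightarrow> e q (\<theta> q v) = v"
    and G: "\<And>q. q \<in> Op \<Longrightarrow> scalar_product (G q)"
    and bil_W: "\<And>q. q \<in> Op \<Longrightarrow> bilinear (W q)"
    and g_eq: "\<And>q v w. q \<in> Op \<Longrightarrow> g q v w = G q (\<theta> q v) (\<theta> q w)"
    and metric_compatible: "\<And>q z z'. q \<in> Op \<Longrightarrow> ((\<lambda>q. G q z z') has_derivative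
          (\<lambda>v. G q (W q (\<theta> q v) z) z' + G q z (W q (\<theta> q v) z'))) (at q)"
    and De: "\<And>q u. q \<in> Op \<Longrightarrow> ((\<lambda>q. e q u) has_derivative (\<lambda>v. De q v u)) (at q)"
    and torsion_free: "\<And>q u v. q \<in> Op \<Longrightarrow> De q (e q u) v - De q (e q v) u = e q (W q u v - W q v u)"
    and D2e: "\<And>v u. ((\<lambda>q. De q v u) has_derivative (\<lambda>w. D2e w v u)) (at p)"
    and D2e_sym: "\<And>w v u. D2e w v u = D2e v w u"
    and DW: "\<And>u z. ((\<lambda>q. W q u z) has_derivative (\<lambda>v. DW v u z)) (at p)"
begin

lemma lin_\<theta>:
  assumes "q \<in> Op" shows "linear (\<theta> q)"
proof
  fix x y :: 'a and r :: real
  have "e q (\<theta> q x + \<theta> q y) = x + y" "e q (r *\<^sub>R \<theta> q x) = r *\<^sub>R x"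
    by (simp_all add: linear_add[OF lin_e] linear_scale[OF lin_e] e_\<theta> assms)
  then show "\<theta> q (x + y) = \<theta> q x + \<theta> q y" "\<theta> q (r *\<^sub>R x) = r *\<^sub>R \<theta> q x"
    by (metis \<theta>_e[OF assms])+
qed

lemma lin_De: "q \<in> Op \<Longrightarrow> linear (De q v)"
  by (rule has_derivative_linear_family_linear[OF O(1) _ lin_e De])

lemma lin_De_dir: "q \<in> Op \<Longrightarrow> linear (\<lambda>v. De q v u)"
  using De has_derivative_linear by blast

lemma D\<theta>: "q \<in> Op \<Longrightarrow> ((\<lambda>q. \<theta> q w) has_derivative (\<lambda>v. - \<theta> q (De q v (\<theta> q w)))) (at q)"
  by (rule has_derivative_inverse_family[OF O(1) _ lin_e \<theta>_e e_\<theta> De])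

lemma bil_G: "q \<in> Op \<Longrightarrow> bilinear (G q)"
  using G by (simp add: scalar_product_def)

lemma scalar_product_g:
  assumes q: "q \<in> Op" shows "scalar_product (g q)"
  unfolding scalar_product_def
proof (intro conjI allI impI)
  have g: "g q = (\<lambda>v w. G q (\<theta> q v) (\<theta> q w))" using g_eq[OF q] by blast
  show "bilinear (g q)"
    using bil_G[OF q] linear_compose[OF lin_\<theta>[OF q]] unfolding bilinear_def g o_def by auto
  show "g q v w = g q w v" for v w using G[OF q] unfolding g scalar_product_def by blast
  fix v assume "\<forall>w. g q v w = 0"
  then have "G q (\<theta> q v) z = 0" for z using \<theta>_e[OF q, of z] unfolding g by metis
  then have "\<theta> q v = 0" using G[OF q] by (simp add: scalar_product_def)
  then show "v = 0" using e_\<theta>[OF q, of v] linear_0[OF lin_e[OF q]] by simp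
qed

lemma bil_g: "q \<in> Op \<Longrightarrow> bilinear (g q)" and sym_g: "q \<in> Op \<Longrightarrow> g q v w = g q w v"
  using scalar_product_g by (auto simp: scalar_product_def)

text \<open>The difference between the flat connection of the coordinates and the connection \<open>W\<close>, as a bilinear
  map on tangent vectors; its components are the Christoffel symbols.\<close>
definition nabla :: "'a \<Rightarrow> 'a \<Rightarrow> 'a \<Rightarrow> 'a"
  where "nabla q v w = e q (W q (\<theta> q v) (\<theta> q w)) - De q v (\<theta> q w)"

lemma nabla_sym: assumes q: "q \<in> Op" shows "nabla q v w = nabla q w v"
  using torsion_free[OF q, of "\<theta> q v" "\<theta> q w"]
  by (simp add: nabla_def e_\<theta> q linear_diff[OF lin_e[OF q]] algebra_simps)

lemma bil_nabla: assumes q: "q \<in> Op" shows "bilinear (nabla q)"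
proof -
  note lins = linear_add[OF lin_\<theta>[OF q]] linear_scale[OF lin_\<theta>[OF q]]
     bilinear_radd[OF bil_W[OF q]] bilinear_ladd[OF bil_W[OF q]]
     bilinear_rmul[OF bil_W[OF q]] bilinear_lmul[OF bil_W[OF q]]
     linear_add[OF lin_e[OF q]] linear_scale[OF lin_e[OF q]]
     linear_add[OF lin_De[OF q]] linear_scale[OF lin_De[OF q]]
     linear_add[OF lin_De_dir[OF q]] linear_scale[OF lin_De_dir[OF q]]
  show ?thesis unfolding bilinear_def nabla_def
    by (intro conjI allI linearI) (simp_all add: lins algebra_simps)
qed

text \<open>That the connection is metric, expressed in coordinates. Together with the symmetry of \<open>nabla\<close>, which is
  the vanishing torsion, it yields the Koszul formula.\<close>
lemma deriv_g:
  assumes q: "q \<in> Op"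
  shows "dderiv i (\<lambda>q. g q j l) q = g q (nabla q i j) l + g q j (nabla q i l)"
proof -
  have "((\<lambda>q. G q (\<theta> q j) (\<theta> q l)) has_derivative
     (\<lambda>v. (G q (W q (\<theta> q v) (\<theta> q j)) (\<theta> q l) + G q (\<theta> q j) (W q (\<theta> q v) (\<theta> q l)))
       + G q (- \<theta> q (De q v (\<theta> q j))) (\<theta> q l) + G q (\<theta> q j) (- \<theta> q (De q v (\<theta> q l))))) (at q)"
    by (rule has_derivative_bilinear_family[OF O(1) q bil_G metric_compatible[OF q] D\<theta>[OF q] D\<theta>[OF q]])
  then have "((\<lambda>q. g q j l) has_derivative
     (\<lambda>v. (G q (W q (\<theta> q v) (\<theta> q j)) (\<theta> q l) + G q (\<theta> q j) (W q (\<theta> q v) (\<theta> q l)))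
       + G q (- \<theta> q (De q v (\<theta> q j))) (\<theta> q l) + G q (\<theta> q j) (- \<theta> q (De q v (\<theta> q l))))) (at q)"
    by (rule has_derivative_transform_within_open[OF _ O(1) q]) (simp add: g_eq)
  then show ?thesis
    by (simp add: dderiv_eq g_eq q nabla_def \<theta>_e linear_diff[OF lin_\<theta>[OF q]] bilinear_lsub[OF bil_G[OF q]]
      bilinear_rsub[OF bil_G[OF q]] bilinear_lneg[OF bil_G[OF q]] bilinear_rneg[OF bil_G[OF q]])
qed

lemma christoffel_eq:
  assumes q: "q \<in> Op"
  shows "christoffel g k i j q = nabla q i j \<bullet> k"
proof -
  have koszul: "dderiv i (\<lambda>q. g q j l) q + dderiv j (\<lambda>q. g q i l) q - dderiv l (\<lambda>q. g q i j) q
      = 2 * g q (nabla q i j) l" for l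
    using nabla_sym[OF q, of j i] nabla_sym[OF q, of l i] nabla_sym[OF q, of l j]
      sym_g[OF q, of i "nabla q j l"] sym_g[OF q, of j "nabla q i l"]
    by (simp add: deriv_g[OF q])
  have "christoffel g k i j q = (\<Sum>l\<in>Basis. metric_inv g q k l * g q (nabla q i j) l)"
    unfolding christoffel_def koszul by (simp add: sum_divide_distrib)
  then show ?thesis
    by (simp add: sum_metric_inv_mult[where g = g, OF scalar_product_g[OF q]])
qed

definition curv :: "'f \<Rightarrow> 'f \<Rightarrow> 'f \<Rightarrow> 'f"
  where "curv u v z = DW (e p u) v z - DW (e p v) u z + W p u (W p v z) - W p v (W p u z)
    - W p (W p u v - W p v u) z"

lemma lin_DW: "linear (DW v u)" "linear (\<lambda>u. DW v u z)" "linear (\<lambda>v. DW v u z)"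
proof -
  show "linear (DW v u)"
    by (rule has_derivative_linear_family_linear[OF O _ DW]) (use bil_W in \<open>auto simp: bilinear_def\<close>)
  show "linear (\<lambda>u. DW v u z)"
    by (rule has_derivative_linear_family_linear[OF O, of "\<lambda>q u. W q u z"])
       (use bil_W DW in \<open>auto simp: bilinear_def\<close>)
  show "linear (\<lambda>v. DW v u z)" using DW has_derivative_linear by blast
qed

lemma deriv_nabla:
  "((\<lambda>q. nabla q j k) has_derivative (\<lambda>v.
     De p v (W p (\<theta> p j) (\<theta> p k)) + e p (DW v (\<theta> p j) (\<theta> p k)
       - W p (\<theta> p (De p v (\<theta> p j))) (\<theta> p k) - W p (\<theta> p j) (\<theta> p (De p v (\<theta> p k))))
     - D2e v j (\<theta> p k) + De p j (\<theta> p (De p v (\<theta> p k))))) (at p)"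
proof -
  have 1: "((\<lambda>q. W q (\<theta> q j) (\<theta> q k)) has_derivative (\<lambda>v. DW v (\<theta> p j) (\<theta> p k)
       + W p (- \<theta> p (De p v (\<theta> p j))) (\<theta> p k) + W p (\<theta> p j) (- \<theta> p (De p v (\<theta> p k))))) (at p)"
    by (rule has_derivative_bilinear_family[OF O bil_W DW D\<theta>[OF O(2)] D\<theta>[OF O(2)]])
  have 2: "((\<lambda>q. De q j (\<theta> q k)) has_derivative
      (\<lambda>v. D2e v j (\<theta> p k) + De p j (- \<theta> p (De p v (\<theta> p k))))) (at p)"
    by (rule has_derivative_linear_family[OF O lin_De D2e D\<theta>[OF O(2)]])
  have 3: "((\<lambda>q. e q (W q (\<theta> q j) (\<theta> q k))) has_derivative (\<lambda>v. De p v (W p (\<theta> p j) (\<theta> p k))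
       + e p (DW v (\<theta> p j) (\<theta> p k)
       + W p (- \<theta> p (De p v (\<theta> p j))) (\<theta> p k) + W p (\<theta> p j) (- \<theta> p (De p v (\<theta> p k)))))) (at p)"
    by (rule has_derivative_linear_family[OF O lin_e De[OF O(2)] 1])
  show ?thesis
    unfolding nabla_def
    by (rule has_derivative_eq_rhs[OF has_derivative_diff[OF 3 2]])
       (simp add: fun_eq_iff linear_neg[OF lin_De[OF O(2)]] bilinear_lneg[OF bil_W[OF O(2)]]
         bilinear_rneg[OF bil_W[OF O(2)]])
qed

text \<open>In \<open>\<partial>\<^sub>i \<Gamma>\<^sub>j - \<partial>\<^sub>j \<Gamma>\<^sub>i\<close> the second derivatives of the frame cancel by their symmetry, and the terms
  with one derivative of the frame combine with \<open>\<Gamma>\<Gamma>\<close> to the torsion, which vanishes.\<close>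
lemma riemann_up_eq:
  assumes "l \<in> Basis"
  shows "riemann_up g l k i j p = e p (curv (\<theta> p i) (\<theta> p j) (\<theta> p k)) \<bullet> l"
proof -
  define N where "N v j k = De p v (W p (\<theta> p j) (\<theta> p k)) + e p (DW v (\<theta> p j) (\<theta> p k)
       - W p (\<theta> p (De p v (\<theta> p j))) (\<theta> p k) - W p (\<theta> p j) (\<theta> p (De p v (\<theta> p k))))
     - D2e v j (\<theta> p k) + De p j (\<theta> p (De p v (\<theta> p k)))" for v j k
  have dC: "dderiv i (christoffel g l j k) p = N i j k \<bullet> l" for i j
  proof -
    have "((\<lambda>q. nabla q j k \<bullet> l) has_derivative (\<lambda>v. N v j k \<bullet> l)) (at p)"
      unfolding N_def by (intro has_derivative_inner_left deriv_nabla)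
    then have "(christoffel g l j k has_derivative (\<lambda>v. N v j k \<bullet> l)) (at p)"
      by (rule has_derivative_transform_within_open[OF _ O]) (simp add: christoffel_eq)
    then show ?thesis by (rule dderiv_eq)
  qed
  have cc: "(\<Sum>m\<in>Basis. christoffel g l i m p * christoffel g m j k p) = nabla p i (nabla p j k) \<bullet> l" for i j
    using bil_nabla[OF O(2)] linear_Basis_expand[of "nabla p i" "nabla p j k"]
    by (simp add: christoffel_eq O bilinear_def inner_sum_left mult.commute)
  have th: "\<theta> p (nabla p j k) = W p (\<theta> p j) (\<theta> p k) - \<theta> p (De p j (\<theta> p k))" for j
    by (simp add: nabla_def linear_diff[OF lin_\<theta>[OF O(2)]] \<theta>_e O)
  have tf: "\<theta> p (De p i (\<theta> p j)) = \<theta> p (De p j (\<theta> p i)) + W p (\<theta> p i) (\<theta> p j) - W p (\<theta> p j) (\<theta> p i)" for i j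
    using arg_cong[OF torsion_free[OF O(2), of "\<theta> p i" "\<theta> p j"], of "\<theta> p"]
    by (simp add: \<theta>_e e_\<theta> O linear_diff[OF lin_\<theta>[OF O(2)]] algebra_simps)
  note lins = linear_diff[OF lin_De[OF O(2)]] linear_add[OF lin_e[OF O(2)]] linear_diff[OF lin_e[OF O(2)]]
     bilinear_radd[OF bil_W[OF O(2)]] bilinear_ladd[OF bil_W[OF O(2)]]
     bilinear_rsub[OF bil_W[OF O(2)]] bilinear_lsub[OF bil_W[OF O(2)]]
  have "riemann_up g l k i j p =
     (N i j k - N j i k + nabla p i (nabla p j k) - nabla p j (nabla p i k)) \<bullet> l"
    by (simp add: riemann_up_def dC sum_subtractf cc inner_diff_left inner_add_left)
  also have "N i j k - N j i k + nabla p i (nabla p j k) - nabla p j (nabla p i k)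
      = e p (curv (\<theta> p i) (\<theta> p j) (\<theta> p k))"
    unfolding nabla_def[of p _ "nabla p _ _"] th N_def curv_def
    by (simp add: tf[of i j] D2e_sym[of j i] lins e_\<theta> O algebra_simps)
  finally show ?thesis .
qed

lemma riemann_eq:
  "riemann g l k i j p = G p (\<theta> p l) (curv (\<theta> p i) (\<theta> p j) (\<theta> p k))"
proof -
  have "riemann g l k i j p = g p l (e p (curv (\<theta> p i) (\<theta> p j) (\<theta> p k)))"
    using bil_g[OF O(2)] linear_Basis_expand[of "g p l" "e p (curv (\<theta> p i) (\<theta> p j) (\<theta> p k))"]
    by (simp add: riemann_def riemann_up_eq bilinear_def mult.commute)
  then show ?thesis by (simp add: g_eq \<theta>_e O)
qed

theorem riemann_norm_sq_eq:
  assumes complete: "\<And>z. (\<Sum>\<alpha>\<in>A. G p z (\<epsilon> \<alpha>) *\<^sub>R \<epsilon> \<alpha>) = z"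
  shows "riemann_norm_sq g p =
    (\<Sum>\<alpha>\<in>A. \<Sum>\<beta>\<in>A. \<Sum>\<gamma>\<in>A. \<Sum>\<delta>\<in>A. (G p (\<epsilon> \<alpha>) (curv (\<epsilon> \<gamma>) (\<epsilon> \<delta>) (\<epsilon> \<beta>)))\<^sup>2)"
proof -
  note lins = linear_add[OF lin_\<theta>[OF O(2)]] linear_scale[OF lin_\<theta>[OF O(2)]]
     bilinear_radd[OF bil_W[OF O(2)]] bilinear_ladd[OF bil_W[OF O(2)]]
     bilinear_rmul[OF bil_W[OF O(2)]] bilinear_lmul[OF bil_W[OF O(2)]]
     bilinear_rsub[OF bil_W[OF O(2)]] bilinear_lsub[OF bil_W[OF O(2)]]
     bilinear_radd[OF bil_G[OF O(2)]] bilinear_ladd[OF bil_G[OF O(2)]]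
     bilinear_rmul[OF bil_G[OF O(2)]] bilinear_lmul[OF bil_G[OF O(2)]]
     linear_add[OF lin_e[OF O(2)]] linear_scale[OF lin_e[OF O(2)]]
     linear_add[OF lin_DW(1)] linear_add[OF lin_DW(2)] linear_add[OF lin_DW(3)]
     linear_scale[OF lin_DW(1)] linear_scale[OF lin_DW(2)] linear_scale[OF lin_DW(3)]
  have c: "curv (a + b) v z = curv a v z + curv b v z" "curv (r *\<^sub>R a) v z = r *\<^sub>R curv a v z"
     "curv u (a + b) z = curv u a z + curv u b z" "curv u (r *\<^sub>R a) z = r *\<^sub>R curv u a z"
     "curv u v (a + b) = curv u v a + curv u v b" "curv u v (r *\<^sub>R a) = r *\<^sub>R curv u v a" for a b u v z r
    by (simp_all add: curv_def lins algebra_simps)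
  have "riemann_norm_sq g p = (\<Sum>\<alpha>\<in>A. \<Sum>\<beta>\<in>A. \<Sum>\<gamma>\<in>A. \<Sum>\<delta>\<in>A.
      (G p (\<theta> p (e p (\<epsilon> \<alpha>))) (curv (\<theta> p (e p (\<epsilon> \<gamma>))) (\<theta> p (e p (\<epsilon> \<delta>))) (\<theta> p (e p (\<epsilon> \<beta>)))))\<^sup>2)"
  proof (rule riemann_norm_sq_complete_family[where g = g, OF scalar_product_g[OF O(2)] _ riemann_eq])
    fix v
    have "(\<Sum>\<alpha>\<in>A. g p v (e p (\<epsilon> \<alpha>)) *\<^sub>R e p (\<epsilon> \<alpha>)) = e p (\<Sum>\<alpha>\<in>A. G p (\<theta> p v) (\<epsilon> \<alpha>) *\<^sub>R \<epsilon> \<alpha>)"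
      by (simp add: g_eq O \<theta>_e linear_sum[OF lin_e[OF O(2)]] linear_scale[OF lin_e[OF O(2)]])
    then show "(\<Sum>\<alpha>\<in>A. g p v (e p (\<epsilon> \<alpha>)) *\<^sub>R e p (\<epsilon> \<alpha>)) = v"
      by (simp add: complete e_\<theta> O)
  qed (intro linearI; simp only: lins c real_scaleR_def)+
  then show ?thesis by (simp add: \<theta>_e O)
qed

end

section \<open>The quaternionic connection of a cubic jet\<close>

type_synonym 'b quad = "'b \<times> 'b \<times> 'b \<times> 'b"
text \<open>Quadruples are quaternions with coefficients in \<open>'b\<close>. Multiplication by the units from the left commutes
  with multiplication by the units from the right.\<close>
definition left_i :: "'b::real_vector quad \<Rightarrow> 'b quad" where "left_i z = (-fst (snd z),fst z,-snd (snd (snd z)),fst (snd (snd z)))"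
definition left_j :: "'b::real_vector quad \<Rightarrow> 'b quad" where "left_j z = (-fst (snd (snd z)),snd (snd (snd z)),fst z,-fst (snd z))"
definition left_k :: "'b::real_vector quad \<Rightarrow> 'b quad" where "left_k z = (-snd (snd (snd z)),-fst (snd (snd z)),fst (snd z),fst z)"
definition right_i :: "'b::real_vector quad \<Rightarrow> 'b quad" where "right_i z = (-fst (snd z),fst z,snd (snd (snd z)),-fst (snd (snd z)))"
definition right_j :: "'b::real_vector quad \<Rightarrow> 'b quad" where "right_j z = (-fst (snd (snd z)),-snd (snd (snd z)),fst z,fst (snd z))"
definition right_k :: "'b::real_vector quad \<Rightarrow> 'b quad" where "right_k z = (-snd (snd (snd z)),fst (snd (snd z)),-fst (snd z),fst z)"
definition map_quad :: "('b \<Rightarrow> 'b) \<Rightarrow> 'b quad \<Rightarrow> 'b quad" where "map_quad f z = (f (fst z), f (fst (snd z)), f (fst (snd (snd z))), f (snd (snd (snd z))))"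
lemma quad_simps: "left_i (a,b,c,d) = (-b,a,-d,c)" "left_j (a,b,c,d) = (-c,d,a,-b)" "left_k (a,b,c,d) = (-d,-c,b,a)"
  "right_i (a,b,c,d) = (-b,a,d,-c)" "right_j (a,b,c,d) = (-c,-d,a,b)" "right_k (a,b,c,d) = (-d,c,-b,a)"
  "map_quad f (a',b',c',d') = (f a', f b', f c', f d')"
  by (simp_all add: left_i_def left_j_def left_k_def right_i_def right_j_def right_k_def map_quad_def)

definition slot0 :: "'b::real_vector \<Rightarrow> 'b quad" where "slot0 w = (w, 0, 0, 0)"
definition slot1 :: "'b::real_vector \<Rightarrow> 'b quad" where "slot1 w = (0, w, 0, 0)"
definition slot2 :: "'b::real_vector \<Rightarrow> 'b quad" where "slot2 w = (0, 0, w, 0)"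
definition slot3 :: "'b::real_vector \<Rightarrow> 'b quad" where "slot3 w = (0, 0, 0, w)"

definition slot :: "nat \<Rightarrow> 'b::real_vector \<Rightarrow> 'b quad"
  where "slot k = (if k = 0 then slot0 else if k = 1 then slot1 else if k = 2 then slot2 else slot3)"

lemmas slot_defs = slot0_def slot1_def slot2_def slot3_def

lemma slot_linear:
  "slot0 a + slot0 b = slot0 (a + b)" "slot1 a + slot1 b = slot1 (a + b)" "slot2 a + slot2 b = slot2 (a + b)" "slot3 a + slot3 b = slot3 (a + b)"
  "slot0 a - slot0 b = slot0 (a - b)" "slot1 a - slot1 b = slot1 (a - b)" "slot2 a - slot2 b = slot2 (a - b)" "slot3 a - slot3 b = slot3 (a - b)"
  "r *\<^sub>R slot0 a = slot0 (r *\<^sub>R a)" "r *\<^sub>R slot1 a = slot1 (r *\<^sub>R a)" "r *\<^sub>R slot2 a = slot2 (r *\<^sub>R a)" "r *\<^sub>R slot3 a = slot3 (r *\<^sub>R a)"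
  "- slot0 a = slot0 (- a)" "- slot1 a = slot1 (- a)" "- slot2 a = slot2 (- a)" "- slot3 a = slot3 (- a)"
  by (simp_all add: slot_defs prod_eq_iff)

lemma map_quad_slot:
  assumes "f 0 = 0"
  shows "map_quad f (slot0 w) = slot0 (f w)" "map_quad f (slot1 w) = slot1 (f w)"
    "map_quad f (slot2 w) = slot2 (f w)" "map_quad f (slot3 w) = slot3 (f w)"
  unfolding slot_defs map_quad_def fst_conv snd_conv assms by (rule refl)+

lemma units_slot: "left_i (slot0 w) = slot1 w" "left_i (slot1 w) = slot0 (- w)" "left_i (slot2 w) = slot3 w" "left_i (slot3 w) = slot2 (- w)"
  "left_j (slot0 w) = slot2 w" "left_j (slot1 w) = slot3 (- w)" "left_j (slot2 w) = slot0 (- w)" "left_j (slot3 w) = slot1 w"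
  "left_k (slot0 w) = slot3 w" "left_k (slot1 w) = slot2 w" "left_k (slot2 w) = slot1 (- w)" "left_k (slot3 w) = slot0 (- w)"
  "right_i (slot0 w) = slot1 w" "right_i (slot1 w) = slot0 (- w)" "right_i (slot2 w) = slot3 (- w)" "right_i (slot3 w) = slot2 w"
  "right_j (slot0 w) = slot2 w" "right_j (slot1 w) = slot3 w" "right_j (slot2 w) = slot0 (- w)" "right_j (slot3 w) = slot1 (- w)"
  "right_k (slot0 w) = slot3 w" "right_k (slot1 w) = slot2 (- w)" "right_k (slot2 w) = slot1 w" "right_k (slot3 w) = slot0 (- w)"
  by (simp_all add: slot_defs left_i_def left_j_def left_k_def right_i_def right_j_def right_k_def)

lemma units_0: "left_i 0 = 0" "left_j 0 = 0" "left_k 0 = 0" "map_quad (\<lambda>z. 0) z = 0"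
  by (simp_all add: left_i_def left_j_def left_k_def map_quad_def prod_eq_iff)

text \<open>The algebraic data of the cubic at a point \<open>x\<close>: the metric \<open>K\<close>, the product \<open>m\<close> given by the cubic form
  \<open>K (m u v) w\<close>, and the two consequences of homogeneity. The normalisation is that of
  \<open>\<K> = -log 8h\<close>, for which \<open>K x x = 3/4\<close>.\<close>
locale cubic_jet =
  fixes K :: "'v::real_vector \<Rightarrow> 'v \<Rightarrow> real" and m :: "'v \<Rightarrow> 'v \<Rightarrow> 'v" and x :: 'v
  assumes K_bilinear: "bilinear K" and K_commute: "K u v = K v u"
    and m_bilinear: "bilinear m" and m_commute: "m u v = m v u"
    and K_m: "K (m u v) w = K u (m v w)"
    and m_x: "m x u = (2 * K x u) *\<^sub>R x - (1/2) *\<^sub>R u"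
    and K_x_x: "K x x = 3/4"
    and K_nondegenerate: "(\<And>w. K u w = 0) \<Longrightarrow> u = 0"
begin

definition xi :: "'v \<Rightarrow> real" where "xi u = K x u"
definition cform :: "'v \<Rightarrow> 'v \<Rightarrow> 'v \<Rightarrow> real" where "cform u v w = K (m u v) w"
text \<open>The Christoffel symbol of the metric \<open>K\<close>, in the sense that
  \<open>2 K (chris u v) w\<close> is the derivative of \<open>K v w\<close> along \<open>u\<close>. By homogeneity it is
  expressed through the cubic form.\<close>
definition chris :: "'v \<Rightarrow> 'v \<Rightarrow> 'v"
  where "chris u v = (8 * xi u * xi v - 2 * K u v) *\<^sub>R x - (2 * xi u) *\<^sub>R v - (2 * xi v) *\<^sub>R u - m u v"

lemmas K_lin = bilinear_ladd[OF K_bilinear] bilinear_radd[OF K_bilinear] bilinear_lmul[OF K_bilinear]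
  bilinear_rmul[OF K_bilinear] bilinear_lneg[OF K_bilinear] bilinear_rneg[OF K_bilinear]
  bilinear_lsub[OF K_bilinear] bilinear_rsub[OF K_bilinear] bilinear_lzero[OF K_bilinear] bilinear_rzero[OF K_bilinear]
lemmas m_lin = bilinear_ladd[OF m_bilinear] bilinear_radd[OF m_bilinear] bilinear_lmul[OF m_bilinear]
  bilinear_rmul[OF m_bilinear] bilinear_lneg[OF m_bilinear] bilinear_rneg[OF m_bilinear]
  bilinear_lsub[OF m_bilinear] bilinear_rsub[OF m_bilinear] bilinear_lzero[OF m_bilinear] bilinear_rzero[OF m_bilinear]

lemma K_eqI: assumes "\<And>w. K u w = K v w" shows "u = v"
  using K_nondegenerate[of "u - v"] assms by (simp add: K_lin)

lemma cform_swap12: "cform u v w = cform v u w" by (simp add: cform_def m_commute)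
lemma cform_swap23: "cform u v w = cform u w v" by (metis cform_def K_m m_commute K_commute)
lemma m_x_right: "m u x = (2 * K x u) *\<^sub>R x - (1/2) *\<^sub>R u" by (metis m_x m_commute)
lemma K_to: "K (m u v) w = cform u v w" "K w (m u v) = cform u v w" "K x u = xi u" "K u x = xi u"
  by (simp_all add: cform_def xi_def K_commute)
lemma xi_lin: "xi (u + v) = xi u + xi v" "xi (u - v) = xi u - xi v" "xi (- u) = - xi u"
  "xi (r *\<^sub>R u) = r * xi u" "xi 0 = 0"
  by (simp_all add: xi_def K_lin)
lemma xi_x: "xi x = 3/4" by (simp add: xi_def K_x_x)
lemma xi_m: "xi (m u v) = 2 * xi u * xi v - K u v / 2"
proof -
  have "xi (m u v) = K (m x u) v" by (simp add: xi_def K_m)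
  then show ?thesis by (simp add: m_x K_lin flip: xi_def)
qed
lemma m_x': "m x u = (2 * xi u) *\<^sub>R x - (1/2) *\<^sub>R u" "m u x = (2 * xi u) *\<^sub>R x - (1/2) *\<^sub>R u"
  by (simp_all add: m_x m_x_right xi_def)
lemma cform_lin: "cform (a + b) v w = cform a v w + cform b v w" "cform v (a + b) w = cform v a w + cform v b w" "cform v w (a + b) = cform v w a + cform v w b"
  "cform (a - b) v w = cform a v w - cform b v w" "cform v (a - b) w = cform v a w - cform v b w" "cform v w (a - b) = cform v w a - cform v w b"
  "cform (r *\<^sub>R b) v w = r * cform b v w" "cform v (r *\<^sub>R b) w = r * cform v b w" "cform v w (r *\<^sub>R b) = r * cform v w b"
  "cform 0 v w = 0" "cform v 0 w = 0" "cform v w 0 = 0" "cform (- a) v w = - cform a v w" "cform v (- a) w = - cform v a w" "cform v w (- a) = - cform v w a"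
  by (simp_all add: cform_def m_lin K_lin)
lemma cform_x: "cform x u v = 2 * xi u * xi v - K u v / 2" "cform u x v = 2 * xi u * xi v - K u v / 2" "cform u v x = 2 * xi u * xi v - K u v / 2"
  by (simp_all add: cform_def m_x' K_lin K_to xi_m)

text \<open>Rewriting with these rules brings every scalar expression to a polynomial in \<open>xi\<close>, \<open>K\<close> and \<open>cform\<close>. Identities
  between vectors are proved by pairing them with an arbitrary vector.\<close>
lemmas vec_simps = K_lin m_lin xi_lin cform_lin xi_x xi_m m_x' cform_x K_to
  scaleR_add_left scaleR_add_right scaleR_diff_left scaleR_diff_right

text \<open>The four endomorphism parts of the connection. They act on \<open>W = \<real> \<times> 'v\<close> and are
  symmetric with respect to its scalar product. The first one accounts for the derivative of \<open>K\<close>; the others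
  become skew when they are multiplied by a left unit.\<close>
definition conn0 :: "real \<times> 'v \<Rightarrow> real \<times> 'v \<Rightarrow> real \<times> 'v"
  where "conn0 u z = (0, chris (snd u) (snd z))"
definition conn1 :: "real \<times> 'v \<Rightarrow> real \<times> 'v \<Rightarrow> real \<times> 'v"
  where "conn1 u z = ((3/2 * fst u + xi (snd u)) * fst z, chris (snd u) (snd z) + (xi (snd u) - fst u / 2) *\<^sub>R snd z)"
definition conn2 :: "real \<times> 'v \<Rightarrow> real \<times> 'v \<Rightarrow> real \<times> 'v"
  where "conn2 u z = (K (snd u) (snd z), fst z *\<^sub>R snd u + m (snd u) (snd z))"
definition conn3 :: "real \<times> 'v \<Rightarrow> real \<times> 'v \<Rightarrow> real \<times> 'v"
  where "conn3 u z = (K (snd u) (snd z), fst z *\<^sub>R snd u - m (snd u) (snd z))"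

text \<open>The derivatives of \<open>m\<close> and \<open>chris\<close> with respect to \<open>x\<close>. Since \<open>h\<close> is cubic, its third derivatives are constant,
  so that both are again expressions in the data of the locale.\<close>
definition dm :: "'v \<Rightarrow> 'v \<Rightarrow> 'v \<Rightarrow> 'v"
  where "dm a u v = - (4 * xi a) *\<^sub>R m u v - 2 *\<^sub>R chris a (m u v)"
definition dchris :: "'v \<Rightarrow> 'v \<Rightarrow> 'v \<Rightarrow> 'v"
  where "dchris a u v = (8 * xi u * xi v) *\<^sub>R a - (8 * (K a u * xi v + xi u * K a v)) *\<^sub>R x
    + (2 * K a u) *\<^sub>R v + (2 * K a v) *\<^sub>R u - (4 * K (chris a u) v) *\<^sub>R x - (2 * K u v) *\<^sub>R a - dm a u v"

text \<open>The curvature of \<open>K\<close> as a Hessian metric on \<open>\<real>\<^sup>n\<close>: it is the commutator of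
  multiplication operators up to a term of constant curvature.\<close>
lemma chris_commutator: "chris u (chris v z) - chris v (chris u z) = m u (m v z) - m v (m u z) + K v z *\<^sub>R u - K u z *\<^sub>R v"
  by (rule K_eqI) (simp add: chris_def vec_simps algebra_simps m_commute K_commute cform_swap12 cform_swap23)

text \<open>The totally symmetric tensor \<open>-2S\<close> with one index raised. It is the covariant derivative of \<open>m\<close>.\<close>
definition sigma :: "'v \<Rightarrow> 'v \<Rightarrow> 'v \<Rightarrow> 'v" where
  "sigma u v z = m u (m v z) + m v (m u z) + m z (m u v)
    + (2 * xi u) *\<^sub>R m v z + (2 * xi v) *\<^sub>R m u z + (2 * xi z) *\<^sub>R m u v + (2 * cform u v z) *\<^sub>R x
    - (48 * xi u * xi v * xi z) *\<^sub>R x + (4 * xi u * xi v) *\<^sub>R z + (4 * xi u * xi z) *\<^sub>R v + (4 * xi v * xi z) *\<^sub>R u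
    + (4 * (K u v * xi z + K u z * xi v + K v z * xi u)) *\<^sub>R x
    - K u v *\<^sub>R z - K u z *\<^sub>R v - K v z *\<^sub>R u"

text \<open>The Levi-Civita connection of the q-map metric in the quaternionic frame. The terms with a right
  multiplication form the \<open>sp(1)\<close> connection of the quaternionic structure.\<close>
definition conn :: "(real \<times> 'v) quad \<Rightarrow> (real \<times> 'v) quad \<Rightarrow> (real \<times> 'v) quad" where
  "conn u z = map_quad (conn0 (fst u)) z + left_i (map_quad (conn1 (fst (snd u))) z) + left_j (map_quad (conn2 (fst (snd (snd u)))) z)
   + left_k (map_quad (conn3 (snd (snd (snd u)))) z) + (fst (fst (snd u)) / 2 - xi (snd (fst (snd u)))) *\<^sub>R right_i z
   + fst (fst (snd (snd u))) *\<^sub>R right_j z + fst (snd (snd (snd u))) *\<^sub>R right_k z"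

text \<open>The coefficients of the connection vary with \<open>x\<close>, through \<open>K\<close>, \<open>m\<close>, \<open>xi\<close> and \<open>chris\<close>; the direction of
  differentiation is \<open>c\<close>. Of the \<open>sp(1)\<close> part only the coefficient of \<open>right_i\<close> varies.\<close>
definition dconn0 :: "'v \<Rightarrow> real \<times> 'v \<Rightarrow> real \<times> 'v \<Rightarrow> real \<times> 'v"
  where "dconn0 c u z = (0, dchris c (snd u) (snd z))"
definition dconn1 :: "'v \<Rightarrow> real \<times> 'v \<Rightarrow> real \<times> 'v \<Rightarrow> real \<times> 'v"
  where "dconn1 c u z = (- K c (snd u) * fst z, dchris c (snd u) (snd z) - K c (snd u) *\<^sub>R snd z)"
definition dconn2 :: "'v \<Rightarrow> real \<times> 'v \<Rightarrow> real \<times> 'v \<Rightarrow> real \<times> 'v"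
  where "dconn2 c u z = (2 * K (chris c (snd u)) (snd z), dm c (snd u) (snd z))"
definition dconn3 :: "'v \<Rightarrow> real \<times> 'v \<Rightarrow> real \<times> 'v \<Rightarrow> real \<times> 'v"
  where "dconn3 c u z = (2 * K (chris c (snd u)) (snd z), - dm c (snd u) (snd z))"
definition dconn :: "'v \<Rightarrow> (real \<times> 'v) quad \<Rightarrow> (real \<times> 'v) quad \<Rightarrow> (real \<times> 'v) quad" where
  "dconn c u z = map_quad (dconn0 c (fst u)) z + left_i (map_quad (dconn1 c (fst (snd u))) z) + left_j (map_quad (dconn2 c (fst (snd (snd u)))) z)
   + left_k (map_quad (dconn3 c (snd (snd (snd u)))) z) + (K c (snd (fst (snd u)))) *\<^sub>R right_i z"
definition curv_frame where "curv_frame u v z = dconn (snd (fst u)) v z - dconn (snd (fst v)) u z + conn u (conn v z) - conn v (conn u z)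
   - conn (conn u v - conn v u) z"
text \<open>The endomorphisms that occur in the curvature: \<open>curv0\<close> for two equal slots, and
  \<open>curv1\<close>, \<open>curv2\<close>, \<open>curv3\<close> for two slots whose quotient is the unit \<open>i\<close>, \<open>j\<close>, \<open>k\<close>. Only the last two involve
  \<open>sigma\<close>, and they are exchanged by \<open>m \<mapsto> -m\<close>, \<open>sigma \<mapsto> -sigma\<close>.\<close>
definition curv0 :: "real \<times> 'v \<Rightarrow> real \<times> 'v \<Rightarrow> real \<times> 'v \<Rightarrow> real \<times> 'v"
  where "curv0 u v z = (0, chris (snd v) (chris (snd u) (snd z)) - chris (snd u) (chris (snd v) (snd z)))"
definition curv1 :: "real \<times> 'v \<Rightarrow> real \<times> 'v \<Rightarrow> real \<times> 'v \<Rightarrow> real \<times> 'v"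
  where "curv1 u v z = ((3 * fst u * fst v - K (snd u) (snd v)) * fst z,
    (K (snd u) (snd v) - fst u * fst v) *\<^sub>R snd z + K (snd v) (snd z) *\<^sub>R snd u + K (snd u) (snd z) *\<^sub>R snd v
     - m (snd u) (m (snd v) (snd z)) - m (snd v) (m (snd u) (snd z)))"
definition curv2 :: "real \<times> 'v \<Rightarrow> real \<times> 'v \<Rightarrow> real \<times> 'v \<Rightarrow> real \<times> 'v"
  where "curv2 u v z = (K (m (snd u) (snd v) + fst u *\<^sub>R snd v + fst v *\<^sub>R snd u) (snd z),
    fst z *\<^sub>R (m (snd u) (snd v) + fst u *\<^sub>R snd v + fst v *\<^sub>R snd u)
     + sigma (snd u) (snd v) (snd z) + m (m (snd u) (snd v)) (snd z) + fst u *\<^sub>R m (snd v) (snd z) + fst v *\<^sub>R m (snd u) (snd z))"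
definition curv3 :: "real \<times> 'v \<Rightarrow> real \<times> 'v \<Rightarrow> real \<times> 'v \<Rightarrow> real \<times> 'v"
  where "curv3 u v z = (K (- m (snd u) (snd v) + fst u *\<^sub>R snd v + fst v *\<^sub>R snd u) (snd z),
    fst z *\<^sub>R (- m (snd u) (snd v) + fst u *\<^sub>R snd v + fst v *\<^sub>R snd u)
     - sigma (snd u) (snd v) (snd z) + m (m (snd u) (snd v)) (snd z) - fst u *\<^sub>R m (snd v) (snd z) - fst v *\<^sub>R m (snd u) (snd z))"
definition ext_form :: "real \<times> 'v \<Rightarrow> real \<times> 'v \<Rightarrow> real"
  where "ext_form u v = fst u * fst v + K (snd u) (snd v)"

lemmas jet_simps = chris_def vec_simps algebra_simps m_commute K_commute cform_swap12 cform_swap23 sigma_def dm_def dchris_def add_divide_distrib diff_divide_distrib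

lemma chris_lin: "chris (a + b) v = chris a v + chris b v" "chris v (a + b) = chris v a + chris v b"
  "chris (a - b) v = chris a v - chris b v" "chris v (a - b) = chris v a - chris v b"
  "chris (r *\<^sub>R b) v = r *\<^sub>R chris b v" "chris v (r *\<^sub>R b) = r *\<^sub>R chris v b"
  "chris 0 v = 0" "chris v 0 = 0" "chris (- a) v = - chris a v"  "chris v (- a) = - chris v a"
  by (rule K_eqI, simp add: jet_simps)+

lemma dchris_0: "dchris 0 u v = 0" "dchris c 0 v = 0" "dm 0 u v = 0" "dm c 0 v = 0"
  by (rule K_eqI, simp add: jet_simps)+

lemma pair_eqI: "fst a = fst b \<Longrightarrow> (\<And>w. K (snd a) w = K (snd b) w) \<Longrightarrow> (a::real \<times> 'v) = b"
  by (simp add: prod_eq_iff K_eqI)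

lemma conn_parts_0: "conn0 0 z = 0" "conn1 0 z = 0" "conn2 0 z = 0" "conn3 0 z = 0" "conn0 u 0 = 0" "conn1 u 0 = 0" "conn2 u 0 = 0" "conn3 u 0 = 0"
  "dconn0 c 0 z = 0" "dconn1 c 0 z = 0" "dconn2 c 0 z = 0" "dconn3 c 0 z = 0" "dconn0 0 u z = 0" "dconn1 0 u z = 0" "dconn2 0 u z = 0" "dconn3 0 u z = 0"
  by (simp_all add: conn0_def conn1_def conn2_def conn3_def dconn0_def dconn1_def dconn2_def dconn3_def chris_lin m_lin K_lin xi_lin dchris_0 prod_eq_iff)

lemma conn_parts_0_fun: "conn0 0 = (\<lambda>z. 0)" "conn1 0 = (\<lambda>z. 0)" "conn2 0 = (\<lambda>z. 0)" "conn3 0 = (\<lambda>z. 0)"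
  "dconn0 c 0 = (\<lambda>z. 0)" "dconn1 c 0 = (\<lambda>z. 0)" "dconn2 c 0 = (\<lambda>z. 0)" "dconn3 c 0 = (\<lambda>z. 0)"
  "dconn0 0 u = (\<lambda>z. 0)" "dconn1 0 u = (\<lambda>z. 0)" "dconn2 0 u = (\<lambda>z. 0)" "dconn3 0 u = (\<lambda>z. 0)"
  by (simp_all add: fun_eq_iff conn_parts_0)

lemmas map_quad_conn_slot = map_quad_slot[where f = "conn0 u" for u, OF conn_parts_0(5)] map_quad_slot[where f = "conn1 u" for u, OF conn_parts_0(6)]
  map_quad_slot[where f = "conn2 u" for u, OF conn_parts_0(7)] map_quad_slot[where f = "conn3 u" for u, OF conn_parts_0(8)]

lemma conn_slot:
  "conn (slot0 u) z = map_quad (conn0 u) z"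
  "conn (slot1 u) z = left_i (map_quad (conn1 u) z) + (fst u / 2 - xi (snd u)) *\<^sub>R right_i z"
  "conn (slot2 u) z = left_j (map_quad (conn2 u) z) + fst u *\<^sub>R right_j z"
  "conn (slot3 u) z = left_k (map_quad (conn3 u) z) + fst u *\<^sub>R right_k z"
  by (simp_all add: conn_def slot_defs conn_parts_0_fun units_0 xi_lin)

lemma dconn_slot:
  "dconn c (slot0 u) z = map_quad (dconn0 c u) z"
  "dconn c (slot1 u) z = left_i (map_quad (dconn1 c u) z) + K c (snd u) *\<^sub>R right_i z"
  "dconn c (slot2 u) z = left_j (map_quad (dconn2 c u) z)"
  "dconn c (slot3 u) z = left_k (map_quad (dconn3 c u) z)"
  "dconn 0 y z = 0"
  by (simp_all add: dconn_def slot_defs conn_parts_0_fun units_0 K_lin)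

lemma fst_slot: "fst (slot0 u) = u" "fst (slot1 u) = 0" "fst (slot2 u) = 0" "fst (slot3 u) = 0"
  by (simp_all add: slot_defs)

lemmas sector_defs = conn0_def conn1_def conn2_def conn3_def dconn0_def dconn1_def dconn2_def dconn3_def curv0_def curv1_def curv2_def curv3_def ext_form_def

text \<open>Each of the ten pairs of slots is a polynomial identity in the data of the locale. The scalar product \<open>ext_form u v\<close> in
  front of the right units is the curvature of the \<open>sp(1)\<close> part, a multiple of the quaternionic Kaehler forms.\<close>
lemma curv_frame_sectors:
  "curv_frame (slot0 u) (slot0 v) z = map_quad (curv0 u v) z"
  "curv_frame (slot1 u) (slot1 v) z = map_quad (curv0 u v) z"
  "curv_frame (slot2 u) (slot2 v) z = map_quad (curv0 u v) z"
  "curv_frame (slot3 u) (slot3 v) z = map_quad (curv0 u v) z"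
  "curv_frame (slot0 u) (slot1 v) z = left_i (map_quad (curv1 u v) z) + ext_form u v *\<^sub>R right_i z"
  "curv_frame (slot0 u) (slot2 v) z = left_j (map_quad (curv2 u v) z) + ext_form u v *\<^sub>R right_j z"
  "curv_frame (slot0 u) (slot3 v) z = left_k (map_quad (curv3 u v) z) + ext_form u v *\<^sub>R right_k z"
  "curv_frame (slot2 u) (slot3 v) z = left_i (map_quad (curv1 u v) z) - ext_form u v *\<^sub>R right_i z"
  "curv_frame (slot3 u) (slot1 v) z = left_j (map_quad (curv2 u v) z) - ext_form u v *\<^sub>R right_j z"
  "curv_frame (slot1 u) (slot2 v) z = left_k (map_quad (curv3 u v) z) - ext_form u v *\<^sub>R right_k z"
proof -
  obtain a b c d where z: "z = (a,b,c,d)" by (metis prod.exhaust)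
  show "curv_frame (slot0 u) (slot0 v) z = map_quad (curv0 u v) z"
    "curv_frame (slot1 u) (slot1 v) z = map_quad (curv0 u v) z"
    "curv_frame (slot2 u) (slot2 v) z = map_quad (curv0 u v) z"
    "curv_frame (slot3 u) (slot3 v) z = map_quad (curv0 u v) z"
    "curv_frame (slot0 u) (slot1 v) z = left_i (map_quad (curv1 u v) z) + ext_form u v *\<^sub>R right_i z"
    "curv_frame (slot0 u) (slot2 v) z = left_j (map_quad (curv2 u v) z) + ext_form u v *\<^sub>R right_j z"
    "curv_frame (slot0 u) (slot3 v) z = left_k (map_quad (curv3 u v) z) + ext_form u v *\<^sub>R right_k z"
    "curv_frame (slot2 u) (slot3 v) z = left_i (map_quad (curv1 u v) z) - ext_form u v *\<^sub>R right_i z"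
    "curv_frame (slot3 u) (slot1 v) z = left_j (map_quad (curv2 u v) z) - ext_form u v *\<^sub>R right_j z"
    "curv_frame (slot1 u) (slot2 v) z = left_k (map_quad (curv3 u v) z) - ext_form u v *\<^sub>R right_k z"
    unfolding curv_frame_def conn_slot[of _ z] fst_slot snd_zero dconn_slot map_quad_conn_slot units_slot slot_linear conn_slot z quad_simps
      add_Pair diff_Pair uminus_Pair scaleR_Pair prod.inject
    by (intro conjI; rule pair_eqI; simp add: sector_defs chris_lin m_lin dchris_0 jet_simps)+
qed

lemma sigma_0: "sigma 0 v z = 0" "sigma u 0 z = 0" "sigma u v 0 = 0"
  by (simp_all add: sigma_def m_lin K_lin xi_lin cform_lin)

lemma K_m_m: "K a (m (m c d) b) = K (m a b) (m c d)"
  by (metis K_m m_commute)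

end

section \<open>Norms of the curvature tensors\<close>

lemma sum_option:
  fixes F :: "'n::finite option \<Rightarrow> 'b::comm_monoid_add"
  shows "(\<Sum>A\<in>UNIV. F A) = F None + (\<Sum>a\<in>UNIV. F (Some a))"
  by (simp add: UNIV_option_conv sum.reindex)

text \<open>A sum over a basis of a tensor product, with the indices of each factor collected.\<close>
lemma sum_interleave:
  fixes F :: "'a \<Rightarrow> 's \<Rightarrow> 'a \<Rightarrow> 's \<Rightarrow> 'a \<Rightarrow> 's \<Rightarrow> 'a \<Rightarrow> 's \<Rightarrow> real"
  shows "(\<Sum>\<alpha>\<in>U\<times>S. \<Sum>\<beta>\<in>U\<times>S. \<Sum>\<gamma>\<in>U\<times>S. \<Sum>\<delta>\<in>U\<times>S.
      F (fst \<alpha>) (snd \<alpha>) (fst \<beta>) (snd \<beta>) (fst \<gamma>) (snd \<gamma>) (fst \<delta>) (snd \<delta>)) =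
    (\<Sum>A\<in>U. \<Sum>B\<in>U. \<Sum>C\<in>U. \<Sum>D\<in>U. \<Sum>k\<in>S. \<Sum>l\<in>S. \<Sum>i\<in>S. \<Sum>j\<in>S. F A i B j C k D l)"
  unfolding sum.cartesian_product case_prod_unfold
  by (rule sum.reindex_bij_witness[of _
     "\<lambda>(A,B,C,D,k,l,i,j). ((A,i),(B,j),(C,k),(D,l))"
     "\<lambda>((A,i),(B,j),(C,k),(D,l)). (A,B,C,D,k,l,i,j)"]) auto

context cubic_jet begin

definition frame_form :: "(real \<times> 'v) quad \<Rightarrow> (real \<times> 'v) quad \<Rightarrow> real"
  where "frame_form y z = ext_form (fst y) (fst z) + ext_form (fst (snd y)) (fst (snd z)) + ext_form (fst (snd (snd y))) (fst (snd (snd z)))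
    + ext_form (snd (snd (snd y))) (snd (snd (snd z)))"

lemma ext_form_lin: "ext_form u (v + w) = ext_form u v + ext_form u w" "ext_form u (v - w) = ext_form u v - ext_form u w" "ext_form u (- v) = - ext_form u v"
  "ext_form u (r *\<^sub>R v) = r * ext_form u v" "ext_form u 0 = 0" "ext_form 0 u = 0"
  by (simp_all add: ext_form_def K_lin algebra_simps)

lemma ext_form_commute: "ext_form u v = ext_form v u" by (simp add: ext_form_def K_commute)

lemma curv_parts_zero: "curv0 u v 0 = 0" "curv1 u v 0 = 0" "curv2 u v 0 = 0" "curv3 u v 0 = 0"
  unfolding curv0_def curv1_def curv2_def curv3_def by (simp_all add: chris_lin m_lin K_lin sigma_def xi_lin cform_lin zero_prod_def)

lemma curv_parts_sym: "curv1 v u z = curv1 u v z" "curv2 v u z = curv2 u v z" "curv3 v u z = curv3 u v z"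
  by (rule pair_eqI; simp add: curv1_def curv2_def curv3_def jet_simps)+

lemma conn_parts_minus: "conn0 (- u) = (\<lambda>z. - conn0 u z)" "conn1 (- u) = (\<lambda>z. - conn1 u z)" "conn2 (- u) = (\<lambda>z. - conn2 u z)" "conn3 (- u) = (\<lambda>z. - conn3 u z)"
  by (simp_all add: fun_eq_iff conn0_def conn1_def conn2_def conn3_def chris_lin xi_lin m_lin K_lin algebra_simps)

lemma map_quad_minus: "map_quad (\<lambda>z. - f z) z = - map_quad f z" by (simp add: map_quad_def)

lemma units_minus: "left_i (- z) = - left_i z" "left_j (- z) = - left_j z" "left_k (- z) = - left_k z"
  by (simp_all add: left_i_def left_j_def left_k_def)

lemma conn_minus: "conn (- w) z = - conn w z"
  by (simp add: conn_def conn_parts_minus map_quad_minus units_minus xi_lin algebra_simps)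

lemma curv_frame_antisym: "curv_frame v u z = - curv_frame u v z"
  unfolding curv_frame_def using conn_minus[of "conn u v - conn v u"] by simp

lemma frame_form_slot: "frame_form (slot0 a) (slot0 b) = ext_form a b" "frame_form (slot1 a) (slot1 b) = ext_form a b" "frame_form (slot2 a) (slot2 b) = ext_form a b" "frame_form (slot3 a) (slot3 b) = ext_form a b"
  "frame_form (slot0 a) (slot1 b) = 0" "frame_form (slot0 a) (slot2 b) = 0" "frame_form (slot0 a) (slot3 b) = 0"
  "frame_form (slot1 a) (slot0 b) = 0" "frame_form (slot1 a) (slot2 b) = 0" "frame_form (slot1 a) (slot3 b) = 0"
  "frame_form (slot2 a) (slot0 b) = 0" "frame_form (slot2 a) (slot1 b) = 0" "frame_form (slot2 a) (slot3 b) = 0"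
  "frame_form (slot3 a) (slot0 b) = 0" "frame_form (slot3 a) (slot1 b) = 0" "frame_form (slot3 a) (slot2 b) = 0"
  "frame_form y (p + q) = frame_form y p + frame_form y q" "frame_form y (p - q) = frame_form y p - frame_form y q" "frame_form y (- q) = - frame_form y q"
  by (simp_all add: frame_form_def slot_defs ext_form_lin)

text \<open>The part of the squared norm of \<open>R\<close> which belongs to one pair of vectors of \<open>W\<close>, summed over the slots.\<close>
definition block_norm :: "((real \<times> 'v) quad \<Rightarrow> (real \<times> 'v) quad) \<Rightarrow> real \<times> 'v \<Rightarrow> real \<times> 'v \<Rightarrow> real"
  where "block_norm R a b = (\<Sum>i\<in>{0,1,2,3}. \<Sum>j\<in>{0,1,2,3}. (frame_form (slot i a) (R (slot j b)))\<^sup>2)"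

lemma block_norm_minus: "block_norm (\<lambda>z. - R z) a b = block_norm R a b"
  by (simp add: block_norm_def frame_form_slot)

text \<open>A left unit \<open>J\<close> and a right unit \<open>I\<close> with the same name agree up to signs on each slot; the two signs are
  equal in two slots and opposite in the other two, so that the mixed terms cancel in the sum.\<close>
lemma block_norm_unit:
  assumes "r 0 = 0"
  shows "block_norm (\<lambda>z. map_quad r z) a b = 4 * (ext_form a (r b))\<^sup>2"
    "block_norm (\<lambda>z. left_i (map_quad r z) + c *\<^sub>R right_i z) a b = 4 * (ext_form a (r b))\<^sup>2 + 4 * c\<^sup>2 * (ext_form a b)\<^sup>2"
    "block_norm (\<lambda>z. left_j (map_quad r z) + c *\<^sub>R right_j z) a b = 4 * (ext_form a (r b))\<^sup>2 + 4 * c\<^sup>2 * (ext_form a b)\<^sup>2"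
    "block_norm (\<lambda>z. left_k (map_quad r z) + c *\<^sub>R right_k z) a b = 4 * (ext_form a (r b))\<^sup>2 + 4 * c\<^sup>2 * (ext_form a b)\<^sup>2"
    "block_norm (\<lambda>z. left_i (map_quad r z) - c *\<^sub>R right_i z) a b = 4 * (ext_form a (r b))\<^sup>2 + 4 * c\<^sup>2 * (ext_form a b)\<^sup>2"
    "block_norm (\<lambda>z. left_j (map_quad r z) - c *\<^sub>R right_j z) a b = 4 * (ext_form a (r b))\<^sup>2 + 4 * c\<^sup>2 * (ext_form a b)\<^sup>2"
    "block_norm (\<lambda>z. left_k (map_quad r z) - c *\<^sub>R right_k z) a b = 4 * (ext_form a (r b))\<^sup>2 + 4 * c\<^sup>2 * (ext_form a b)\<^sup>2"
  by (simp_all add: block_norm_def slot_def map_quad_slot[where f = r, OF assms] units_slot slot_linear frame_form_slot ext_form_lin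
    power2_eq_square algebra_simps)

lemma curv_frame_norm_block:
  "(\<Sum>k\<in>{0,1,2,3}. \<Sum>l\<in>{0,1,2,3}. block_norm (curv_frame (slot k u) (slot l v)) a b) =
   16 * ((ext_form a (curv0 u v b))\<^sup>2 + (ext_form a (curv1 u v b))\<^sup>2 + (ext_form a (curv2 u v b))\<^sup>2 + (ext_form a (curv3 u v b))\<^sup>2)
   + 48 * (ext_form u v)\<^sup>2 * (ext_form a b)\<^sup>2"
proof -
  have anti: "block_norm (curv_frame y x) a b = block_norm (curv_frame x y) a b" for x y
    using block_norm_minus[of "curv_frame x y"] by (simp add: curv_frame_antisym[of y x, abs_def])
  have sec: "curv_frame (slot0 u) (slot0 v) = map_quad (curv0 u v)" "curv_frame (slot1 u) (slot1 v) = map_quad (curv0 u v)"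
    "curv_frame (slot2 u) (slot2 v) = map_quad (curv0 u v)" "curv_frame (slot3 u) (slot3 v) = map_quad (curv0 u v)"
    "curv_frame (slot0 u) (slot1 v) = (\<lambda>z. left_i (map_quad (curv1 u v) z) + ext_form u v *\<^sub>R right_i z)"
    "curv_frame (slot0 u) (slot2 v) = (\<lambda>z. left_j (map_quad (curv2 u v) z) + ext_form u v *\<^sub>R right_j z)"
    "curv_frame (slot0 u) (slot3 v) = (\<lambda>z. left_k (map_quad (curv3 u v) z) + ext_form u v *\<^sub>R right_k z)"
    "curv_frame (slot2 u) (slot3 v) = (\<lambda>z. left_i (map_quad (curv1 u v) z) - ext_form u v *\<^sub>R right_i z)"
    "curv_frame (slot3 u) (slot1 v) = (\<lambda>z. left_j (map_quad (curv2 u v) z) - ext_form u v *\<^sub>R right_j z)"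
    "curv_frame (slot1 u) (slot2 v) = (\<lambda>z. left_k (map_quad (curv3 u v) z) - ext_form u v *\<^sub>R right_k z)" for u v
    by (rule ext, rule curv_frame_sectors)+
  show ?thesis
    by (simp add: slot_def sec block_norm_unit[where r = "curv0 u v" for u v, OF curv_parts_zero(1)] block_norm_unit[where r = "curv1 u v" for u v, OF curv_parts_zero(2)] block_norm_unit[where r = "curv2 u v" for u v, OF curv_parts_zero(3)]
      block_norm_unit[where r = "curv3 u v" for u v, OF curv_parts_zero(4)] anti[of "slot1 u" "slot0 v"] anti[of "slot2 u" "slot0 v"] anti[of "slot3 u" "slot0 v"]
      anti[of "slot1 u" "slot3 v"] anti[of "slot2 u" "slot1 v"] anti[of "slot3 u" "slot2 v"] curv_parts_sym[of v u] ext_form_commute[of v u])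
qed

end

context cubic_jet begin

text \<open>The same data for the base \<open>M\<close>: the Levi-Civita connection of \<open>K \<oplus> K\<close> on \<open>\<real>\<^sup>n \<oplus> \<real>\<^sup>n\<close> is
  the complex bilinear extension of \<open>chris\<close>. The direction of \<open>Im X\<close> comes first and plays the role of the real axis.\<close>
definition connM :: "'v \<times> 'v \<Rightarrow> 'v \<times> 'v \<Rightarrow> 'v \<times> 'v"
  where "connM u z = (chris (fst u) (fst z) - chris (snd u) (snd z), chris (fst u) (snd z) + chris (snd u) (fst z))"
definition dconnM :: "'v \<Rightarrow> 'v \<times> 'v \<Rightarrow> 'v \<times> 'v \<Rightarrow> 'v \<times> 'v"
  where "dconnM c u z = (dchris c (fst u) (fst z) - dchris c (snd u) (snd z), dchris c (fst u) (snd z) + dchris c (snd u) (fst z))"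
definition curvM :: "'v \<times> 'v \<Rightarrow> 'v \<times> 'v \<Rightarrow> 'v \<times> 'v \<Rightarrow> 'v \<times> 'v"
  where "curvM u v z = dconnM (fst u) v z - dconnM (fst v) u z + connM u (connM v z) - connM v (connM u z)
   - connM (connM u v - connM v u) z"
definition frame_formM :: "'v \<times> 'v \<Rightarrow> 'v \<times> 'v \<Rightarrow> real" where "frame_formM y z = K (fst y) (fst z) + K (snd y) (snd z)"
definition slotM :: "nat \<Rightarrow> 'v \<Rightarrow> 'v \<times> 'v" where "slotM k w = (if k = 0 then (w, 0) else (0, w))"
definition pureM :: "'v \<Rightarrow> 'v \<Rightarrow> 'v \<Rightarrow> 'v" where "pureM u v z = chris v (chris u z) - chris u (chris v z)"
definition mixedM :: "'v \<Rightarrow> 'v \<Rightarrow> 'v \<Rightarrow> 'v" where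
  "mixedM u v z = (2 * K u v) *\<^sub>R z + K u z *\<^sub>R v + K v z *\<^sub>R u - m u (m v z) - m v (m u z)"

lemma sectorM: "curvM (u,0) (v,0) z = (pureM u v (fst z), pureM u v (snd z))"
  "curvM (0,u) (0,v) z = (pureM u v (fst z), pureM u v (snd z))"
  "curvM (u,0) (0,v) z = (- mixedM u v (snd z), mixedM u v (fst z))"
  "curvM (0,u) (v,0) z = (mixedM v u (snd z), - mixedM v u (fst z))"
  by (cases z, simp add: curvM_def connM_def dconnM_def pureM_def mixedM_def chris_lin dchris_0,
      (intro conjI)?; rule K_eqI; simp add: jet_simps)+

lemma curvM_norm_block:
  "(\<Sum>k\<in>{0,1}. \<Sum>l\<in>{0,1}. \<Sum>i\<in>{0,1}. \<Sum>j\<in>{0,1}. (frame_formM (slotM i a) (curvM (slotM k u) (slotM l v) (slotM j b)))\<^sup>2)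
   = 4 * (K a (pureM u v b))\<^sup>2 + 2 * (K a (mixedM u v b))\<^sup>2 + 2 * (K a (mixedM v u b))\<^sup>2"
proof -
  have "pureM u v 0 = 0" "mixedM u v 0 = 0" for u v by (simp_all add: pureM_def mixedM_def chris_lin m_lin K_lin)
  then show ?thesis by (simp add: slotM_def sectorM frame_formM_def K_lin)
qed

end

text \<open>An orthonormal basis of \<open>K\<close>. Completeness is assumed separately, to avoid a dimension count in an abstract
  vector space.\<close>
locale cubic_jet_basis = cubic_jet K m x for K :: "'v::real_vector \<Rightarrow> 'v \<Rightarrow> real" and m x +
  fixes f :: "'n::finite \<Rightarrow> 'v"
  assumes f_orthonormal: "K (f a) (f b) = (if a = b then 1 else 0)"
    and f_complete: "(\<Sum>a\<in>UNIV. K v (f a) *\<^sub>R f a) = v"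
begin

definition bas :: "'n option \<Rightarrow> real \<times> 'v" where "bas A = (case A of None \<Rightarrow> (1, 0) | Some a \<Rightarrow> (0, f a))"

lemma bas_simps[simp]: "bas None = (1,0)" "bas (Some a) = (0, f a)" by (simp_all add: bas_def)

lemma ext_form_complete: "(\<Sum>A\<in>UNIV. ext_form w (bas A) *\<^sub>R bas A) = w"
  using f_complete[of "snd w"]
  by (simp add: UNIV_option_conv sum.insert sum.reindex ext_form_def K_lin prod_eq_iff fst_sum snd_sum)

lemma sum_times4: "(\<Sum>\<alpha>\<in>UNIV\<times>{0,1,2,3::nat}. F (fst \<alpha>) (snd \<alpha>)) = (\<Sum>A\<in>(UNIV::'n option set). F A 0 + F A 1 + F A 2 + F A 3)"
  for F :: "'n option \<Rightarrow> nat \<Rightarrow> 'b::comm_monoid_add"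
  using sum.cartesian_product[of F "{0,1,2,3}" UNIV] by (simp add: case_prod_unfold add.assoc)

lemma frame_form_complete: "(\<Sum>\<alpha>\<in>UNIV \<times> {0,1,2,3}. frame_form z (slot (snd \<alpha>) (bas (fst \<alpha>))) *\<^sub>R slot (snd \<alpha>) (bas (fst \<alpha>))) = z"
proof -
  obtain a b c d where z: "z = (a,b,c,d)" by (metis prod.exhaust)
  show ?thesis
    using ext_form_complete[of a] ext_form_complete[of b] ext_form_complete[of c] ext_form_complete[of d]
    unfolding sum_times4[of "\<lambda>A k. frame_form z (slot k (bas A)) *\<^sub>R slot k (bas A)"]
    by (simp add: z slot_def slot_defs frame_form_def ext_form_lin sum.distrib prod_eq_iff fst_sum snd_sum)
qed

definition cform_norm_sq :: real where "cform_norm_sq = (\<Sum>a\<in>UNIV. \<Sum>b\<in>UNIV. \<Sum>d\<in>UNIV. (cform (f a) (f b) (f d))\<^sup>2)"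
abbreviation sum4 :: "('n \<Rightarrow> 'n \<Rightarrow> 'n \<Rightarrow> 'n \<Rightarrow> real) \<Rightarrow> real" where
  "sum4 F \<equiv> (\<Sum>a\<in>UNIV. \<Sum>b\<in>UNIV. \<Sum>c\<in>UNIV. \<Sum>d\<in>UNIV. F a b c d)"
text \<open>The two blocks of the curvature tensor of \<open>M\<close>: the first for two real or two imaginary
  directions, the second for one of each. The index \<open>a\<close> belongs to the output and \<open>b\<close> to the argument, while
  \<open>c\<close> and \<open>d\<close> are the directions.\<close>
definition curv_pure where "curv_pure a b c d = K (f a) (chris (f d) (chris (f c) (f b)) - chris (f c) (chris (f d) (f b)))"
definition curv_mixed where "curv_mixed a b c d = K (f a) ((2 * K (f c) (f d)) *\<^sub>R f b + K (f c) (f b) *\<^sub>R f d + K (f d) (f b) *\<^sub>R f c - m (f c) (m (f d) (f b)) - m (f d) (m (f c) (f b)))"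
definition kappa where "kappa a b c d = K (m (f a) (f b)) (m (f c) (f d))"
definition sigma_comp where "sigma_comp a b c d = K (f a) (sigma (f c) (f d) (f b))"
abbreviation kron :: "'n \<Rightarrow> 'n \<Rightarrow> real" where "kron a b \<equiv> (if a = b then 1 else 0)"

lemma sum_curv0: "(\<Sum>A\<in>UNIV. \<Sum>B\<in>UNIV. \<Sum>C\<in>UNIV. \<Sum>D\<in>UNIV. (ext_form (bas A) (curv0 (bas C) (bas D) (bas B)))\<^sup>2)
   = sum4 (\<lambda>a b c d. (curv_pure a b c d)\<^sup>2)"
  by (simp add: sum_option curv0_def ext_form_def K_lin chris_lin curv_pure_def)

lemma curv1_blocks:
  "ext_form (1,0) (curv1 (1,0) (1,0) (1,0)) = 3"
  "ext_form (1,0) (curv1 (1,0) (0, f d) (1,0)) = 0"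
  "ext_form (1,0) (curv1 (0, f c) (1,0) (1,0)) = 0"
  "ext_form (1,0) (curv1 (0, f c) (0, f d) (1,0)) = - kron c d"
  "ext_form (1,0) (curv1 (1,0) (1,0) (0, f b)) = 0"
  "ext_form (1,0) (curv1 (1,0) (0, f d) (0, f b)) = 0"
  "ext_form (1,0) (curv1 (0, f c) (1,0) (0, f b)) = 0"
  "ext_form (1,0) (curv1 (0, f c) (0, f d) (0, f b)) = 0"
  "ext_form (0, f a) (curv1 (1,0) (1,0) (1,0)) = 0"
  "ext_form (0, f a) (curv1 (1,0) (0, f d) (1,0)) = 0"
  "ext_form (0, f a) (curv1 (0, f c) (1,0) (1,0)) = 0"
  "ext_form (0, f a) (curv1 (0, f c) (0, f d) (1,0)) = 0"
  "ext_form (0, f a) (curv1 (1,0) (1,0) (0, f b)) = - kron a b"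
  "ext_form (0, f a) (curv1 (1,0) (0, f d) (0, f b)) = 0"
  "ext_form (0, f a) (curv1 (0, f c) (1,0) (0, f b)) = 0"
  "ext_form (0, f a) (curv1 (0, f c) (0, f d) (0, f b)) = curv_mixed a b c d - kron a b * kron c d"
  by (simp_all add: curv1_def ext_form_def curv_mixed_def K_lin m_lin f_orthonormal)

lemma cform_K: "K (m (f a) (f b)) (f d) = cform (f a) (f b) (f d)" "K (f d) (m (f a) (f b)) = cform (f a) (f b) (f d)"
  by (simp_all add: cform_def K_commute)

lemma curv2_blocks:
  "ext_form (1,0) (curv2 (1,0) (1,0) (1,0)) = 0"
  "ext_form (1,0) (curv2 (1,0) (0, f d) (1,0)) = 0"
  "ext_form (1,0) (curv2 (0, f c) (1,0) (1,0)) = 0"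
  "ext_form (1,0) (curv2 (0, f c) (0, f d) (1,0)) = 0"
  "ext_form (1,0) (curv2 (1,0) (1,0) (0, f b)) = 0"
  "ext_form (1,0) (curv2 (1,0) (0, f d) (0, f b)) = kron b d"
  "ext_form (1,0) (curv2 (0, f c) (1,0) (0, f b)) = kron b c"
  "ext_form (1,0) (curv2 (0, f c) (0, f d) (0, f b)) = cform (f b) (f c) (f d)"
  "ext_form (0, f a) (curv2 (1,0) (1,0) (1,0)) = 0"
  "ext_form (0, f a) (curv2 (1,0) (0, f d) (1,0)) = kron a d"
  "ext_form (0, f a) (curv2 (0, f c) (1,0) (1,0)) = kron a c"
  "ext_form (0, f a) (curv2 (0, f c) (0, f d) (1,0)) = cform (f a) (f c) (f d)"
  "ext_form (0, f a) (curv2 (1,0) (1,0) (0, f b)) = 0"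
  "ext_form (0, f a) (curv2 (1,0) (0, f d) (0, f b)) = cform (f a) (f b) (f d)"
  "ext_form (0, f a) (curv2 (0, f c) (1,0) (0, f b)) = cform (f a) (f b) (f c)"
  "ext_form (0, f a) (curv2 (0, f c) (0, f d) (0, f b)) = sigma_comp a b c d + kappa a b c d"
  by (simp_all add: curv2_def ext_form_def sigma_comp_def kappa_def K_lin m_lin f_orthonormal sigma_0 K_m_m cform_K cform_swap12 cform_swap23 eq_commute)

lemma curv3_blocks:
  "ext_form (1,0) (curv3 (1,0) (1,0) (1,0)) = 0"
  "ext_form (1,0) (curv3 (1,0) (0, f d) (1,0)) = 0"
  "ext_form (1,0) (curv3 (0, f c) (1,0) (1,0)) = 0"
  "ext_form (1,0) (curv3 (0, f c) (0, f d) (1,0)) = 0"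
  "ext_form (1,0) (curv3 (1,0) (1,0) (0, f b)) = 0"
  "ext_form (1,0) (curv3 (1,0) (0, f d) (0, f b)) = kron b d"
  "ext_form (1,0) (curv3 (0, f c) (1,0) (0, f b)) = kron b c"
  "ext_form (1,0) (curv3 (0, f c) (0, f d) (0, f b)) = - cform (f b) (f c) (f d)"
  "ext_form (0, f a) (curv3 (1,0) (1,0) (1,0)) = 0"
  "ext_form (0, f a) (curv3 (1,0) (0, f d) (1,0)) = kron a d"
  "ext_form (0, f a) (curv3 (0, f c) (1,0) (1,0)) = kron a c"
  "ext_form (0, f a) (curv3 (0, f c) (0, f d) (1,0)) = - cform (f a) (f c) (f d)"
  "ext_form (0, f a) (curv3 (1,0) (1,0) (0, f b)) = 0"
  "ext_form (0, f a) (curv3 (1,0) (0, f d) (0, f b)) = - cform (f a) (f b) (f d)"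
  "ext_form (0, f a) (curv3 (0, f c) (1,0) (0, f b)) = - cform (f a) (f b) (f c)"
  "ext_form (0, f a) (curv3 (0, f c) (0, f d) (0, f b)) = kappa a b c d - sigma_comp a b c d"
  by (simp_all add: curv3_def ext_form_def sigma_comp_def kappa_def K_lin m_lin f_orthonormal sigma_0 K_m_m cform_K cform_swap12 cform_swap23 eq_commute)

lemma sum_kron: "(\<Sum>a\<in>UNIV. \<Sum>b\<in>UNIV. (kron a b)\<^sup>2) = real CARD('n)"
  by (simp add: if_distrib[of "\<lambda>x. x\<^sup>2"] cong: if_cong)

lemma sum_curv1: "(\<Sum>A\<in>UNIV. \<Sum>B\<in>UNIV. \<Sum>C\<in>UNIV. \<Sum>D\<in>UNIV. (ext_form (bas A) (curv1 (bas C) (bas D) (bas B)))\<^sup>2)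
   = 9 + 2 * real CARD('n) + sum4 (\<lambda>a b c d. (curv_mixed a b c d - kron a b * kron c d)\<^sup>2)"
  unfolding sum_option bas_simps curv1_blocks
  by (simp only: sum.distrib sum_kron power2_minus) simp

lemma sum_curv2: "(\<Sum>A\<in>UNIV. \<Sum>B\<in>UNIV. \<Sum>C\<in>UNIV. \<Sum>D\<in>UNIV. (ext_form (bas A) (curv2 (bas C) (bas D) (bas B)))\<^sup>2)
   = 4 * real CARD('n) + 4 * cform_norm_sq + sum4 (\<lambda>a b c d. (sigma_comp a b c d + kappa a b c d)\<^sup>2)"
  unfolding sum_option bas_simps curv2_blocks
  by (simp only: sum.distrib sum_kron power2_minus cform_norm_sq_def) simp
lemma sum_curv3: "(\<Sum>A\<in>UNIV. \<Sum>B\<in>UNIV. \<Sum>C\<in>UNIV. \<Sum>D\<in>UNIV. (ext_form (bas A) (curv3 (bas C) (bas D) (bas B)))\<^sup>2)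
   = 4 * real CARD('n) + 4 * cform_norm_sq + sum4 (\<lambda>a b c d. (kappa a b c d - sigma_comp a b c d)\<^sup>2)"
  unfolding sum_option bas_simps curv3_blocks
  by (simp only: sum.distrib sum_kron power2_minus cform_norm_sq_def) simp

definition frame_norm :: real where
  "frame_norm = (\<Sum>\<alpha>\<in>UNIV\<times>{0,1,2,3}. \<Sum>\<beta>\<in>UNIV\<times>{0,1,2,3}. \<Sum>\<gamma>\<in>UNIV\<times>{0,1,2,3}. \<Sum>\<delta>\<in>UNIV\<times>{0,1,2,3}.
    (frame_form (slot (snd \<alpha>) (bas (fst \<alpha>))) (curv_frame (slot (snd \<gamma>) (bas (fst \<gamma>))) (slot (snd \<delta>) (bas (fst \<delta>)))
      (slot (snd \<beta>) (bas (fst \<beta>)))))\<^sup>2)"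

lemma sum_ext_form: "(\<Sum>A\<in>UNIV. \<Sum>B\<in>UNIV. (ext_form (bas A) (bas B))\<^sup>2) = real CARD('n) + 1"
  by (simp add: sum_option ext_form_def K_lin f_orthonormal if_distrib[of "\<lambda>x. x\<^sup>2"] cong: if_cong)

text \<open>The constants count the components of the four endomorphisms with at least one index in the summand \<open>\<real>\<close> of \<open>W\<close>,
  and \<open>48(n+1)\<^sup>2\<close> is the contribution of the right units.\<close>
lemma frame_norm_eq: "frame_norm = 16 * (sum4 (\<lambda>a b c d. (curv_pure a b c d)\<^sup>2)
    + sum4 (\<lambda>a b c d. (curv_mixed a b c d - kron a b * kron c d)\<^sup>2)
    + sum4 (\<lambda>a b c d. (sigma_comp a b c d + kappa a b c d)\<^sup>2) + sum4 (\<lambda>a b c d. (kappa a b c d - sigma_comp a b c d)\<^sup>2)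
    + 9 + 10 * real CARD('n) + 8 * cform_norm_sq) + 48 * (real CARD('n) + 1)\<^sup>2"
proof -
  have "frame_norm = (\<Sum>A\<in>UNIV. \<Sum>B\<in>UNIV. \<Sum>C\<in>UNIV. \<Sum>D\<in>UNIV. \<Sum>k\<in>{0,1,2,3}. \<Sum>l\<in>{0,1,2,3}.
     block_norm (curv_frame (slot k (bas C)) (slot l (bas D))) (bas A) (bas B))"
    unfolding frame_norm_def block_norm_def by (rule sum_interleave)
  also have "\<dots> = (\<Sum>A\<in>UNIV. \<Sum>B\<in>UNIV. \<Sum>C\<in>UNIV. \<Sum>D\<in>UNIV.
     16 * (ext_form (bas A) (curv0 (bas C) (bas D) (bas B)))\<^sup>2 + 16 * (ext_form (bas A) (curv1 (bas C) (bas D) (bas B)))\<^sup>2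
     + 16 * (ext_form (bas A) (curv2 (bas C) (bas D) (bas B)))\<^sup>2 + 16 * (ext_form (bas A) (curv3 (bas C) (bas D) (bas B)))\<^sup>2
     + 48 * ((ext_form (bas A) (bas B))\<^sup>2 * (ext_form (bas C) (bas D))\<^sup>2))"
    by (simp only: curv_frame_norm_block distrib_left mult_ac)
  also have "\<dots> = 16 * (sum4 (\<lambda>a b c d. (curv_pure a b c d)\<^sup>2)) + 16 * (9 + 2 * real CARD('n) + sum4 (\<lambda>a b c d. (curv_mixed a b c d - kron a b * kron c d)\<^sup>2))
    + 16 * (4 * real CARD('n) + 4 * cform_norm_sq + sum4 (\<lambda>a b c d. (sigma_comp a b c d + kappa a b c d)\<^sup>2))
    + 16 * (4 * real CARD('n) + 4 * cform_norm_sq + sum4 (\<lambda>a b c d. (kappa a b c d - sigma_comp a b c d)\<^sup>2))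
    + 48 * ((real CARD('n) + 1) * (real CARD('n) + 1))"
    by (simp only: sum.distrib sum_distrib_left[symmetric] sum_distrib_right[symmetric] sum_curv0 sum_curv1 sum_curv2 sum_curv3 sum_ext_form)
  finally show ?thesis by (simp add: power2_eq_square)
qed

lemma parseval: "K v w = (\<Sum>d\<in>UNIV. K v (f d) * K w (f d))"
proof -
  have "K v w = K v (\<Sum>d\<in>UNIV. K w (f d) *\<^sub>R f d)" by (simp add: f_complete)
  also have "\<dots> = (\<Sum>d\<in>UNIV. K v (f d) * K w (f d))"
    by (simp add: linear_sum[OF bilinear_def[THEN iffD1, OF K_bilinear, THEN conjunct1, rule_format]] K_lin mult.commute)
  finally show ?thesis .
qed

lemma sum_kappa_acac: "(\<Sum>a\<in>UNIV. \<Sum>c\<in>UNIV. kappa a c a c) = cform_norm_sq"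
  by (simp add: kappa_def parseval[of "m _ _" "m _ _"] cform_norm_sq_def cform_def power2_eq_square)

lemma kappa_sym: "kappa b a c d = kappa a b c d" "kappa a b d c = kappa a b c d" "kappa c d a b = kappa a b c d"
  by (simp_all add: kappa_def m_commute K_commute)

lemma curv_pure_kappa: "curv_pure a b c d = kappa a d b c - kappa a c b d + kron a d * kron b c - kron a c * kron b d"
  unfolding curv_pure_def chris_commutator
  by (simp add: K_lin f_orthonormal kappa_def m_commute[of "f d" "f b"] m_commute[of "f c" "f b"] flip: K_m)

lemma curv_mixed_kappa: "curv_mixed a b c d = 2 * (kron a b * kron c d) + kron a c * kron b d + kron a d * kron b c - kappa a c b d - kappa a d b c"
  by (simp add: curv_mixed_def K_lin f_orthonormal kappa_def m_commute[of "f d" "f b"] m_commute[of "f c" "f b"] flip: K_m)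

lemma sum4_swap_bc: "sum4 (\<lambda>a b c d. F a c b d) = sum4 F"
  by (rule sum.cong[OF refl], rule sum.swap)
lemma sum4_swap_cd: "sum4 (\<lambda>a b c d. F a b d c) = sum4 F"
  by (rule sum.cong[OF refl], rule sum.cong[OF refl], rule sum.swap)

lemma sum_if0: "(\<Sum>a\<in>A. if P then g a else 0) = (if P then sum g A else (0::real))"
  by simp

lemma sum4_kron: "sum4 (\<lambda>a b c d. kron a b * kron c d * F a b c d) = (\<Sum>a\<in>UNIV. \<Sum>c\<in>UNIV. F a a c c)"
  "sum4 (\<lambda>a b c d. kron a c * kron b d * F a b c d) = (\<Sum>a\<in>UNIV. \<Sum>b\<in>UNIV. F a b a b)"
  "sum4 (\<lambda>a b c d. kron a d * kron b c * F a b c d) = (\<Sum>a\<in>UNIV. \<Sum>b\<in>UNIV. F a b b a)"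
  by (simp_all add: if_distrib[of "\<lambda>x. x * _"] sum_if0 cong: if_cong)

text \<open>Elimination of \<open>\<kappa>\<close>. Both blocks of the curvature of \<open>M\<close> are combinations of permuted copies of \<open>\<kappa>\<close> and of
  Kronecker deltas; the products of two different permutations of \<open>\<kappa>\<close> cancel between the two blocks, and what is
  left consists of \<open>|\<kappa>|\<^sup>2\<close> and traces.\<close>
lemma sum4_quadratic:
  "16 * sum4 (\<lambda>a b c d. (curv_pure a b c d)\<^sup>2) + 16 * sum4 (\<lambda>a b c d. (curv_mixed a b c d - kron a b * kron c d)\<^sup>2)
    + 32 * sum4 (\<lambda>a b c d. (kappa a b c d)\<^sup>2)
   = 24 * sum4 (\<lambda>a b c d. (curv_pure a b c d)\<^sup>2) + 24 * sum4 (\<lambda>a b c d. (curv_mixed a b c d)\<^sup>2)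
    + 192 * cform_norm_sq - 112 * (real CARD('n))\<^sup>2 - 128 * real CARD('n)"
proof -
  have pt: "16 * (curv_pure a b c d)\<^sup>2 + 16 * (curv_mixed a b c d - kron a b * kron c d)\<^sup>2 + 32 * (kappa a b c d)\<^sup>2
      = 24 * (curv_pure a b c d)\<^sup>2 + 24 * (curv_mixed a b c d)\<^sup>2 + 32 * (kappa a b c d)\<^sup>2 - 16 * (kappa a c b d)\<^sup>2 - 16 * (kappa a d b c)\<^sup>2
       - 80 * (kron a b * kron c d * 1) - 16 * (kron a c * kron b d * 1) - 16 * (kron a d * kron b c * 1)
       - 64 * (kron a b * kron c d * (kron a c * kron b d)) - 64 * (kron a b * kron c d * (kron a d * kron b c))
       + 64 * (kron a b * kron c d * kappa a c b d) + 64 * (kron a b * kron c d * kappa a d b c)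
       + 32 * (kron a c * kron b d * kappa a d b c) + 32 * (kron a d * kron b c * kappa a c b d)" for a b c d
    unfolding curv_pure_kappa curv_mixed_kappa by (simp add: power2_eq_square algebra_simps)
  have s1: "sum4 (\<lambda>a b c d. (kappa a c b d)\<^sup>2) = sum4 (\<lambda>a b c d. (kappa a b c d)\<^sup>2)"
    by (rule sum4_swap_bc)
  have s2: "sum4 (\<lambda>a b c d. (kappa a d b c)\<^sup>2) = sum4 (\<lambda>a b c d. (kappa a b c d)\<^sup>2)"
    using sum4_swap_bc[of "\<lambda>a c b d. (kappa a d b c)\<^sup>2"] sum4_swap_cd[of "\<lambda>a c d b. (kappa a d b c)\<^sup>2"] sum4_swap_bc[of "\<lambda>a d c b. (kappa a d b c)\<^sup>2"]
     sum4_swap_cd[of "\<lambda>a d b c. (kappa a d b c)\<^sup>2"] by simp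
  have "sum4 (\<lambda>a b c d. 16 * (curv_pure a b c d)\<^sup>2 + 16 * (curv_mixed a b c d - kron a b * kron c d)\<^sup>2 + 32 * (kappa a b c d)\<^sup>2)
     = 24 * sum4 (\<lambda>a b c d. (curv_pure a b c d)\<^sup>2) + 24 * sum4 (\<lambda>a b c d. (curv_mixed a b c d)\<^sup>2)
    + 192 * cform_norm_sq - 112 * (real CARD('n))\<^sup>2 - 128 * real CARD('n)"
    unfolding pt
    by (simp only: sum.distrib sum_subtractf sum_distrib_left[symmetric] s1 s2 sum4_kron)
       (simp add: sum_kappa_acac kappa_sym power2_eq_square if_distrib[of "\<lambda>x. x * _"] cong: if_cong)
  then show ?thesis by (simp only: sum.distrib sum_distrib_left[symmetric])
qed

theorem frame_norm_formula:
  "frame_norm = 64 * (real CARD('n) + 1) * (4 * real CARD('n) + 3)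
     + 160 * (- 2 * real CARD('n) * (real CARD('n) + 1) + 2 * cform_norm_sq)
     + 6 * (4 * sum4 (\<lambda>a b c d. (curv_pure a b c d)\<^sup>2) + 4 * sum4 (\<lambda>a b c d. (curv_mixed a b c d)\<^sup>2))
     + 32 * sum4 (\<lambda>a b c d. (sigma_comp a b c d)\<^sup>2)"
proof -
  have pt: "(sigma_comp a b c d + kappa a b c d)\<^sup>2 + (kappa a b c d - sigma_comp a b c d)\<^sup>2 = 2 * (sigma_comp a b c d)\<^sup>2 + 2 * (kappa a b c d)\<^sup>2" for a b c d
    by (simp add: power2_eq_square algebra_simps)
  have "sum4 (\<lambda>a b c d. (sigma_comp a b c d + kappa a b c d)\<^sup>2) + sum4 (\<lambda>a b c d. (kappa a b c d - sigma_comp a b c d)\<^sup>2)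
     = 2 * sum4 (\<lambda>a b c d. (sigma_comp a b c d)\<^sup>2) + 2 * sum4 (\<lambda>a b c d. (kappa a b c d)\<^sup>2)"
    by (simp only: sum.distrib[symmetric] pt sum_distrib_left)
  with sum4_quadratic show ?thesis
    unfolding frame_norm_eq by (simp add: power2_eq_square algebra_simps)
qed

lemma frame_formM_complete: "(\<Sum>\<alpha>\<in>UNIV \<times> {0,1}. frame_formM z (slotM (snd \<alpha>) (f (fst \<alpha>))) *\<^sub>R slotM (snd \<alpha>) (f (fst \<alpha>))) = z"
proof -
  have "(\<Sum>\<alpha>\<in>UNIV \<times> {0,1}. frame_formM z (slotM (snd \<alpha>) (f (fst \<alpha>))) *\<^sub>R slotM (snd \<alpha>) (f (fst \<alpha>)))
    = (\<Sum>a\<in>UNIV. frame_formM z (slotM 0 (f a)) *\<^sub>R slotM 0 (f a) + frame_formM z (slotM 1 (f a)) *\<^sub>R slotM 1 (f a))"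
    using sum.cartesian_product[of "\<lambda>a k. frame_formM z (slotM k (f a)) *\<^sub>R slotM k (f a)" "{0,1}" UNIV]
    by (simp add: case_prod_unfold)
  then show ?thesis
    using f_complete[of "fst z"] f_complete[of "snd z"]
    by (simp add: slotM_def frame_formM_def K_lin sum.distrib prod_eq_iff fst_sum snd_sum)
qed

text \<open>The curvature tensor of \<open>M\<close> has four sectors, of which two have the pure and two have the mixed type.\<close>
theorem frame_normM_formula:
  "(\<Sum>\<alpha>\<in>UNIV\<times>{0,1}. \<Sum>\<beta>\<in>UNIV\<times>{0,1}. \<Sum>\<gamma>\<in>UNIV\<times>{0,1}. \<Sum>\<delta>\<in>UNIV\<times>{0,1}.
    (frame_formM (slotM (snd \<alpha>) (f (fst \<alpha>))) (curvM (slotM (snd \<gamma>) (f (fst \<gamma>))) (slotM (snd \<delta>) (f (fst \<delta>)))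
      (slotM (snd \<beta>) (f (fst \<beta>)))))\<^sup>2)
   = 4 * sum4 (\<lambda>a b c d. (curv_pure a b c d)\<^sup>2) + 4 * sum4 (\<lambda>a b c d. (curv_mixed a b c d)\<^sup>2)" (is "?L = _")
proof -
  have "?L = sum4 (\<lambda>a b c d. 4 * (curv_pure a b c d)\<^sup>2 + 2 * (curv_mixed a b c d)\<^sup>2 + 2 * (curv_mixed a b d c)\<^sup>2)"
    by (subst sum_interleave[where F = "\<lambda>A i B j C k D l. (frame_formM (slotM i (f A)) (curvM (slotM k (f C)) (slotM l (f D)) (slotM j (f B))))\<^sup>2"])
       (simp only: curvM_norm_block curv_pure_def curv_mixed_def pureM_def mixedM_def)
  then show ?thesis
    using sum4_swap_cd[of "\<lambda>a b c d. (curv_mixed a b c d)\<^sup>2"]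
    by (simp only: sum.distrib sum_distrib_left[symmetric])
qed

end

section \<open>The cubic form and its Kaehler metric\<close>

definition sym_coeff :: "('n \<Rightarrow> 'n \<Rightarrow> 'n \<Rightarrow> real) \<Rightarrow> 'n \<Rightarrow> 'n \<Rightarrow> 'n \<Rightarrow> real"
  where "sym_coeff c i j k = c i j k + c i k j + c j i k + c j k i + c k i j + c k j i"

definition polar_low :: "('n::finite \<Rightarrow> 'n \<Rightarrow> 'n \<Rightarrow> real) \<Rightarrow> 'a::real_normed_field ^ 'n \<Rightarrow> 'a ^ 'n \<Rightarrow> 'a ^ 'n"
  where "polar_low c u v = (\<chi> k. \<Sum>i\<in>UNIV. \<Sum>j\<in>UNIV. of_real (sym_coeff c i j k) * u $ i * v $ j)"

text \<open>The polarisation of the cubic, \<open>polar c u v w = h\<^sub>\<alpha>\<^sub>\<beta>\<^sub>\<gamma> u\<^sup>\<alpha> v\<^sup>\<beta> w\<^sup>\<gamma>\<close>; all derivatives of \<open>h\<close> are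
  values of this trilinear form. It is needed over the real and over the complex numbers.\<close>
definition polar :: "('n::finite \<Rightarrow> 'n \<Rightarrow> 'n \<Rightarrow> real) \<Rightarrow> 'a::real_normed_field ^ 'n \<Rightarrow> 'a ^ 'n \<Rightarrow> 'a ^ 'n \<Rightarrow> 'a"
  where "polar c u v w = (\<Sum>i\<in>UNIV. \<Sum>j\<in>UNIV. \<Sum>k\<in>UNIV. of_real (sym_coeff c i j k) * u $ i * v $ j * w $ k)"

lemma polar_low_sum: "polar c u v w = (\<Sum>k\<in>UNIV. polar_low c u v $ k * w $ k)"
proof -
  have "polar c u v w = (\<Sum>i\<in>UNIV. \<Sum>k\<in>UNIV. \<Sum>j\<in>UNIV. of_real (sym_coeff c i j k) * u $ i * v $ j * w $ k)"
    unfolding polar_def by (intro sum.cong refl sum.swap)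
  also have "\<dots> = (\<Sum>k\<in>UNIV. \<Sum>i\<in>UNIV. \<Sum>j\<in>UNIV. of_real (sym_coeff c i j k) * u $ i * v $ j * w $ k)"
    by (rule sum.swap)
  finally show ?thesis by (simp add: polar_low_def sum_distrib_right)
qed

lemma polar_inner: "polar_low c u v \<bullet> w = polar c u v w" for u v w :: "real ^ 'n"
  by (simp add: polar_low_sum inner_vec_def)

lemma polar_commute12: "polar c v u w = polar c u v w"
  unfolding polar_def
  by (subst sum.swap) (simp add: sym_coeff_def algebra_simps)

lemma polar_commute23: "polar c u w v = polar c u v w"
  unfolding polar_def
  by (rule sum.cong[OF refl], subst sum.swap) (simp add: sym_coeff_def algebra_simps)

lemma polar_lin:
  "polar c (u + u') v w = polar c u v w + polar c u' v w"
  "polar c u (v + v') w = polar c u v w + polar c u v' w"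
  "polar c u v (w + w') = polar c u v w + polar c u v w'"
  "polar c (- u) v w = - polar c u v w" "polar c u (- v) w = - polar c u v w" "polar c u v (- w) = - polar c u v w"
  "polar c (u - u') v w = polar c u v w - polar c u' v w"
  "polar c u (v - v') w = polar c u v w - polar c u v' w"
  "polar c u v (w - w') = polar c u v w - polar c u v w'"
  "polar c (r *s u) v w = r * polar c u v w" "polar c u (r *s v) w = r * polar c u v w"
  "polar c u v (r *s w) = r * polar c u v w"
  by (simp_all add: polar_def sum.distrib sum_subtractf sum_negf sum_distrib_left algebra_simps)

lemma polar_scaleR:
  fixes u v w :: "real ^ 'n"
  shows "polar c (r *\<^sub>R u) v w = r * polar c u v w" "polar c u (r *\<^sub>R v) w = r * polar c u v w"
  "polar c u v (r *\<^sub>R w) = r * polar c u v w"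
  by (simp_all add: polar_lin flip: scalar_mult_eq_scaleR)

lemma polar_0: "polar c 0 v w = 0" "polar c u 0 w = 0" "polar c u v 0 = 0"
  by (simp_all add: polar_def)

lemma cubic_polar: "cubic c x = polar c x x x / 6"
proof -
  have r: "(\<Sum>i\<in>UNIV. \<Sum>j\<in>UNIV. \<Sum>k\<in>UNIV. F i j k) = (\<Sum>(i,j,k)\<in>UNIV. F i j k)" for F :: "'b \<Rightarrow> 'b \<Rightarrow> 'b \<Rightarrow> 'a"
    by (simp add: sum.cartesian_product UNIV_Times_UNIV[symmetric] del: UNIV_Times_UNIV)
  let ?T = "\<lambda>i j k. of_real (c i j k) * x $ i * x $ j * x $ k"
  have ikj: "(\<Sum>(i,j,k)\<in>UNIV. F i k j) = (\<Sum>(i,j,k)\<in>UNIV. F i j k)" for F :: "'b \<Rightarrow> 'b \<Rightarrow> 'b \<Rightarrow> 'a"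
    by (rule sum.reindex_bij_witness[of _ "\<lambda>(i,j,k). (i,k,j)" "\<lambda>(i,j,k). (i,k,j)"]) auto
  have jik: "(\<Sum>(i,j,k)\<in>UNIV. F j i k) = (\<Sum>(i,j,k)\<in>UNIV. F i j k)" for F :: "'b \<Rightarrow> 'b \<Rightarrow> 'b \<Rightarrow> 'a"
    by (rule sum.reindex_bij_witness[of _ "\<lambda>(i,j,k). (j,i,k)" "\<lambda>(i,j,k). (j,i,k)"]) auto
  have jki: "(\<Sum>(i,j,k)\<in>UNIV. F j k i) = (\<Sum>(i,j,k)\<in>UNIV. F i j k)" for F :: "'b \<Rightarrow> 'b \<Rightarrow> 'b \<Rightarrow> 'a"
    by (rule sum.reindex_bij_witness[of _ "\<lambda>(i,j,k). (k,i,j)" "\<lambda>(i,j,k). (j,k,i)"]) auto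
  have kij: "(\<Sum>(i,j,k)\<in>UNIV. F k i j) = (\<Sum>(i,j,k)\<in>UNIV. F i j k)" for F :: "'b \<Rightarrow> 'b \<Rightarrow> 'b \<Rightarrow> 'a"
    by (rule sum.reindex_bij_witness[of _ "\<lambda>(i,j,k). (j,k,i)" "\<lambda>(i,j,k). (k,i,j)"]) auto
  have kji: "(\<Sum>(i,j,k)\<in>UNIV. F k j i) = (\<Sum>(i,j,k)\<in>UNIV. F i j k)" for F :: "'b \<Rightarrow> 'b \<Rightarrow> 'b \<Rightarrow> 'a"
    by (rule sum.reindex_bij_witness[of _ "\<lambda>(i,j,k). (k,j,i)" "\<lambda>(i,j,k). (k,j,i)"]) auto
  have "polar c x x x = (\<Sum>(i,j,k)\<in>UNIV. ?T i j k) + (\<Sum>(i,j,k)\<in>UNIV. ?T i k j) + (\<Sum>(i,j,k)\<in>UNIV. ?T j i k)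
     + (\<Sum>(i,j,k)\<in>UNIV. ?T j k i) + (\<Sum>(i,j,k)\<in>UNIV. ?T k i j) + (\<Sum>(i,j,k)\<in>UNIV. ?T k j i)"
    unfolding polar_def r sum.distrib[symmetric] by (simp add: case_prod_unfold sym_coeff_def algebra_simps)
  also have "\<dots> = 6 * cubic c x" unfolding ikj[of ?T] jik[of ?T] jki[of ?T] kij[of ?T] kji[of ?T] cubic_def r by simp
  finally show ?thesis by simp
qed

lemma has_derivative_polar [derivative_intros]:
  fixes f g h :: "'q::real_normed_vector \<Rightarrow> real ^ 'n"
  assumes "(f has_derivative Df) (at q within S)" "(g has_derivative Dg) (at q within S)" "(h has_derivative Dh) (at q within S)"
  shows "((\<lambda>q. polar c (f q) (g q) (h q)) has_derivative
    (\<lambda>v. polar c (Df v) (g q) (h q) + polar c (f q) (Dg v) (h q) + polar c (f q) (g q) (Dh v))) (at q within S)"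
proof -
  note d = assms[THEN bounded_linear.has_derivative[OF bounded_linear_vec_nth]]
  show ?thesis unfolding polar_def
    by (rule has_derivative_eq_rhs, (rule has_derivative_sum has_derivative_mult has_derivative_const d)+)
       (simp add: fun_eq_iff sum.distrib algebra_simps)
qed

context fixes c :: "'n::finite \<Rightarrow> 'n \<Rightarrow> 'n \<Rightarrow> real" begin

lemma has_derivative_cubic [derivative_intros]:
  fixes f :: "'q::real_normed_vector \<Rightarrow> real ^ 'n"
  assumes "(f has_derivative Df) (at q within S)"
  shows "((\<lambda>q. cubic c (f q)) has_derivative (\<lambda>v. polar c (f q) (f q) (Df v) / 2)) (at q within S)"
  unfolding cubic_polar
  by (rule has_derivative_eq_rhs[OF bounded_linear.has_derivative[OF bounded_linear_divide has_derivative_polar[OF assms assms assms]]])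
     (simp add: fun_eq_iff polar_commute23 polar_commute12[of c _ "f q" "f q"])

lemma cubic1_polar: "cubic1 c \<mu> x = polar c x x (axis \<mu> 1) / 2"
  unfolding cubic1_def by (rule dderiv_eq[OF has_derivative_cubic, OF has_derivative_ident])

lemma cubic2_polar: "cubic2 c \<mu> \<nu> x = polar c x (axis \<mu> 1) (axis \<nu> 1)"
proof -
  have "(cubic1 c \<nu> has_derivative (\<lambda>v. polar c x v (axis \<nu> 1))) (at x)"
    unfolding cubic1_polar
    by (rule has_derivative_eq_rhs[OF bounded_linear.has_derivative[OF bounded_linear_divide
          has_derivative_polar[OF has_derivative_ident has_derivative_ident has_derivative_const]]])
       (simp add: polar_0 fun_eq_iff polar_commute12[of c _ x])
  then show ?thesis unfolding cubic2_def by (rule dderiv_eq)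
qed

lemma cubic3_polar: "cubic3 c \<mu> \<nu> \<sigma> x = polar c (axis \<mu> 1) (axis \<nu> 1) (axis \<sigma> 1)"
proof -
  have "(cubic2 c \<nu> \<sigma> has_derivative (\<lambda>v. polar c v (axis \<nu> 1) (axis \<sigma> 1))) (at x)"
    unfolding cubic2_polar
    by (rule has_derivative_eq_rhs[OF has_derivative_polar[OF has_derivative_ident has_derivative_const has_derivative_const]])
       (simp add: polar_0 fun_eq_iff)
  then show ?thesis unfolding cubic3_def by (rule dderiv_eq)
qed

text \<open>The bilinear form \<open>\<K>\<^sub>\<mu>\<^sub>\<nu>\<close>: a quarter of the Hessian of \<open>-log h\<close>.\<close>
definition Kc :: "real ^ 'n \<Rightarrow> real ^ 'n \<Rightarrow> real ^ 'n \<Rightarrow> real"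
  where "Kc x u v = (polar c x x u * polar c x x v / (4 * (cubic c x)\<^sup>2) - polar c x u v / cubic c x) / 4"

text \<open>The map which represents \<open>Kc x\<close> with respect to the standard scalar product.\<close>
definition Klow :: "real ^ 'n \<Rightarrow> real ^ 'n \<Rightarrow> real ^ 'n"
  where "Klow x u = (1 / 4) *\<^sub>R ((polar c x x u / (4 * (cubic c x)\<^sup>2)) *\<^sub>R polar_low c x x - (1 / cubic c x) *\<^sub>R polar_low c x u)"

text \<open>The points at which \<open>Kc x\<close> is nondegenerate, so that it has a Levi-Civita connection. They form an open set, on which
  derivatives can be computed.\<close>
definition regular_points :: "(real ^ 'n) set" where "regular_points = {x. cubic c x > 0 \<and> det (matrix (Klow x)) \<noteq> 0}"

text \<open>The cubic form \<open>h\<^sub>\<alpha>\<^sub>\<beta>\<^sub>\<gamma> / 8h\<close> with one index raised.\<close>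
definition mc :: "real ^ 'n \<Rightarrow> real ^ 'n \<Rightarrow> real ^ 'n \<Rightarrow> real ^ 'n"
  where "mc x u v = inv (Klow x) ((1 / (8 * cubic c x)) *\<^sub>R polar_low c u v)"

lemma Klow_inner: "Klow x u \<bullet> v = Kc x u v"
  by (simp add: Klow_def Kc_def inner_diff_left polar_inner)

lemma Kc_bilinear: "bilinear (Kc x)"
  unfolding bilinear_def Kc_def by (intro conjI allI linearI)
    (simp_all add: polar_lin polar_scaleR add_divide_distrib diff_divide_distrib right_diff_distrib distrib_left distrib_right)

lemma Kc_commute: "Kc x u v = Kc x v u" by (simp add: Kc_def polar_commute23)

lemma Klow_linear: "linear (Klow x)"
proof
  show "Klow x (a + b) = Klow x a + Klow x b" "Klow x (r *\<^sub>R a) = r *\<^sub>R Klow x a" for a b r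
    using Kc_bilinear[of x]
    by (simp_all add: vector_eq_rdot[symmetric] Klow_inner inner_add_left bilinear_ladd bilinear_lmul del: vector_eq_rdot)
qed

lemma Klow_inv: assumes "x \<in> regular_points" shows "Klow x (inv (Klow x) w) = w" "inv (Klow x) (Klow x u) = u"
proof -
  have "invertible (matrix (Klow x))" using assms by (simp add: regular_points_def invertible_det_nz)
  then have "bij (Klow x)" using Klow_linear[of x]
    by (metis bijI invertible_left_inverse invertible_right_inverse matrix_left_invertible_injective matrix_right_invertible_surjective matrix_works matrix_vector_mul(2))
  then show "Klow x (inv (Klow x) w) = w" "inv (Klow x) (Klow x u) = u"
    by (simp_all add: bij_is_surj surj_f_inv_f bij_is_inj)
qed

lemma Kc_mc: assumes "x \<in> regular_points" shows "Kc x (mc x u v) w = polar c u v w / (8 * cubic c x)"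
  unfolding mc_def by (simp add: Klow_inner[symmetric] Klow_inv[OF assms] polar_inner)

lemma Kc_nondeg: assumes "x \<in> regular_points" "\<And>w. Kc x u w = 0" shows "u = 0"
proof -
  have "Klow x u = 0" using assms(2)[of "Klow x u"] by (simp flip: Klow_inner)
  then show ?thesis using Klow_inv(2)[OF assms(1), of u] Klow_inv(2)[OF assms(1), of 0] linear_0[OF Klow_linear] by metis
qed

lemma Kc_eqI: assumes "x \<in> regular_points" "\<And>w. Kc x u w = Kc x v w" shows "u = v"
  using Kc_nondeg[OF assms(1), of "u - v"] assms(2) by (simp add: bilinear_lsub[OF Kc_bilinear])

lemma Kc_x: assumes "x \<in> regular_points" shows "Kc x x u = polar c x x u / (8 * cubic c x)"
proof -
  have h: "polar c x x x = 6 * cubic c x" "cubic c x > 0" using assms by (simp_all add: cubic_polar regular_points_def)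
  show ?thesis unfolding Kc_def h(1) using h(2) by (simp add: field_simps power2_eq_square)
qed

lemma cubic_jet: assumes "x \<in> regular_points" shows "cubic_jet (Kc x) (mc x) x"
proof
  have h: "polar c x x x = 6 * cubic c x" "cubic c x > 0" using assms by (simp_all add: cubic_polar regular_points_def)
  note K_lin = bilinear_ladd[OF Kc_bilinear] bilinear_lmul[OF Kc_bilinear] bilinear_lsub[OF Kc_bilinear]
  show "bilinear (Kc x)" by (rule Kc_bilinear)
  show "Kc x u v = Kc x v u" for u v by (rule Kc_commute)
  show "mc x u v = mc x v u" for u v by (rule Kc_eqI[OF assms]) (simp add: Kc_mc assms polar_commute12)
  show "bilinear (mc x)"
    unfolding bilinear_def
    by (intro conjI allI linearI; rule Kc_eqI[OF assms])
       (simp_all add: K_lin Kc_mc assms polar_lin polar_scaleR add_divide_distrib)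
  show "Kc x (mc x u v) w = Kc x u (mc x v w)" for u v w
    by (simp add: Kc_mc assms Kc_commute[of x u] polar_commute12 polar_commute23)
  show "mc x x u = (2 * Kc x x u) *\<^sub>R x - (1 / 2) *\<^sub>R u" for u
    by (rule Kc_eqI[OF assms], simp add: K_lin Kc_mc assms Kc_x)
       (use h(2) in \<open>simp add: Kc_def field_simps power2_eq_square\<close>)
  show "Kc x x x = 3 / 4" using h by (simp add: Kc_x assms)
  show "(\<And>w. Kc x u w = 0) \<Longrightarrow> u = 0" for u by (rule Kc_nondeg[OF assms])
qed

lemma open_regular: "open regular_points"
proof -
  have c1: "continuous_on UNIV (cubic c :: real ^ 'n \<Rightarrow> real)"
    unfolding cubic_def[abs_def] by (intro continuous_intros)
  have ent: "matrix (Klow x) $ i $ j = Kc x (axis j 1) (axis i 1)" for x i j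
    by (simp add: matrix_def flip: Klow_inner) (simp add: inner_axis)
  have "continuous_on {x. cubic c x > 0} (\<lambda>x. det (matrix (Klow x)))"
    unfolding det_def ent Kc_def polar_def
    by (intro continuous_intros continuous_on_subset[OF c1]) auto
  moreover have "open {x. (cubic c x :: real) > 0}"
    using open_Collect_less[of "\<lambda>x. 0" "cubic c :: real ^ 'n \<Rightarrow> real"] c1 by simp
  ultimately have "open ({x. cubic c x > 0} \<inter> (\<lambda>x. det (matrix (Klow x))) -` (- {0}))"
    using open_Compl[OF closed_singleton[of "0::real"]]
    by (simp only: continuous_on_open_vimage Int_commute[of "{x. cubic c x > 0}"])
  also have "{x. cubic c x > 0} \<inter> (\<lambda>x. det (matrix (Klow x))) -` (- {0}) = regular_points"
    by (auto simp: regular_points_def)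
  finally show ?thesis .
qed

end

section \<open>Derivatives of the connection\<close>

context fixes c :: "'n::finite \<Rightarrow> 'n \<Rightarrow> 'n \<Rightarrow> real" begin

abbreviation "chris_at x \<equiv> cubic_jet.chris (Kc c x) (mc c x) x"
abbreviation "xi_at x \<equiv> cubic_jet.xi (Kc c x) x"
abbreviation "dm_at x \<equiv> cubic_jet.dm (Kc c x) (mc c x) x"
abbreviation "dchris_at x \<equiv> cubic_jet.dchris (Kc c x) (mc c x) x"
abbreviation "conn_at x \<equiv> cubic_jet.conn (Kc c x) (mc c x) x"
abbreviation "dconn_at x \<equiv> cubic_jet.dconn (Kc c x) (mc c x) x"

lemma xi_polar: "x \<in> regular_points c \<Longrightarrow> xi_at x u = polar c x x u / (8 * cubic c x)"
  by (simp add: cubic_jet.xi_def[OF cubic_jet] Kc_x)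

lemma D_cubic: assumes "x \<in> regular_points c" shows "(cubic c has_derivative (\<lambda>a. 4 * xi_at x a * cubic c x)) (at x)"
proof -
  have "cubic c x > 0" using assms by (simp add: regular_points_def)
  then show ?thesis
    by (intro has_derivative_eq_rhs[OF has_derivative_cubic[OF has_derivative_ident]])
       (simp add: fun_eq_iff xi_polar assms)
qed

lemma D_xi: assumes x: "x \<in> regular_points c" shows "((\<lambda>x. xi_at x u) has_derivative (\<lambda>a. - Kc c x a u)) (at x)"
proof -
  have h: "cubic c x > 0" using x by (simp add: regular_points_def)
  have 1: "((\<lambda>x. polar c x x u) has_derivative (\<lambda>a. 2 * polar c x a u)) (at x)"
    by (rule has_derivative_eq_rhs[OF has_derivative_polar[OF has_derivative_ident has_derivative_ident has_derivative_const]])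
       (simp add: fun_eq_iff polar_0 polar_commute12[of c _ x])
  have "((\<lambda>x. polar c x x u / (8 * cubic c x)) has_derivative (\<lambda>a. - Kc c x a u)) (at x)"
    by (rule has_derivative_eq_rhs[OF has_derivative_divide'[OF 1 has_derivative_mult_right[OF D_cubic[OF x]]]])
       (use h in \<open>auto simp: fun_eq_iff Kc_def xi_polar[OF x] field_simps power2_eq_square\<close>)
  then show ?thesis
    by (rule has_derivative_transform_within_open[OF _ open_regular x]) (simp add: xi_polar)
qed

text \<open>Here the product \<open>mc\<close> disappears in favour of the third derivatives, which do not depend on \<open>x\<close>.\<close>
lemma K_chris: assumes x: "x \<in> regular_points c"
  shows "Kc c x (chris_at x a u) v = (8 * xi_at x a * xi_at x u - 2 * Kc c x a u) * xi_at x v - 2 * xi_at x a * Kc c x u v - 2 * xi_at x u * Kc c x a v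
    - polar c a u v / cubic c x / 8"
proof -
  interpret J: cubic_jet "Kc c x" "mc c x" x by (rule cubic_jet[OF x])
  show ?thesis
    by (simp add: J.chris_def bilinear_lsub[OF Kc_bilinear] bilinear_lmul[OF Kc_bilinear] Kc_mc[OF x] J.K_to(3))
qed

text \<open>This identifies \<open>chris\<close> as the Christoffel symbol of a Hessian metric.\<close>
lemma D_K: assumes x: "x \<in> regular_points c" shows "((\<lambda>x. Kc c x u v) has_derivative (\<lambda>a. 2 * Kc c x (chris_at x a u) v)) (at x)"
proof -
  have h: "cubic c x > 0" using x by (simp add: regular_points_def)
  have 2: "((\<lambda>x. polar c x u v / cubic c x) has_derivative (\<lambda>a. polar c a u v / cubic c x - polar c x u v / cubic c x * (4 * xi_at x a))) (at x)"
    by (rule has_derivative_eq_rhs[OF has_derivative_divide'[OF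
      has_derivative_polar[OF has_derivative_ident has_derivative_const has_derivative_const] D_cubic[OF x]]])
       (use h in \<open>auto simp: fun_eq_iff polar_0 field_simps\<close>)
  have e: "Kc c y u v = 4 * xi_at y u * xi_at y v - polar c y u v / cubic c y / 4" if "y \<in> regular_points c" for y
    using that by (simp add: xi_polar Kc_def regular_points_def field_simps power2_eq_square)
  have p: "polar c x u v / cubic c x = 16 * xi_at x u * xi_at x v - 4 * Kc c x u v" using e[OF x] by simp
  have "((\<lambda>x. 4 * xi_at x u * xi_at x v - polar c x u v / cubic c x / 4) has_derivative (\<lambda>a. 2 * Kc c x (chris_at x a u) v)) (at x)"
    by (rule has_derivative_eq_rhs[OF has_derivative_diff[OF has_derivative_mult[OF has_derivative_mult_right[OF D_xi[OF x]] D_xi[OF x]]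
       bounded_linear.has_derivative[OF bounded_linear_divide 2]]])
       (simp add: fun_eq_iff K_chris[OF x] p algebra_simps add_divide_distrib diff_divide_distrib
         del: times_divide_eq_left times_divide_eq_right divide_divide_eq_left; simp)
  then show ?thesis
    by (rule has_derivative_transform_within_open[OF _ open_regular x]) (simp add: e)
qed

lemma D_Klow: assumes x: "x \<in> regular_points c" shows "((\<lambda>x. Klow c x u) has_derivative (\<lambda>a. 2 *\<^sub>R Klow c x (chris_at x a u))) (at x)"
  by (subst has_derivative_componentwise_within) (simp add: Klow_inner D_K[OF x])

lemma D_m: assumes x: "x \<in> regular_points c" shows "((\<lambda>x. mc c x u v) has_derivative (\<lambda>a. dm_at x a u v)) (at x)"
proof -
  have h: "cubic c x > 0" using x by (simp add: regular_points_def)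
  have N: "((\<lambda>y. inv (Klow c y) w) has_derivative (\<lambda>a. - inv (Klow c x) (2 *\<^sub>R Klow c x (chris_at x a (inv (Klow c x) w))))) (at x)" for w
    by (rule has_derivative_inverse_family[OF open_regular x Klow_linear Klow_inv(2) Klow_inv(1) D_Klow[OF x]])
  have lN: "linear (inv (Klow c y))" if "y \<in> regular_points c" for y
  proof
    have "Klow c y (inv (Klow c y) a + inv (Klow c y) b) = a + b" "Klow c y (r *\<^sub>R inv (Klow c y) a) = r *\<^sub>R a" for a b r
      by (simp_all add: linear_add[OF Klow_linear] linear_scale[OF Klow_linear] Klow_inv(1)[OF that])
    then show "inv (Klow c y) (a + b) = inv (Klow c y) a + inv (Klow c y) b" "inv (Klow c y) (r *\<^sub>R a) = r *\<^sub>R inv (Klow c y) a" for a b r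
      by (metis Klow_inv(2)[OF that])+
  qed
  have conn0: "((\<lambda>y. 1 / (8 * cubic c y)) has_derivative (\<lambda>a. - (4 * xi_at x a) * (1 / (8 * cubic c x)))) (at x)"
    by (rule has_derivative_eq_rhs[OF has_derivative_divide'[OF has_derivative_const has_derivative_mult_right[OF D_cubic[OF x]]]])
       (use h in \<open>auto simp: fun_eq_iff field_simps\<close>)
  have w: "((\<lambda>y. (1 / (8 * cubic c y)) *\<^sub>R polar_low c u v) has_derivative (\<lambda>a. (- (4 * xi_at x a)) *\<^sub>R ((1 / (8 * cubic c x)) *\<^sub>R polar_low c u v))) (at x)"
    by (rule has_derivative_eq_rhs[OF has_derivative_scaleR_left[OF conn0]]) (simp only: scaleR_scaleR)
  have "((\<lambda>x. mc c x u v) has_derivative (\<lambda>a. - inv (Klow c x) (2 *\<^sub>R Klow c x (chris_at x a (mc c x u v)))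
      + inv (Klow c x) ((- (4 * xi_at x a)) *\<^sub>R ((1 / (8 * cubic c x)) *\<^sub>R polar_low c u v)))) (at x)"
    using has_derivative_linear_family[OF open_regular x lN N w] by (simp only: mc_def)
  moreover have "inv (Klow c x) (2 *\<^sub>R Klow c x z) = 2 *\<^sub>R z" for z
    by (simp only: linear_scale[OF lN[OF x]] Klow_inv[OF x])
  moreover have "inv (Klow c x) (r *\<^sub>R ((1 / (8 * cubic c x)) *\<^sub>R polar_low c u v)) = r *\<^sub>R mc c x u v" for r
    by (simp only: linear_scale[OF lN[OF x]] mc_def)
  ultimately have "((\<lambda>x. mc c x u v) has_derivative (\<lambda>a. - (2 *\<^sub>R chris_at x a (mc c x u v)) + (- (4 * xi_at x a)) *\<^sub>R mc c x u v)) (at x)"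
    by (simp only:)
  then show ?thesis by (simp add: cubic_jet.dm_def[OF cubic_jet[OF x]] algebra_simps)
qed

lemma D_chris: assumes x: "x \<in> regular_points c" shows "((\<lambda>x. chris_at x u v) has_derivative (\<lambda>a. dchris_at x a u v)) (at x)"
proof -
  have "((\<lambda>x. (8 * xi_at x u * xi_at x v - 2 * Kc c x u v) *\<^sub>R x - (2 * xi_at x u) *\<^sub>R v - (2 * xi_at x v) *\<^sub>R u - mc c x u v) has_derivative (\<lambda>a. dchris_at x a u v)) (at x)"
    by (rule has_derivative_eq_rhs, (rule has_derivative_diff has_derivative_scaleR has_derivative_mult has_derivative_const has_derivative_ident D_xi[OF x] D_K[OF x] D_m[OF x])+)
       (simp add: fun_eq_iff cubic_jet.dchris_def[OF cubic_jet[OF x]] algebra_simps)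
  then show ?thesis
    by (rule has_derivative_transform_within_open[OF _ open_regular x]) (simp add: cubic_jet.chris_def[OF cubic_jet])
qed

text \<open>The definitions of the locale \<open>cubic_jet\<close> are available at regular points only, and these form an open set.\<close>
lemma has_derivative_on_regular:
  assumes "x \<in> regular_points c" "\<And>y. y \<in> regular_points c \<Longrightarrow> f y = F y" "(F has_derivative D) (at x)"
  shows "(f has_derivative D) (at x)"
  by (rule has_derivative_transform_within_open[OF assms(3) open_regular assms(1)]) (simp add: assms(2))

lemma D_conn0: assumes x: "x \<in> regular_points c"
  shows "((\<lambda>x. cubic_jet.conn0 (Kc c x) (mc c x) x u z) has_derivative (\<lambda>a. cubic_jet.dconn0 (Kc c x) (mc c x) x a u z)) (at x)"
  apply (rule has_derivative_on_regular[OF x])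
   apply (simp only: cubic_jet.conn0_def[OF cubic_jet])
  apply (rule has_derivative_eq_rhs)
   apply (rule has_derivative_Pair has_derivative_diff has_derivative_add has_derivative_scaleR has_derivative_mult
      has_derivative_const D_xi[OF x] D_K[OF x] D_m[OF x] D_chris[OF x])+
  apply (simp add: fun_eq_iff cubic_jet.dconn0_def[OF cubic_jet[OF x]])
  done

lemma D_conn1: assumes x: "x \<in> regular_points c"
  shows "((\<lambda>x. cubic_jet.conn1 (Kc c x) (mc c x) x u z) has_derivative (\<lambda>a. cubic_jet.dconn1 (Kc c x) (mc c x) x a u z)) (at x)"
  apply (rule has_derivative_on_regular[OF x])
   apply (simp only: cubic_jet.conn1_def[OF cubic_jet])
  apply (rule has_derivative_eq_rhs)
   apply (rule has_derivative_Pair has_derivative_diff has_derivative_add has_derivative_scaleR has_derivative_mult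
      has_derivative_const D_xi[OF x] D_K[OF x] D_m[OF x] D_chris[OF x])+
  apply (simp add: fun_eq_iff cubic_jet.dconn1_def[OF cubic_jet[OF x]])
  done

lemma D_conn2: assumes x: "x \<in> regular_points c"
  shows "((\<lambda>x. cubic_jet.conn2 (Kc c x) (mc c x) u z) has_derivative (\<lambda>a. cubic_jet.dconn2 (Kc c x) (mc c x) x a u z)) (at x)"
  apply (rule has_derivative_on_regular[OF x])
   apply (simp only: cubic_jet.conn2_def[OF cubic_jet])
  apply (rule has_derivative_eq_rhs)
   apply (rule has_derivative_Pair has_derivative_diff has_derivative_add has_derivative_scaleR has_derivative_mult
      has_derivative_const D_xi[OF x] D_K[OF x] D_m[OF x] D_chris[OF x])+
  apply (simp add: fun_eq_iff cubic_jet.dconn2_def[OF cubic_jet[OF x]])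
  done

lemma D_conn3: assumes x: "x \<in> regular_points c"
  shows "((\<lambda>x. cubic_jet.conn3 (Kc c x) (mc c x) u z) has_derivative (\<lambda>a. cubic_jet.dconn3 (Kc c x) (mc c x) x a u z)) (at x)"
  apply (rule has_derivative_on_regular[OF x])
   apply (simp only: cubic_jet.conn3_def[OF cubic_jet])
  apply (rule has_derivative_eq_rhs)
   apply (rule has_derivative_Pair has_derivative_diff has_derivative_add has_derivative_scaleR has_derivative_mult
      has_derivative_const D_xi[OF x] D_K[OF x] D_m[OF x] D_chris[OF x])+
  apply (simp add: fun_eq_iff cubic_jet.dconn3_def[OF cubic_jet[OF x]])
  done

lemmas D_conn_parts = D_conn0 D_conn1 D_conn2 D_conn3

lemma D_conn: assumes x: "x \<in> regular_points c" shows "((\<lambda>x. conn_at x u z) has_derivative (\<lambda>a. dconn_at x a u z)) (at x)"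
  apply (rule has_derivative_on_regular[OF x])
   apply (simp only: cubic_jet.conn_def[OF cubic_jet] map_quad_def left_i_def left_j_def left_k_def fst_conv snd_conv)
  apply (rule has_derivative_eq_rhs)
   apply (rule has_derivative_Pair has_derivative_minus has_derivative_diff has_derivative_add has_derivative_scaleR has_derivative_const D_xi[OF x] D_conn_parts[OF x])+
  apply (simp add: fun_eq_iff cubic_jet.dconn_def[OF cubic_jet[OF x]] map_quad_def left_i_def left_j_def left_k_def)
  done

lemma D_connM: assumes x: "x \<in> regular_points c" shows "((\<lambda>x. cubic_jet.connM (Kc c x) (mc c x) x u z) has_derivative (\<lambda>a. cubic_jet.dconnM (Kc c x) (mc c x) x a u z)) (at x)"
  apply (rule has_derivative_on_regular[OF x])
   apply (simp only: cubic_jet.connM_def[OF cubic_jet])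
  apply (rule has_derivative_eq_rhs)
   apply (rule has_derivative_Pair has_derivative_minus has_derivative_diff has_derivative_add D_chris[OF x])+
  apply (simp add: fun_eq_iff cubic_jet.dconnM_def[OF cubic_jet[OF x]])
  done

end

section \<open>Nondegeneracy on the cone\<close>

text \<open>The intermediate value theorem on the segments in the direction \<open>w\<close>, on which \<open>f\<close> changes sign, yields
  zeros at distance \<open>o(t)\<close> from the tangent line.\<close>
lemma zero_set_near_tangent:
  fixes f :: "'a::euclidean_space \<Rightarrow> real"
  assumes V: "open V" "p \<in> V" and cont: "continuous_on V f" and f: "(f has_derivative A) (at p)" and fp: "f p = 0"
    and w: "A w = 1" and v: "A v = 0" and \<epsilon>: "\<epsilon> > 0" "\<epsilon> \<le> 1"
  shows "\<exists>\<eta>>0. \<forall>t. \<bar>t\<bar> < \<eta> \<longrightarrow> (\<exists>s. \<bar>s\<bar> \<le> \<epsilon> * \<bar>t\<bar> \<and> p + t *\<^sub>R v + s *\<^sub>R w \<in> V \<and> f (p + t *\<^sub>R v + s *\<^sub>R w) = 0)"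
proof -
  have bl: "bounded_linear A" using f by (rule has_derivative_bounded_linear)
  define M where "M = norm v + norm w + 1"
  have M: "M > 0" by (simp add: M_def add_nonneg_pos)
  obtain r where r: "r > 0" "ball p r \<subseteq> V" using V openE by blast
  obtain d where d: "d > 0" "\<And>y. norm (y - p) < d \<Longrightarrow> norm (f y - f p - A (y - p)) \<le> \<epsilon> / (2 * M) * norm (y - p)"
    using f \<epsilon>(1) M unfolding has_derivative_at_alt by (metis divide_pos_pos mult_pos_pos zero_less_numeral)
  define \<eta> where "\<eta> = min d r / M"
  have \<eta>: "\<eta> > 0" using d r M by (simp add: \<eta>_def)
  have "\<exists>s. \<bar>s\<bar> \<le> \<epsilon> * \<bar>t\<bar> \<and> p + t *\<^sub>R v + s *\<^sub>R w \<in> V \<and> f (p + t *\<^sub>R v + s *\<^sub>R w) = 0" if t: "\<bar>t\<bar> < \<eta>" for t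
  proof -
    let ?y = "\<lambda>s. p + t *\<^sub>R v + s *\<^sub>R w"
    have bnd: "norm (?y s - p) \<le> \<bar>t\<bar> * M" if s: "\<bar>s\<bar> \<le> \<epsilon> * \<bar>t\<bar>" for s
    proof -
      have "\<bar>s\<bar> \<le> \<bar>t\<bar>" using s \<epsilon> mult_right_mono[of \<epsilon> 1 "\<bar>t\<bar>"] by simp
      have "norm (?y s - p) \<le> \<bar>t\<bar> * norm v + \<bar>s\<bar> * norm w"
        using norm_triangle_ineq[of "t *\<^sub>R v" "s *\<^sub>R w"] by (simp add: add.assoc)
      also have "\<dots> \<le> \<bar>t\<bar> * norm v + \<bar>t\<bar> * norm w"
        using \<open>\<bar>s\<bar> \<le> \<bar>t\<bar>\<close> by (simp add: mult_right_mono)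
      also have "\<dots> \<le> \<bar>t\<bar> * M" by (simp add: M_def distrib_left)
      finally show ?thesis .
    qed
    have small: "\<bar>t\<bar> * M < min d r" using t M by (simp add: \<eta>_def field_simps)
    have inV: "?y s \<in> V" if "\<bar>s\<bar> \<le> \<epsilon> * \<bar>t\<bar>" for s
      using bnd[OF that] small r(2) by (auto simp: dist_norm norm_minus_commute subset_iff)
    have est: "\<bar>f (?y s) - s\<bar> \<le> \<epsilon> * \<bar>t\<bar> / 2" if s: "\<bar>s\<bar> \<le> \<epsilon> * \<bar>t\<bar>" for s
    proof -
      have Ay: "A (?y s - p) = s"
        using linear_add[OF bounded_linear.linear[OF bl]] linear_scale[OF bounded_linear.linear[OF bl]] w v by (simp add: add.assoc)
      have "\<bar>f (?y s) - s\<bar> \<le> \<epsilon> / (2 * M) * norm (?y s - p)"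
        using d(2)[of "?y s"] bnd[OF s] small Ay fp by simp
      also have "\<dots> \<le> \<epsilon> / (2 * M) * (\<bar>t\<bar> * M)" using bnd[OF s] \<epsilon> M by (intro mult_left_mono) auto
      finally show ?thesis using M by simp
    qed
    have "\<exists>s\<ge>- (\<epsilon> * \<bar>t\<bar>). s \<le> \<epsilon> * \<bar>t\<bar> \<and> f (?y s) = 0"
    proof (rule IVT')
      have "0 \<le> \<epsilon> * \<bar>t\<bar>" using \<epsilon> by simp
      then show "f (?y (- (\<epsilon> * \<bar>t\<bar>))) \<le> 0" "0 \<le> f (?y (\<epsilon> * \<bar>t\<bar>))"
        using est[of "- (\<epsilon> * \<bar>t\<bar>)"] est[of "\<epsilon> * \<bar>t\<bar>"] by linarith+
      show "- (\<epsilon> * \<bar>t\<bar>) \<le> \<epsilon> * \<bar>t\<bar>" using \<epsilon> by simp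
      show "continuous_on {- (\<epsilon> * \<bar>t\<bar>)..\<epsilon> * \<bar>t\<bar>} (\<lambda>s. f (?y s))"
        by (rule continuous_on_compose2[OF cont]) (auto intro!: continuous_intros inV)
    qed
    then obtain s where "\<bar>s\<bar> \<le> \<epsilon> * \<bar>t\<bar>" "f (?y s) = 0" by (auto simp: abs_le_iff minus_le_iff)
    then show ?thesis using inV by blast
  qed
  then show ?thesis using \<eta> by blast
qed

text \<open>Choosing such a zero of almost minimal distance for each \<open>t\<close> gives a curve in \<open>H\<close> with velocity \<open>v\<close>. It may fail to be
  continuous away from \<open>0\<close>, but the tangent space asks for differentiability at \<open>0\<close> only.\<close>
lemma kernel_subset_tangent_space:
  fixes f :: "'a::euclidean_space \<Rightarrow> real"
  assumes V: "open V" "p \<in> V" and cont: "continuous_on V f" and f: "(f has_derivative A) (at p)"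
    and H: "H \<inter> V = {x\<in>V. f x = 0}" and p: "p \<in> H" and w: "A w = 1" and v: "A v = 0"
  shows "v \<in> tangent_space H p"
proof -
  have fp: "f p = 0" using H V p by blast
  define Z where "Z t = {s. p + t *\<^sub>R v + s *\<^sub>R w \<in> V \<and> f (p + t *\<^sub>R v + s *\<^sub>R w) = 0}" for t :: real
  define m where "m t = Inf (abs ` Z t)" for t
  have bdd: "bdd_below (abs ` Z t)" for t by (rule bdd_belowI[of _ 0]) auto
  \<comment> \<open>The infimum need not be attained; the slack \<open>t\<^sup>2\<close> is of smaller order than \<open>t\<close>.\<close>
  define s where "s t = (SOME s. s \<in> Z t \<and> \<bar>s\<bar> \<le> m t + t\<^sup>2)" for t
  have near: "\<exists>\<eta>>0. \<forall>t. \<bar>t\<bar> < \<eta> \<longrightarrow> (\<exists>s\<in>Z t. \<bar>s\<bar> \<le> \<epsilon> * \<bar>t\<bar>)" if "\<epsilon> > 0" "\<epsilon> \<le> 1" for \<epsilon>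
    using zero_set_near_tangent[OF V cont f fp w v that] unfolding Z_def by blast
  have s: "s t \<in> Z t \<and> \<bar>s t\<bar> \<le> m t + t\<^sup>2" if ne: "Z t \<noteq> {}" and "t \<noteq> 0" for t
  proof -
    have "\<exists>y\<in>abs ` Z t. y < m t + t\<^sup>2"
      using cInf_lessD[of "abs ` Z t" "m t + t\<^sup>2"] ne that(2) by (simp add: m_def)
    then obtain s1 where "s1 \<in> Z t \<and> \<bar>s1\<bar> \<le> m t + t\<^sup>2" by (auto dest: less_imp_le)
    then show ?thesis unfolding s_def by (rule someI[of "\<lambda>s. s \<in> Z t \<and> \<bar>s\<bar> \<le> m t + t\<^sup>2"])
  qed
  have s0: "s 0 = 0"
  proof -
    have z: "0 \<in> Z 0" using V fp by (simp add: Z_def)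
    have "m 0 \<le> \<bar>0\<bar>" unfolding m_def by (rule cInf_lower) (use z bdd in \<open>auto intro: imageI\<close>)
    moreover have "m 0 \<ge> 0" unfolding m_def by (rule cInf_greatest) (use z in auto)
    ultimately have "m 0 = 0" by simp
    then have "s 0 \<in> Z 0 \<and> \<bar>s 0\<bar> \<le> m 0 + 0\<^sup>2" unfolding s_def
      using z by (intro someI[of "\<lambda>s. s \<in> Z 0 \<and> \<bar>s\<bar> \<le> m 0 + 0\<^sup>2" 0]) simp
    with \<open>m 0 = 0\<close> show ?thesis by simp
  qed
  define \<gamma> where "\<gamma> t = p + t *\<^sub>R v + s t *\<^sub>R w" for t
  have ev: "\<exists>\<eta>>0. \<forall>t. \<bar>t\<bar> < \<eta> \<longrightarrow> \<gamma> t \<in> H \<and> \<bar>s t\<bar> \<le> \<epsilon> * \<bar>t\<bar>" if \<epsilon>: "\<epsilon> > 0" "\<epsilon> \<le> 1" for \<epsilon>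
  proof -
    obtain \<eta> where \<eta>: "\<eta> > 0" "\<And>t. \<bar>t\<bar> < \<eta> \<Longrightarrow> \<exists>s\<in>Z t. \<bar>s\<bar> \<le> \<epsilon> / 2 * \<bar>t\<bar>"
      using near[of "\<epsilon> / 2"] \<epsilon> by auto
    have "\<gamma> t \<in> H \<and> \<bar>s t\<bar> \<le> \<epsilon> * \<bar>t\<bar>" if t: "\<bar>t\<bar> < min \<eta> (\<epsilon> / 2)" for t
    proof (cases "t = 0")
      case True then show ?thesis using p by (simp add: \<gamma>_def s0)
    next
      case False
      obtain s' where s': "s' \<in> Z t" "\<bar>s'\<bar> \<le> \<epsilon> / 2 * \<bar>t\<bar>" using \<eta>(2)[of t] t by auto
      have st: "s t \<in> Z t" "\<bar>s t\<bar> \<le> m t + t\<^sup>2" using s[of t] s' False by blast+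
      have "m t \<le> \<bar>s'\<bar>" unfolding m_def by (rule cInf_lower) (use s' bdd in auto)
      moreover have "t\<^sup>2 \<le> \<epsilon> / 2 * \<bar>t\<bar>"
        using t mult_right_mono[of "\<bar>t\<bar>" "\<epsilon> / 2" "\<bar>t\<bar>"] by (simp add: power2_eq_square)
      ultimately have "\<bar>s t\<bar> \<le> \<epsilon> * \<bar>t\<bar>" using st(2) s'(2) by simp
      moreover have "\<gamma> t \<in> H" using st(1) H unfolding Z_def \<gamma>_def by blast
      ultimately show ?thesis by blast
    qed
    then show ?thesis using \<eta>(1) \<epsilon>(1) by (intro exI[of _ "min \<eta> (\<epsilon> / 2)"]) auto
  qed
  have "(s has_derivative (\<lambda>t. 0)) (at 0)"
    unfolding has_derivative_at_alt
  proof (intro conjI allI impI)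
    fix e :: real assume e: "e > 0"
    obtain \<eta> where "\<eta> > 0" "\<And>t. \<bar>t\<bar> < \<eta> \<Longrightarrow> \<bar>s t\<bar> \<le> min e 1 * \<bar>t\<bar>" using ev[of "min e 1"] e by auto
    moreover have "min e 1 * \<bar>t\<bar> \<le> e * \<bar>t\<bar>" for t by (rule mult_right_mono) auto
    ultimately show "\<exists>d>0. \<forall>y. norm (y - 0) < d \<longrightarrow> norm (s y - s 0 - 0) \<le> e * norm (y - 0)"
      by (intro exI[of _ \<eta>]) (auto simp: s0 intro: order_trans)
  qed simp
  then have "(\<gamma> has_derivative (\<lambda>t. t *\<^sub>R v)) (at 0)"
    unfolding \<gamma>_def[abs_def] by (auto intro!: derivative_eq_intros)
  then have "(\<gamma> has_vector_derivative v) (at 0)" by (simp add: has_vector_derivative_def)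
  moreover have "\<forall>\<^sub>F t in nhds 0. \<gamma> t \<in> H"
    using ev[of 1] unfolding eventually_nhds_metric by (auto simp: dist_real_def)
  moreover have "\<gamma> 0 = p" by (simp add: \<gamma>_def s0)
  ultimately show ?thesis unfolding tangent_space_def by blast
qed

context fixes c :: "'n::finite \<Rightarrow> 'n \<Rightarrow> 'n \<Rightarrow> real" begin

text \<open>The kernel of \<open>dh\<close> at \<open>p\<close> is contained in the tangent space of \<open>H\<close>. The defining function \<open>f\<close> of \<open>H\<close> is not \<open>h - 1\<close> in general, but
  the two differentials are proportional, because \<open>h\<close> is constant on \<open>H\<close>, and \<open>dh\<close> does not vanish by Euler's relation.\<close>
lemma hessian_negative_on_kernel:
  assumes psr: "projective_special_real c H" and p: "p \<in> H" and v: "polar c p p v = 0" "v \<noteq> 0"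
  shows "polar c p v v < 0"
proof -
  have H1: "\<And>x. x \<in> H \<Longrightarrow> cubic c x = 1" and hyp: "hypersurface H"
    and pos: "\<And>v. v \<in> tangent_space H p \<Longrightarrow> v \<noteq> 0 \<Longrightarrow> - dderiv v (dderiv v (cubic c)) p > 0"
    using psr p unfolding projective_special_real_def by auto
  obtain V f where V: "open V" "p \<in> V" and sm: "smooth_on V f" and sub: "\<And>x. x \<in> V \<Longrightarrow> \<exists>v. dderiv v f x \<noteq> 0"
    and HV: "H \<inter> V = {x\<in>V. f x = 0}"
    using hyp p unfolding hypersurface_def by meson
  have diff: "f differentiable (at x)" if "x \<in> V" for x using sm that by (cases rule: smooth_on.cases) auto
  define A where "A = frechet_derivative f (at p)"
  have A: "(f has_derivative A) (at p)" using diff[OF V(2)] unfolding A_def by (simp add: frechet_derivative_works)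
  have linA: "linear A" using A has_derivative_linear by blast
  obtain w0 where w0: "A w0 \<noteq> 0" using sub[OF V(2)] by (auto simp: dderiv_def A_def)
  \<comment> \<open>A direction transversal to \<open>H\<close>.\<close>
  define w where "w = (1 / A w0) *\<^sub>R w0"
  have w: "A w = 1" using w0 by (simp add: w_def linear_scale[OF linA])
  have cont: "continuous_on V f"
    using diff by (simp add: continuous_at_imp_continuous_on differentiable_imp_continuous_within)
  have ker: "polar c p p u = 0" if "u \<in> tangent_space H p" for u
  proof -
    obtain \<gamma> where g: "\<gamma> 0 = p" "\<forall>\<^sub>F t in nhds (0::real). \<gamma> t \<in> H" "(\<gamma> has_vector_derivative u) (at 0)"
      using \<open>u \<in> tangent_space H p\<close> unfolding tangent_space_def by blast
    have "((\<lambda>t. cubic c (\<gamma> t)) has_derivative (\<lambda>t. polar c (\<gamma> 0) (\<gamma> 0) (t *\<^sub>R u) / 2)) (at 0)"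
      using g(3) unfolding has_vector_derivative_def by (rule has_derivative_cubic)
    moreover have "((\<lambda>t. cubic c (\<gamma> t)) has_derivative (\<lambda>t. 0)) (at 0)"
    proof -
      obtain S where S: "open S" "0 \<in> S" "\<And>t. t \<in> S \<Longrightarrow> \<gamma> t \<in> H"
        using g(2) unfolding eventually_nhds by blast
      show ?thesis
        by (rule has_derivative_transform_within_open[OF has_derivative_const[of 1] S(1,2)]) (simp add: H1 S(3))
    qed
    ultimately have "(\<lambda>t. polar c (\<gamma> 0) (\<gamma> 0) (t *\<^sub>R u) / 2) = (\<lambda>t. 0)" by (rule has_derivative_unique)
    from fun_cong[OF this, of 1] show ?thesis by (simp add: g(1))
  qed
  have tan: "u \<in> tangent_space H p" if "A u = 0" for u
    by (rule kernel_subset_tangent_space[OF V cont A HV p w that])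
  have proj: "polar c p p u = A u * polar c p p w" for u
  proof -
    have "A (u - A u *\<^sub>R w) = 0" by (simp add: linear_diff[OF linA] linear_scale[OF linA] w)
    from ker[OF tan[OF this]] show ?thesis by (simp add: polar_lin polar_scaleR)
  qed
  have "polar c p p p = 6" using H1[OF p] by (simp add: cubic_polar)
  then have "polar c p p w \<noteq> 0" using proj[of p] by auto
  then have "A v = 0" using proj[of v] v by simp
  then have "- dderiv v (dderiv v (cubic c)) p > 0" using pos tan v by blast
  moreover have "dderiv v (cubic c) = (\<lambda>x. polar c x x v / 2)"
    by (rule ext, rule dderiv_eq[OF has_derivative_cubic[OF has_derivative_ident]])
  moreover have "((\<lambda>x. polar c x x v / 2) has_derivative (\<lambda>u. polar c p u v)) (at p)"
    by (rule has_derivative_eq_rhs[OF bounded_linear.has_derivative[OF bounded_linear_divide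
          has_derivative_polar[OF has_derivative_ident has_derivative_ident has_derivative_const]]])
       (simp add: polar_0 fun_eq_iff polar_commute12[of c _ p])
  ultimately show ?thesis using dderiv_eq by fastforce
qed

text \<open>On the splitting into the line through \<open>p\<close> and the kernel of \<open>dh\<close>, the form \<open>Kc p\<close> is diagonal with positive blocks.
  It is homogeneous of degree \<open>-2\<close>, hence positive on the cone as well.\<close>
lemma cone_subset_regular:
  assumes psr: "projective_special_real c H" and x: "x \<in> cone H"
  shows "x \<in> regular_points c"
proof -
  obtain r p where r: "r > 0" "p \<in> H" "x = r *\<^sub>R p" using x unfolding cone_def by blast
  have hp: "cubic c p = 1" using psr r unfolding projective_special_real_def by auto
  then have pp: "polar c p p p = 6" by (simp add: cubic_polar)
  have Kp: "Kc c p u u > 0" if u: "u \<noteq> 0" for u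
  proof -
    define a where "a = polar c p p u / 6"
    define v where "v = u - a *\<^sub>R p"
    have v0: "polar c p p v = 0" by (simp add: v_def polar_lin polar_scaleR pp a_def)
    have "polar c p u u = 6 * a\<^sup>2 + polar c p v v"
    proof -
      have "u = a *\<^sub>R p + v" by (simp add: v_def)
      then have "polar c p u u = polar c p (a *\<^sub>R p + v) (a *\<^sub>R p + v)" by simp
      also have "\<dots> = 6 * a\<^sup>2 + 2 * a * polar c p p v + polar c p v v"
        by (simp add: polar_lin polar_scaleR pp polar_commute23[of c p v p] power2_eq_square algebra_simps)
      finally show ?thesis by (simp add: v0)
    qed
    then have K: "Kc c p u u = (3 * a\<^sup>2 - polar c p v v) / 4"
      by (simp add: Kc_def hp a_def power2_eq_square field_simps)
    show ?thesis
    proof (cases "v = 0")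
      case True
      then have "a \<noteq> 0" using u by (auto simp: v_def)
      then have "a\<^sup>2 > 0" by simp
      moreover have "Kc c p u u = 3 / 4 * a\<^sup>2" using K True by (simp add: polar_0)
      ultimately show ?thesis by linarith
    next
      case False
      then have "polar c p v v < 0" by (rule hessian_negative_on_kernel[OF psr r(2) v0])
      then have "3 * a\<^sup>2 - polar c p v v > 0" using zero_le_power2[of a] by linarith
      then show ?thesis using K by simp
    qed
  qed
  have hx: "cubic c x = r ^ 3" by (simp add: r(3) cubic_polar polar_scaleR pp power3_eq_cube)
  have "Kc c x u u = Kc c p u u / r\<^sup>2" for u
    unfolding Kc_def hx using r(1) by (simp add: r(3) polar_scaleR hp field_simps power2_eq_square power3_eq_cube)
  then have "Kc c x u u > 0" if "u \<noteq> 0" for u using Kp[OF that] r(1) by simp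
  then have "u = 0" if "Klow c x u = 0" for u using that by (metis Klow_inner inner_zero_left less_irrefl)
  then have "inj (Klow c x)" by (simp add: linear_injective_0 Klow_linear)
  then have "det (matrix (Klow c x)) \<noteq> 0" by (simp add: det_nz_iff_inj Klow_linear)
  then show ?thesis using r(1) by (simp add: regular_points_def hx)
qed

end

section \<open>The metric of the r-map\<close>

lemma matrix_inv_eqI:
  fixes A B :: "real ^ 'n ^ 'n"
  assumes "A ** B = mat 1" shows "matrix_inv A = B"
proof -
  have BA: "B ** A = mat 1" using assms matrix_left_right_inverse by blast
  have "\<exists>C. A ** C = mat 1 \<and> C ** A = mat 1" using assms BA by blast
  then have "A ** matrix_inv A = mat 1 \<and> matrix_inv A ** A = mat 1" unfolding matrix_inv_def by (rule someI_ex)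
  then have "B ** (A ** matrix_inv A) = B ** mat 1" by (simp only:)
  then show ?thesis by (simp only: matrix_mul_assoc BA matrix_mul_lid matrix_mul_rid)
qed

lemma bounded_linear_Im_vec: "bounded_linear Im_vec"
  by (rule linear_conv_bounded_linear[THEN iffD1], rule linearI) (simp_all add: Im_vec_def vec_eq_iff)

definition Re_vec :: "complex ^ 'n \<Rightarrow> real ^ 'n" where "Re_vec X = (\<chi> \<mu>. Re (X $ \<mu>))"

definition cvec :: "real ^ 'n \<Rightarrow> real ^ 'n \<Rightarrow> complex ^ 'n" where "cvec x y = (\<chi> \<mu>. Complex (y $ \<mu>) (x $ \<mu>))"

lemma cvec_simps: "Im_vec (cvec x y) = x" "Re_vec (cvec x y) = y" "cvec (Im_vec X) (Re_vec X) = X"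
  by (simp_all add: Im_vec_def Re_vec_def cvec_def vec_eq_iff)

context fixes c :: "'n::finite \<Rightarrow> 'n \<Rightarrow> 'n \<Rightarrow> real" begin

abbreviation "r_domain \<equiv> {X. Im_vec X \<in> regular_points c}"

lemma open_r_domain: "open r_domain"
  using open_vimage[OF open_regular[of c] linear_continuous_on[OF bounded_linear_Im_vec]] unfolding vimage_def .

lemma Kc_sum: "(\<Sum>\<mu>\<in>UNIV. \<Sum>\<nu>\<in>UNIV. Kc c x (axis \<mu> 1) (axis \<nu> 1) * (u $ \<mu> * v $ \<nu>)) = Kc c x u v"
proof -
  have b: "u = (\<Sum>\<mu>\<in>UNIV. u $ \<mu> *\<^sub>R axis \<mu> 1)" for u :: "real ^ 'n"
    by (simp add: basis_expansion flip: scalar_mult_eq_scaleR)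
  have l: "linear (Kc c x w)" "linear (\<lambda>w. Kc c x w u)" for w u using Kc_bilinear[of c x] by (simp_all add: bilinear_def)
  have "Kc c x u v = (\<Sum>\<mu>\<in>UNIV. u $ \<mu> * Kc c x (axis \<mu> 1) v)"
    by (subst b[of u]) (simp add: linear_sum[OF l(2)] linear_scale[OF l(2)])
  also have "\<dots> = (\<Sum>\<mu>\<in>UNIV. \<Sum>\<nu>\<in>UNIV. u $ \<mu> * (v $ \<nu> * Kc c x (axis \<mu> 1) (axis \<nu> 1)))"
    by (subst b[of v]) (simp add: linear_sum[OF l(1)] linear_scale[OF l(1)] sum_distrib_left)
  finally show ?thesis by (simp add: mult_ac)
qed

text \<open>The potential depends on the imaginary parts only, and on such functions \<open>\<partial>\<^sup>2/\<partial>X\<^sup>\<mu>\<partial>X\<^sup>\<nu>\<close> is a quarter of the real Hessian.\<close>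
lemma kaehler_matrix_eq:
  assumes X: "X \<in> r_domain" shows "kaehler_matrix c X $ \<mu> $ \<nu> = Kc c (Im_vec X) (axis \<mu> 1) (axis \<nu> 1)"
proof -
  have Dkp: "((\<lambda>Y. complex_of_real (kaehler_potential c Y)) has_derivative (\<lambda>v. complex_of_real (- 4 * cubic_jet.xi (Kc c (Im_vec Y)) (Im_vec Y) (Im_vec v)))) (at Y)"
    if Y: "Y \<in> r_domain" for Y
  proof -
    have h: "cubic c (Im_vec Y) > 0" using Y by (simp add: regular_points_def)
    have "((\<lambda>x. - ln (8 * cubic c x)) has_derivative (\<lambda>a. - 4 * cubic_jet.xi (Kc c (Im_vec Y)) (Im_vec Y) a)) (at (Im_vec Y))"
      by (rule has_derivative_eq_rhs[OF has_derivative_minus[OF has_derivative_ln[OF _ has_derivative_mult_right[OF D_cubic]]]])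
         (use Y h in \<open>auto simp: fun_eq_iff\<close>)
    from has_derivative_compose[OF bounded_linear_imp_has_derivative[OF bounded_linear_Im_vec] this]
    show ?thesis unfolding kaehler_potential_def by (rule has_derivative_of_real)
  qed
  have ax: "Im_vec (axis \<mu> 1) = 0" "Im_vec (axis \<mu> \<i>) = axis \<mu> 1" for \<mu> :: 'n
    by (simp_all add: Im_vec_def axis_def vec_eq_iff)
  have xi0: "cubic_jet.xi (Kc c (Im_vec Y)) (Im_vec Y) 0 = 0" if "Y \<in> r_domain" for Y
    using that cubic_jet.xi_lin(5)[OF cubic_jet] by simp
  have wb: "wirtinger_bar \<nu> (\<lambda>Y. complex_of_real (kaehler_potential c Y)) Y = complex_of_real (cubic_jet.xi (Kc c (Im_vec Y)) (Im_vec Y) (axis \<nu> 1)) * (- 2 * \<i>)"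
    if "Y \<in> r_domain" for Y
    by (simp add: wirtinger_bar_def dderiv_eq[OF Dkp[OF that]] ax xi0[OF that])
  have "((\<lambda>Y. complex_of_real (cubic_jet.xi (Kc c (Im_vec Y)) (Im_vec Y) (axis \<nu> 1)) * (- 2 * \<i>)) has_derivative
     (\<lambda>v. complex_of_real (- Kc c (Im_vec X) (Im_vec v) (axis \<nu> 1)) * (- 2 * \<i>))) (at X)"
    using X by (intro has_derivative_mult_left has_derivative_of_real
        has_derivative_compose[OF bounded_linear_imp_has_derivative[OF bounded_linear_Im_vec] D_xi]) simp
  then have "((\<lambda>Y. wirtinger_bar \<nu> (\<lambda>Y. complex_of_real (kaehler_potential c Y)) Y) has_derivative
     (\<lambda>v. complex_of_real (- Kc c (Im_vec X) (Im_vec v) (axis \<nu> 1)) * (- 2 * \<i>))) (at X)"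
    by (rule has_derivative_transform_within_open[OF _ open_r_domain X]) (simp add: wb)
  from dderiv_eq[OF this] show ?thesis
    by (simp add: kaehler_matrix_def wirtinger_def ax bilinear_lzero[OF Kc_bilinear])
qed

lemma r_metric_eq:
  assumes X: "X \<in> r_domain"
  shows "r_metric c X v w = Kc c (Im_vec X) (Im_vec v) (Im_vec w) + Kc c (Im_vec X) (Re_vec v) (Re_vec w)"
proof -
  have "r_metric c X v w = (\<Sum>\<mu>\<in>UNIV. \<Sum>\<nu>\<in>UNIV. Kc c (Im_vec X) (axis \<mu> 1) (axis \<nu> 1) * (Im_vec v $ \<mu> * Im_vec w $ \<nu>)) / 2
     + (\<Sum>\<mu>\<in>UNIV. \<Sum>\<nu>\<in>UNIV. Kc c (Im_vec X) (axis \<mu> 1) (axis \<nu> 1) * (Im_vec w $ \<mu> * Im_vec v $ \<nu>)) / 2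
     + (\<Sum>\<mu>\<in>UNIV. \<Sum>\<nu>\<in>UNIV. Kc c (Im_vec X) (axis \<mu> 1) (axis \<nu> 1) * (Re_vec v $ \<mu> * Re_vec w $ \<nu>)) / 2
     + (\<Sum>\<mu>\<in>UNIV. \<Sum>\<nu>\<in>UNIV. Kc c (Im_vec X) (axis \<mu> 1) (axis \<nu> 1) * (Re_vec w $ \<mu> * Re_vec v $ \<nu>)) / 2"
    unfolding r_metric_def Re_sum sum_divide_distrib sum.distrib[symmetric]
    by (intro sum.cong refl)
       (simp add: kaehler_matrix_eq[OF X] form_prod_def Im_vec_def Re_vec_def field_simps)
  then show ?thesis unfolding Kc_sum by (simp add: Kc_commute[of c _ "Im_vec w"] Kc_commute[of c _ "Re_vec w"])
qed

lemma chris_commute: "x \<in> regular_points c \<Longrightarrow> chris_at c x u v = chris_at c x v u"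
proof -
  assume x: "x \<in> regular_points c"
  interpret J: cubic_jet "Kc c x" "mc c x" x by (rule cubic_jet[OF x])
  show ?thesis by (simp add: J.chris_def J.K_commute[of u v] J.m_commute[of u v] algebra_simps)
qed

lemma K_chris_sym: "x \<in> regular_points c \<Longrightarrow> Kc c x (chris_at c x a u) v = Kc c x u (chris_at c x a v)"
proof -
  assume x: "x \<in> regular_points c"
  interpret J: cubic_jet "Kc c x" "mc c x" x by (rule cubic_jet[OF x])
  show ?thesis by (simp add: J.jet_simps)
qed

text \<open>The columns of \<open>e\<^sup>-\<^sup>1\<close> are orthonormal, because \<open>e\<^sup>Te\<close> is the matrix of \<open>K\<close>.\<close>
lemma frame_basis:
  fixes e :: "real ^ 'n ^ 'n"
  assumes X: "X \<in> r_domain" and e: "\<And>\<mu> \<nu>. (\<Sum>a\<in>UNIV. e $ a $ \<mu> * e $ a $ \<nu>) = kaehler_matrix c X $ \<mu> $ \<nu>"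
  defines "f \<equiv> \<lambda>a. (\<chi> \<mu>. matrix_inv e $ \<mu> $ a) :: real ^ 'n"
  shows "cubic_jet_basis (Kc c (Im_vec X)) (mc c (Im_vec X)) (Im_vec X) f"
    and "matrix_inv (kaehler_matrix c X) $ \<mu> $ \<nu> = (\<Sum>a\<in>UNIV. f a $ \<mu> * f a $ \<nu>)"
proof -
  let ?K = "kaehler_matrix c X"
  have x: "Im_vec X \<in> regular_points c" using X by simp
  have K: "transpose e ** e = ?K"
    by (simp only: vec_eq_iff matrix_matrix_mult_def transpose_def vec_lambda_beta e simp_thms)
  have Kuv: "Kc c (Im_vec X) u v = (e *v u) \<bullet> (e *v v)" for u v
  proof -
    have "u \<bullet> (?K *v v) = (\<Sum>\<mu>\<in>UNIV. \<Sum>\<nu>\<in>UNIV. Kc c (Im_vec X) (axis \<mu> 1) (axis \<nu> 1) * (u $ \<mu> * v $ \<nu>))"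
      by (simp add: inner_vec_def matrix_vector_mult_def kaehler_matrix_eq[OF X] sum_distrib_left mult_ac)
    then have "Kc c (Im_vec X) u v = u \<bullet> (?K *v v)" by (simp only: Kc_sum)
    moreover have "u \<bullet> (transpose e *v w) = (e *v u) \<bullet> w" for w
      by (metis dot_lmul_matrix vector_transpose_matrix)
    ultimately show ?thesis by (simp only: K[symmetric] matrix_vector_mul_assoc[symmetric])
  qed
  have "inj ((*v) e)"
  proof -
    have "u = 0" if "e *v u = 0" for u using Kc_nondeg[OF x, of u] that by (simp add: Kuv)
    then show ?thesis by (simp add: linear_injective_0)
  qed
  then obtain B where B: "B ** e = mat 1" using matrix_left_invertible_injective by blast
  then have eB: "e ** B = mat 1" by (rule matrix_left_right_inverse[THEN iffD1])
  then have Bi: "matrix_inv e = B" by (rule matrix_inv_eqI)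
  have f: "f a = B *v axis a 1" for a by (simp add: f_def Bi matrix_vector_mult_basis column_def)
  have ef: "e *v f a = axis a 1" for a by (simp add: f matrix_vector_mul_assoc eB)
  have orth: "Kc c (Im_vec X) (f a) (f b) = (if a = b then 1 else 0)" for a b
    by (simp add: Kuv ef inner_axis_axis)
  have compl: "(\<Sum>a\<in>UNIV. Kc c (Im_vec X) v (f a) *\<^sub>R f a) = v" for v
  proof -
    have "(\<Sum>a\<in>UNIV. Kc c (Im_vec X) v (f a) *\<^sub>R f a) = B *v (\<Sum>a\<in>UNIV. ((e *v v) $ a) *\<^sub>R axis a 1)"
      by (simp add: Kuv ef[unfolded f] inner_axis f matrix_vector_mult_scaleR linear_sum[OF matrix_vector_mul_linear])
    also have "(\<Sum>a\<in>UNIV. ((e *v v) $ a) *\<^sub>R axis a 1) = e *v v" by (simp add: basis_expansion flip: scalar_mult_eq_scaleR)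
    finally show ?thesis by (simp add: matrix_vector_mul_assoc B)
  qed
  interpret cubic_jet "Kc c (Im_vec X)" "mc c (Im_vec X)" "Im_vec X" by (rule cubic_jet[OF x])
  show "cubic_jet_basis (Kc c (Im_vec X)) (mc c (Im_vec X)) (Im_vec X) f"
    by unfold_locales (simp_all add: orth compl)
  have "?K ** (B ** transpose B) = transpose e ** (e ** B) ** transpose B"
    by (simp add: K[symmetric] matrix_mul_assoc)
  also have "\<dots> = mat 1" by (simp add: eB B flip: matrix_transpose_mul)
  finally have "matrix_inv ?K = B ** transpose B" by (rule matrix_inv_eqI)
  then show "matrix_inv (kaehler_matrix c X) $ \<mu> $ \<nu> = (\<Sum>a\<in>UNIV. f a $ \<mu> * f a $ \<nu>)"
    by (simp add: matrix_matrix_mult_def transpose_def f_def Bi)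
qed

end

text \<open>The frame is the constant one, so that the bracket vanishes, and vanishing torsion is the symmetry of \<open>connM\<close>.\<close>
theorem r_metric_norm:
  assumes X: "Im_vec X \<in> regular_points c" and basis: "cubic_jet_basis (Kc c (Im_vec X)) (mc c (Im_vec X)) (Im_vec X) f"
  shows "riemann_norm_sq (r_metric c) X =
    4 * (\<Sum>i\<in>UNIV. \<Sum>j\<in>UNIV. \<Sum>k\<in>UNIV. \<Sum>l\<in>UNIV. (cubic_jet_basis.curv_pure (Kc c (Im_vec X)) (mc c (Im_vec X)) (Im_vec X) f i j k l)\<^sup>2)
    + 4 * (\<Sum>i\<in>UNIV. \<Sum>j\<in>UNIV. \<Sum>k\<in>UNIV. \<Sum>l\<in>UNIV. (cubic_jet_basis.curv_mixed (Kc c (Im_vec X)) (mc c (Im_vec X)) f i j k l)\<^sup>2)"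
proof -
  let ?x = "\<lambda>X. Im_vec X :: real ^ 'a"
  define W where "W q = cubic_jet.connM (Kc c (?x q)) (mc c (?x q)) (?x q)" for q
  define G where "G q = cubic_jet.frame_formM (Kc c (?x q))" for q
  define DW where "DW v = cubic_jet.dconnM (Kc c (?x X)) (mc c (?x X)) (?x X) (?x v)" for v
  interpret F: metric_frame "r_metric c" "{X. Im_vec X \<in> regular_points c}" X "\<lambda>q z. cvec (fst z) (snd z)" "\<lambda>q v u. 0" "\<lambda>w v u. 0"
    "\<lambda>q v. (Im_vec v, Re_vec v)" G W DW
  proof (rule metric_frame.intro)
    show "open {X. Im_vec X \<in> regular_points c}" by (rule open_r_domain)
    show "X \<in> {X. Im_vec X \<in> regular_points c}" using X by simp
    show "linear (\<lambda>z :: (real ^ 'a) \<times> (real ^ 'a). cvec (fst z) (snd z))"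
      by (rule linearI) (simp_all add: cvec_def vec_eq_iff complex_eq_iff)
    fix q :: "complex ^ 'a" assume q: "q \<in> {X. Im_vec X \<in> regular_points c}"
    then have x: "?x q \<in> regular_points c" by simp
    interpret J: cubic_jet "Kc c (?x q)" "mc c (?x q)" "?x q" by (rule cubic_jet[OF x])
    show "(Im_vec (cvec (fst u) (snd u)), Re_vec (cvec (fst u) (snd u))) = u" for u :: "(real ^ 'a) \<times> (real ^ 'a)"
      by (simp add: cvec_simps)
    show "scalar_product (G q)"
      unfolding scalar_product_def bilinear_def G_def
    proof (intro conjI allI impI linearI)
      fix v :: "(real ^ 'a) \<times> (real ^ 'a)" assume v: "\<forall>w. J.frame_formM v w = 0"
      have "Kc c (?x q) (fst v) w = 0" "Kc c (?x q) (snd v) w = 0" for w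
        using spec[OF v, of "(w, 0)"] spec[OF v, of "(0, w)"] by (simp_all add: J.frame_formM_def J.K_lin)
      then show "v = 0" using Kc_nondeg[OF x] by (simp add: prod_eq_iff)
    qed (simp_all add: J.frame_formM_def J.K_lin J.K_commute algebra_simps)
    show "bilinear (W q)"
      unfolding bilinear_def W_def
      by (intro conjI allI linearI) (simp_all add: J.connM_def J.chris_lin algebra_simps)
    show "r_metric c q v w = G q (Im_vec v, Re_vec v) (Im_vec w, Re_vec w)" for v w
      by (simp add: r_metric_eq[OF q] G_def J.frame_formM_def)
    show "((\<lambda>q. G q z z') has_derivative (\<lambda>v. G q (W q (Im_vec v, Re_vec v) z) z' + G q z (W q (Im_vec v, Re_vec v) z'))) (at q)" for z z'
    proof -
      have Gy: "G y z z' = Kc c (?x y) (fst z) (fst z') + Kc c (?x y) (snd z) (snd z')" if "y \<in> {X. Im_vec X \<in> regular_points c}" for y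
        using that by (simp add: G_def cubic_jet.frame_formM_def[OF cubic_jet])
      have D: "((\<lambda>y. Kc c (?x y) u v) has_derivative (\<lambda>a. 2 * Kc c (?x q) (chris_at c (?x q) (?x a) u) v)) (at q)" for u v
        by (rule has_derivative_compose[OF bounded_linear_imp_has_derivative[OF bounded_linear_Im_vec] D_K[OF x]])
      have "((\<lambda>y. Kc c (?x y) (fst z) (fst z') + Kc c (?x y) (snd z) (snd z')) has_derivative
         (\<lambda>v. G q (W q (Im_vec v, Re_vec v) z) z' + G q z (W q (Im_vec v, Re_vec v) z'))) (at q)"
        by (rule has_derivative_eq_rhs[OF has_derivative_add[OF D D]])
           (simp add: fun_eq_iff G_def W_def J.frame_formM_def J.connM_def J.K_lin K_chris_sym[OF x])
      then show ?thesis by (rule has_derivative_transform_within_open[OF _ open_r_domain q]) (simp add: Gy)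
    qed
    show "0 - 0 = cvec (fst (W q u v - W q v u)) (snd (W q u v - W q v u))" for u v
      by (simp add: W_def J.connM_def chris_commute[OF x, of "fst v"] chris_commute[OF x, of "snd v"] cvec_def vec_eq_iff complex_eq_iff)
  next
    show "((\<lambda>q. W q u z) has_derivative (\<lambda>v. DW v u z)) (at X)" for u z
      unfolding W_def DW_def
      by (rule has_derivative_compose[OF bounded_linear_imp_has_derivative[OF bounded_linear_Im_vec] D_connM[OF X]])
  qed (simp_all add: cvec_simps)
  interpret B: cubic_jet_basis "Kc c (?x X)" "mc c (?x X)" "?x X" f by (rule basis)
  have curv: "F.curv = B.curvM"
    unfolding F.curv_def[abs_def] B.curvM_def[abs_def] W_def DW_def by (simp add: cvec_simps)
  show ?thesis
    using F.riemann_norm_sq_eq[where A = "UNIV \<times> {0,1}" and \<epsilon> = "\<lambda>\<alpha>. B.slotM (snd \<alpha>) (f (fst \<alpha>))"]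
    unfolding curv G_def by (simp only: B.frame_formM_complete B.frame_normM_formula)
qed

section \<open>Torsion identities\<close>

context cubic_jet begin

text \<open>In the quaternionic frame the one-forms \<open>d\<zeta>\<close> and \<open>d\<zeta>t\<close> of the fibre are mixed by \<open>x\<close>. These four
  functions express them, up to scaling, by the coordinates \<open>z\<^sub>2\<close> and \<open>z\<^sub>3\<close> of the frame: \<open>(beta0, beta)\<close> belongs to
  \<open>d\<zeta>\<close> and \<open>(gam0, gam)\<close> to \<open>d\<zeta>t + \<R> d\<zeta>\<close>, in each case with the \<open>\<real>\<close>-component first.\<close>
definition beta0 :: "(real \<times> 'v) quad \<Rightarrow> real" where "beta0 z = fst (fst (snd (snd z))) / 2 + xi (snd (fst (snd (snd z))))"
definition beta :: "(real \<times> 'v) quad \<Rightarrow> 'v" where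
  "beta z = (fst (snd (snd (snd z))) + 2 * xi (snd (snd (snd (snd z))))) *\<^sub>R x - snd (snd (snd (snd z)))"
definition gam :: "(real \<times> 'v) quad \<Rightarrow> 'v" where
  "gam z = (fst (fst (snd (snd z))) - 2 * xi (snd (fst (snd (snd z))))) *\<^sub>R x + snd (fst (snd (snd z)))"
definition gam0 :: "(real \<times> 'v) quad \<Rightarrow> real" where "gam0 z = xi (snd (snd (snd (snd z)))) - fst (snd (snd (snd z))) / 2"

text \<open>The derivative of \<open>xi\<close> along \<open>a\<close> is \<open>- K a\<close>, which gives the derivatives of the four functions.\<close>
definition dbeta0 where "dbeta0 a z = - K a (snd (fst (snd (snd z))))"
definition dbeta where "dbeta a z = (fst (snd (snd (snd z))) + 2 * xi (snd (snd (snd (snd z))))) *\<^sub>R a - (2 * K a (snd (snd (snd (snd z))))) *\<^sub>R x"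
definition dgam where "dgam a z = (fst (fst (snd (snd z))) - 2 * xi (snd (fst (snd (snd z))))) *\<^sub>R a + (2 * K a (snd (fst (snd (snd z))))) *\<^sub>R x"
definition dgam0 where "dgam0 a z = - K a (snd (snd (snd (snd z))))"

lemmas conn_expand = conn_def map_quad_def left_i_def left_j_def left_k_def right_i_def right_j_def right_k_def conn0_def conn1_def conn2_def conn3_def

text \<open>The structure equations of the frame, one for each kind of component. The factors \<open>fst (fst u) + 2 * xi _\<close> come from
  differentiating the scaling by powers of \<open>\<rho>\<close> and \<open>h\<close>, and the remaining terms from the shifts by \<open>Re X\<close>.\<close>
lemma torsion_base: "fst (fst (conn u z - conn z u)) = 0" "snd (fst (conn u z - conn z u)) = 0" "snd (fst (snd (conn u z - conn z u))) = 0"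
    apply (simp add: conn_expand jet_simps)
   apply (rule K_eqI, simp add: conn_expand jet_simps)
  apply (rule K_eqI, simp add: conn_expand jet_simps)
  done

lemma torsion_beta0:
  "dbeta0 (snd (fst u)) z - dbeta0 (snd (fst z)) u - (fst (fst u) + 2 * xi (snd (fst u))) * beta0 z + (fst (fst z) + 2 * xi (snd (fst z))) * beta0 u
   = beta0 (conn u z - conn z u)"
  by (simp add: beta0_def dbeta0_def conn_expand jet_simps)

lemma torsion_beta:
  "dbeta (snd (fst u)) z - dbeta (snd (fst z)) u - (fst (fst u) + 2 * xi (snd (fst u))) *\<^sub>R beta z + (fst (fst z) + 2 * xi (snd (fst z))) *\<^sub>R beta u
   + (2 * beta0 z) *\<^sub>R snd (fst (snd u)) - (2 * beta0 u) *\<^sub>R snd (fst (snd z)) = beta (conn u z - conn z u)"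
  by (rule K_eqI) (simp add: beta_def beta0_def dbeta_def conn_expand jet_simps)

lemma torsion_gam0:
  "dgam0 (snd (fst u)) z - dgam0 (snd (fst z)) u - (fst (fst u) - 2 * xi (snd (fst u))) * gam0 z + (fst (fst z) - 2 * xi (snd (fst z))) * gam0 u
   - 2 * K (snd (fst (snd u))) (gam z) + 2 * K (snd (fst (snd z))) (gam u) = gam0 (conn u z - conn z u)"
  by (simp add: gam0_def dgam0_def gam_def conn_expand jet_simps)

lemma torsion_gam:
  "2 *\<^sub>R chris (snd (fst u)) (gam z) - 2 *\<^sub>R chris (snd (fst z)) (gam u) + dgam (snd (fst u)) z - dgam (snd (fst z)) u
    - (fst (fst u) - 2 * xi (snd (fst u))) *\<^sub>R gam z + (fst (fst z) - 2 * xi (snd (fst z))) *\<^sub>R gam u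
   - 2 *\<^sub>R m (snd (fst (snd u))) (beta z) + 2 *\<^sub>R m (snd (fst (snd z))) (beta u) = gam (conn u z - conn z u)"
  by (rule K_eqI) (simp add: gam_def dgam_def beta_def conn_expand jet_simps)

text \<open>The structure equation of the contact form: its differential is the symplectic form \<open>d\<zeta> \<and> d\<zeta>t\<close>.\<close>
lemma torsion_eta:
  "2 * (fst (fst u) * fst (fst (snd z)) - fst (fst z) * fst (fst (snd u)))
    - 2 * (beta0 u * gam0 z + K (beta u) (gam z) - beta0 z * gam0 u - K (beta z) (gam u)) = - fst (fst (snd (conn u z - conn z u)))"
  by (simp add: beta0_def gam0_def gam_def beta_def conn_expand jet_simps)

text \<open>The change of basis from \<open>z\<^sub>2\<close>, \<open>z\<^sub>3\<close> to these four functions is orthogonal. This is why the frame metric agrees with the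
  fibre part of the q-map metric.\<close>
lemma frame_form_dual: "frame_form u z = K (snd (fst u)) (snd (fst z)) + K (snd (fst (snd u))) (snd (fst (snd z))) + fst (fst u) * fst (fst z)
   + fst (fst (snd u)) * fst (fst (snd z)) + beta0 u * beta0 z + K (beta u) (beta z) + K (gam u) (gam z) + gam0 u * gam0 z"
  by (simp add: frame_form_def ext_form_def beta0_def gam0_def gam_def beta_def jet_simps)

text \<open>All terms cancel except for the derivative of \<open>K\<close>: the endomorphism parts with a left unit
  are skew, as are the right units.\<close>
lemma conn_compatible: "frame_form (conn u y) z + frame_form y (conn u z) =
   2 * K (chris (snd (fst u)) (snd (fst y))) (snd (fst z)) + 2 * K (chris (snd (fst u)) (snd (fst (snd y)))) (snd (fst (snd z)))
   + 2 * K (chris (snd (fst u)) (snd (fst (snd (snd y))))) (snd (fst (snd (snd z)))) + 2 * K (chris (snd (fst u)) (snd (snd (snd (snd y))))) (snd (snd (snd (snd z))))"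
  by (simp add: frame_form_def ext_form_def conn_expand jet_simps)

lemma scalar_product_frame_form: "scalar_product frame_form"
  unfolding scalar_product_def bilinear_def
proof (intro conjI allI impI linearI)
  fix v assume v: "\<forall>w. frame_form v w = 0"
  have "ext_form (fst v) w = 0" "ext_form (fst (snd v)) w = 0" "ext_form (fst (snd (snd v))) w = 0" "ext_form (snd (snd (snd v))) w = 0" for w
    using spec[OF v, of "slot0 w"] spec[OF v, of "slot1 w"] spec[OF v, of "slot2 w"] spec[OF v, of "slot3 w"]
    by (simp_all add: frame_form_def slot_defs ext_form_lin)
  moreover have "y = 0" if "\<And>w. ext_form y w = 0" for y
    using that[of "(1,0)"] that[of "(0, w)" for w] K_nondegenerate by (auto simp: ext_form_def K_lin prod_eq_iff)
  ultimately show "v = 0" by (simp add: prod_eq_iff)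
qed (simp_all add: frame_form_def ext_form_def K_lin K_commute algebra_simps)

lemma bilinear_conn: "bilinear conn"
  unfolding bilinear_def
  by (intro conjI allI linearI; simp add: conn_expand prod_eq_iff; intro conjI; (rule K_eqI)?; simp add: jet_simps)

end

section \<open>Twice differentiable maps\<close>

text \<open>A calculus for the symmetric second derivative of the frame at \<open>p\<close>. Products, compositions and inverses inherit the symmetry,
  so that the second derivative need not be written down.\<close>
definition second_jet :: "'a::real_normed_vector \<Rightarrow> ('a \<Rightarrow> 'b::real_normed_vector) \<Rightarrow> 'a set \<Rightarrow> ('a \<Rightarrow> 'a \<Rightarrow> 'b) \<Rightarrow> ('a \<Rightarrow> 'a \<Rightarrow> 'b) \<Rightarrow> bool"
  where "second_jet p f S Df D2f \<longleftrightarrow> open S \<and> p \<in> S \<and> (\<forall>q\<in>S. (f has_derivative Df q) (at q)) \<and>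
    (\<forall>v. ((\<lambda>q. Df q v) has_derivative (\<lambda>w. D2f w v)) (at p)) \<and> (\<forall>v w. D2f v w = D2f w v)"

definition twice_diff :: "'a::real_normed_vector \<Rightarrow> ('a \<Rightarrow> 'b::real_normed_vector) \<Rightarrow> bool" where
  "twice_diff p f \<longleftrightarrow> (\<exists>S Df D2f. second_jet p f S Df D2f)"

lemma second_jetD:
  assumes "second_jet p f S Df D2f"
  shows "open S" "p \<in> S" "\<And>q. q \<in> S \<Longrightarrow> (f has_derivative Df q) (at q)"
    "\<And>v. ((\<lambda>q. Df q v) has_derivative (\<lambda>w. D2f w v)) (at p)" "\<And>v w. D2f v w = D2f w v"
  using assms unfolding second_jet_def by blast+

lemma twice_diffI:
  assumes "open S" "p \<in> S" "\<And>q. q \<in> S \<Longrightarrow> (f has_derivative Df q) (at q)"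
    "\<And>v. ((\<lambda>q. Df q v) has_derivative (\<lambda>w. D2f w v)) (at p)" "\<And>v w. D2f v w = D2f w v"
  shows "twice_diff p f"
  unfolding twice_diff_def second_jet_def using assms by blast

lemma twice_diff_bounded_linear: assumes "bounded_linear f" shows "twice_diff p f"
  by (rule twice_diffI[of UNIV, where Df = "\<lambda>q. f" and D2f = "\<lambda>w v. 0"])
     (auto intro: bounded_linear_imp_has_derivative assms)

lemma twice_diff_const: "twice_diff p (\<lambda>q. c)"
  by (rule twice_diffI[of UNIV, where Df = "\<lambda>q v. 0" and D2f = "\<lambda>w v. 0"]) auto

lemma twice_diff_linear_compose:
  assumes l: "bounded_linear l" and f: "twice_diff p f" shows "twice_diff p (\<lambda>q. l (f q))"
proof -
  obtain S Df D2f where "second_jet p f S Df D2f" using f unfolding twice_diff_def by blast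
  note f = second_jetD[OF this]
  show ?thesis
    by (rule twice_diffI[OF f(1,2), where Df = "\<lambda>q v. l (Df q v)" and D2f = "\<lambda>w v. l (D2f w v)"])
       (auto intro!: bounded_linear.has_derivative[OF l] f(3,4) arg_cong[of _ _ l] f(5))
qed

lemma twice_diff_add:
  assumes "twice_diff p f" "twice_diff p g" shows "twice_diff p (\<lambda>q. f q + g q)"
proof -
  obtain S Df D2f where "second_jet p f S Df D2f" using assms(1) unfolding twice_diff_def by blast
  note f = second_jetD[OF this]
  obtain T Dg D2g where "second_jet p g T Dg D2g" using assms(2) unfolding twice_diff_def by blast
  note g = second_jetD[OF this]
  show ?thesis
    by (rule twice_diffI[of "S \<inter> T", where Df = "\<lambda>q v. Df q v + Dg q v" and D2f = "\<lambda>w v. D2f w v + D2g w v"])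
       (use f(1,2) g(1,2) in \<open>auto intro!: has_derivative_add f(3,4) g(3,4) arg_cong2[of _ _ _ _ "(+)"] f(5) g(5)\<close>)
qed

lemma twice_diff_bilinear:
  assumes b: "bounded_bilinear b" and "twice_diff p f" "twice_diff p g" shows "twice_diff p (\<lambda>q. b (f q) (g q))"
proof -
  obtain S Df D2f where "second_jet p f S Df D2f" using assms(2) unfolding twice_diff_def by blast
  note f = second_jetD[OF this]
  obtain T Dg D2g where "second_jet p g T Dg D2g" using assms(3) unfolding twice_diff_def by blast
  note g = second_jetD[OF this]
  show ?thesis
  proof (rule twice_diffI[of "S \<inter> T"])
    show "open (S \<inter> T)" "p \<in> S \<inter> T" using f g by auto
    show "((\<lambda>q. b (f q) (g q)) has_derivative (\<lambda>v. b (f q) (Dg q v) + b (Df q v) (g q))) (at q)" if "q \<in> S \<inter> T" for q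
      using bounded_bilinear.FDERIV[OF b f(3) g(3)] that by simp
    show "((\<lambda>q. b (f q) (Dg q v) + b (Df q v) (g q)) has_derivative
      (\<lambda>w. (b (f p) (D2g w v) + b (Df p w) (Dg p v)) + (b (Df p v) (Dg p w) + b (D2f w v) (g p)))) (at p)" for v
      by (intro has_derivative_add bounded_bilinear.FDERIV[OF b] f g)
    show "(b (f p) (D2g v w) + b (Df p v) (Dg p w)) + (b (Df p w) (Dg p v) + b (D2f v w) (g p)) =
      (b (f p) (D2g w v) + b (Df p w) (Dg p v)) + (b (Df p v) (Dg p w) + b (D2f w v) (g p))" for v w
      using f(5)[of v w] g(5)[of v w] by simp
  qed
qed

lemma twice_diff_real_compose:
  fixes f :: "'a::real_normed_vector \<Rightarrow> real"
  assumes U: "open U" "f p \<in> U" and g: "\<And>y. y \<in> U \<Longrightarrow> (g has_real_derivative g' y) (at y)"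
    and g': "(g' has_real_derivative g'') (at (f p))" and f: "twice_diff p f"
  shows "twice_diff p (\<lambda>q. g (f q))"
proof -
  obtain S Df D2f where "second_jet p f S Df D2f" using f unfolding twice_diff_def by blast
  note f = second_jetD[OF this]
  have "continuous_on S f"
    using f(3) by (meson continuous_at_imp_continuous_on has_derivative_continuous)
  then have o: "open (S \<inter> f -` U)" using U(1) f(1) by (simp add: continuous_on_open_vimage Int_commute)
  show ?thesis
  proof (rule twice_diffI[OF o])
    show "p \<in> S \<inter> f -` U" using f(2) U(2) by simp
    show "((\<lambda>q. g (f q)) has_derivative (\<lambda>v. Df q v * g' (f q))) (at q)" if "q \<in> S \<inter> f -` U" for q
      using DERIV_compose_FDERIV[where f = g and g = f, OF g f(3)] that by simp
    show "((\<lambda>q. Df q v * g' (f q)) has_derivative (\<lambda>w. Df p v * (Df p w * g'') + D2f w v * g' (f p))) (at p)" for v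
      by (intro has_derivative_mult f(4) DERIV_compose_FDERIV[where f = g' and g = f, OF g' f(3)[OF f(2)]])
    show "Df p w * (Df p v * g'') + D2f v w * g' (f p) = Df p v * (Df p w * g'') + D2f w v * g' (f p)" for v w
      using f(5)[of v w] by simp
  qed
qed

lemma twice_diff_inverse:
  fixes f :: "'a::real_normed_vector \<Rightarrow> real"
  assumes "twice_diff p f" "f p > 0" shows "twice_diff p (\<lambda>q. inverse (f q))"
proof (rule twice_diff_real_compose[where U = "{0<..}" and g = inverse, OF _ _ _ _ assms(1)])
  show "(inverse has_real_derivative - (inverse y ^ 2)) (at y)" if "y \<in> {0<..}" for y
    using DERIV_inverse[of y] that by (simp add: power2_eq_square)
  show "((\<lambda>y. - (inverse y ^ 2)) has_real_derivative 2 * inverse (f p) ^ 3) (at (f p))"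
    by (rule DERIV_cong[OF DERIV_minus[OF DERIV_power[OF DERIV_inverse]]])
       (use assms(2) in \<open>simp_all add: power2_eq_square power3_eq_cube\<close>)
qed (use assms in auto)

lemma twice_diff_sqrt:
  fixes f :: "'a::real_normed_vector \<Rightarrow> real"
  assumes "twice_diff p f" "f p > 0" shows "twice_diff p (\<lambda>q. sqrt (f q))"
proof (rule twice_diff_real_compose[where U = "{0<..}" and g = sqrt, OF _ _ _ _ assms(1)])
  show "(sqrt has_real_derivative inverse (sqrt y) / 2) (at y)" if "y \<in> {0<..}" for y
    using DERIV_real_sqrt[of y] that by simp
  show "((\<lambda>y. inverse (sqrt y) / 2) has_real_derivative (- (inverse (sqrt (f p)) * (inverse (sqrt (f p)) / 2) * inverse (sqrt (f p))) / 2)) (at (f p))"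
    by (rule DERIV_cdivide[OF DERIV_inverse'[OF DERIV_real_sqrt[OF assms(2)]]]) (use assms(2) in simp)
qed (use assms in auto)

text \<open>Whichever formula describes the first derivative near \<open>p\<close>, it has a symmetric derivative at \<open>p\<close>.\<close>
lemma twice_diff_second_derivative:
  assumes f: "twice_diff p f" and O: "open Op" "p \<in> Op" and D: "\<And>q. q \<in> Op \<Longrightarrow> (f has_derivative Df q) (at q)"
  shows "\<exists>D2f. (\<forall>v. ((\<lambda>q. Df q v) has_derivative (\<lambda>w. D2f w v)) (at p)) \<and> (\<forall>v w. D2f v w = D2f w v)"
proof -
  obtain S Df' D2f where "second_jet p f S Df' D2f" using f unfolding twice_diff_def by blast
  note f = second_jetD[OF this]
  have eq: "Df' q = Df q" if "q \<in> S \<inter> Op" for q using has_derivative_unique[OF f(3) D] that by blast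
  have "((\<lambda>q. Df q v) has_derivative (\<lambda>w. D2f w v)) (at p)" for v
    by (rule has_derivative_transform_within_open[OF f(4), of "S \<inter> Op"]) (use f(1,2) O eq in auto)
  moreover have "D2f v w = D2f w v" for v w by (rule f(5))
  ultimately show ?thesis by blast
qed

section \<open>The period matrix\<close>

text \<open>Vectors indexed by \<open>'n option\<close> as pairs of a component with index \<open>0\<close> and a vector with indices \<open>1,\<dots>,n\<close>.\<close>
definition cons_vec :: "'a \<Rightarrow> 'a ^ 'n \<Rightarrow> 'a ^ ('n option)" where "cons_vec a v = (\<chi> I. case I of None \<Rightarrow> a | Some \<mu> \<Rightarrow> v $ \<mu>)"
definition tail_vec :: "'a ^ ('n option) \<Rightarrow> 'a ^ 'n" where "tail_vec z = (\<chi> \<mu>. z $ Some \<mu>)"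

lemma cons_vec_simps [simp]: "cons_vec a v $ None = a" "cons_vec a v $ Some \<mu> = v $ \<mu>" "tail_vec z $ \<mu> = z $ Some \<mu>" "tail_vec (cons_vec a v) = v"
  by (simp_all add: cons_vec_def tail_vec_def vec_eq_iff)

definition real_vec :: "real ^ 'n \<Rightarrow> complex ^ 'n" where "real_vec u = (\<chi> \<mu>. complex_of_real (u $ \<mu>))"

lemma polar_real_vec: "polar c (real_vec u) (real_vec v) (real_vec w) = complex_of_real (polar c u v w)"
  by (simp add: polar_def real_vec_def)

lemma real_vec_decompose: "X = real_vec (Re_vec X) + \<i> *s real_vec (Im_vec X)"
  by (simp add: real_vec_def Re_vec_def Im_vec_def vec_eq_iff complex_eq_iff)

lemma axis_real_vec: "axis \<mu> 1 = real_vec (axis \<mu> 1)"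
  by (simp add: real_vec_def vec_eq_iff axis_def)

lemma polar_axis_sum: "(\<Sum>\<nu>\<in>UNIV. polar c u v (axis \<nu> 1) * w $ \<nu>) = polar c u v w"
proof -
  have "polar c u v (axis \<nu> 1) = polar_low c u v $ \<nu>" for \<nu>
    by (simp add: polar_low_sum axis_def if_distrib[of "\<lambda>x. _ * x"] cong: if_cong)
  then show ?thesis by (simp add: polar_low_sum)
qed

context fixes c :: "'n::finite \<Rightarrow> 'n \<Rightarrow> 'n \<Rightarrow> real" begin

lemma polar_line_derivs:
  fixes v a b d :: "complex ^ 'n"
  shows "((\<lambda>t. cubic c (v + t *s a)) has_field_derivative polar c v v a / 2) (at 0)"
    "((\<lambda>t. polar c (v + t *s a) (v + t *s a) b) has_field_derivative 2 * polar c v a b) (at 0)"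
proof -
  have s: "polar c a a v = polar c v a a" by (metis polar_commute12 polar_commute23)
  have 1: "cubic c (v + t *s a) = (polar c v v v + 3 * t * polar c v v a + 3 * t\<^sup>2 * polar c v a a + t ^ 3 * polar c a a a) / 6" for t
    by (simp add: cubic_polar polar_lin s polar_commute12[of c a v] polar_commute23[of c v a v] power2_eq_square power3_eq_cube algebra_simps)
  show "((\<lambda>t. cubic c (v + t *s a)) has_field_derivative polar c v v a / 2) (at 0)"
    unfolding 1 by (auto intro!: derivative_eq_intros)
  have 2: "polar c (v + t *s a) (v + t *s a) b = polar c v v b + 2 * t * polar c v a b + t\<^sup>2 * polar c a a b" for t
    by (simp add: polar_lin polar_commute12[of c a v] power2_eq_square algebra_simps)
  show "((\<lambda>t. polar c (v + t *s a) (v + t *s a) b) has_field_derivative 2 * polar c v a b) (at 0)"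
    unfolding 2 by (auto intro!: derivative_eq_intros)
qed

lemma axis_None [simp]: "axis (Some \<mu>) x $ None = 0" by (simp add: axis_def)

lemma shift_simps:
  "(z + t *s axis (Some \<mu>) 1) $ None = z $ None" "tail_vec (z + t *s axis (Some \<mu>) 1) = tail_vec z + t *s axis \<mu> 1"
  "(z + t *s axis None 1) $ None = z $ None + t" "tail_vec (z + t *s axis None 1) = tail_vec z"
  for z :: "complex ^ ('n option)"
  by (simp_all add: vec_eq_iff axis_def)

lemma prepotential_tail_vec: "prepotential c z = cubic c (tail_vec z) / z $ None"
  by (simp add: prepotential_def tail_vec_def)

lemma cpartial_prepotential:
  "cpartial (Some \<nu>) (prepotential c) z = polar c (tail_vec z) (tail_vec z) (axis \<nu> 1) / (2 * z $ None)"
  "z $ None \<noteq> 0 \<Longrightarrow> cpartial None (prepotential c) z = - cubic c (tail_vec z) / (z $ None)\<^sup>2"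
proof -
  show "cpartial (Some \<nu>) (prepotential c) z = polar c (tail_vec z) (tail_vec z) (axis \<nu> 1) / (2 * z $ None)"
    unfolding cpartial_def prepotential_tail_vec shift_simps
    using DERIV_cdivide[OF polar_line_derivs(1)[of "tail_vec z" "axis \<nu> 1"], of "z $ None"] by (simp add: DERIV_imp_deriv)
  assume z: "z $ None \<noteq> 0"
  have "((\<lambda>t. cubic c (tail_vec z) / (z $ None + t)) has_field_derivative - cubic c (tail_vec z) / (z $ None)\<^sup>2) (at 0)"
    using z by (auto intro!: derivative_eq_intros simp: power2_eq_square)
  then show "cpartial None (prepotential c) z = - cubic c (tail_vec z) / (z $ None)\<^sup>2"
    unfolding cpartial_def prepotential_tail_vec shift_simps by (rule DERIV_imp_deriv)
qed

text \<open>The second derivatives of \<open>h(z)/z\<^sup>0\<close>, at points with \<open>z\<^sup>0 = 1\<close>.\<close>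
lemma prepotential2_eq:
  assumes z: "z $ None = 1"
  shows "prepotential2 c z (Some \<mu>) (Some \<nu>) = polar c (tail_vec z) (axis \<mu> 1) (axis \<nu> 1)"
    "prepotential2 c z None (Some \<nu>) = - polar c (tail_vec z) (tail_vec z) (axis \<nu> 1) / 2"
    "prepotential2 c z (Some \<mu>) None = - polar c (tail_vec z) (tail_vec z) (axis \<mu> 1) / 2"
    "prepotential2 c z None None = 2 * cubic c (tail_vec z)"
proof -
  show "prepotential2 c z (Some \<mu>) (Some \<nu>) = polar c (tail_vec z) (axis \<mu> 1) (axis \<nu> 1)"
    unfolding prepotential2_def cpartial_def[of "Some \<mu>"] cpartial_prepotential(1) shift_simps
    using DERIV_cdivide[OF polar_line_derivs(2)[of "tail_vec z" "axis \<mu> 1" "axis \<nu> 1"], of 2] by (simp add: DERIV_imp_deriv z)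
  have "((\<lambda>t. polar c (tail_vec z) (tail_vec z) (axis \<nu> 1) / (2 * (1 + t))) has_field_derivative - polar c (tail_vec z) (tail_vec z) (axis \<nu> 1) / 2) (at 0)"
    by (auto intro!: derivative_eq_intros)
  then show "prepotential2 c z None (Some \<nu>) = - polar c (tail_vec z) (tail_vec z) (axis \<nu> 1) / 2"
    unfolding prepotential2_def cpartial_def[of None] cpartial_prepotential(1) shift_simps z by (rule DERIV_imp_deriv)
  have s: "cpartial None (prepotential c) (z + t *s axis (Some \<mu>) 1) = - cubic c (tail_vec z + t *s axis \<mu> 1)" for t
    by (subst cpartial_prepotential(2)) (simp_all add: shift_simps(1)[of z t \<mu>] shift_simps(2)[of z t \<mu>] z)
  show "prepotential2 c z (Some \<mu>) None = - polar c (tail_vec z) (tail_vec z) (axis \<mu> 1) / 2"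
    unfolding prepotential2_def cpartial_def[of "Some \<mu>"] s
    using DERIV_minus[OF polar_line_derivs(1)[of "tail_vec z" "axis \<mu> 1"]] by (simp add: DERIV_imp_deriv)
  have n: "cpartial None (prepotential c) (z + t *s axis None 1) = - cubic c (tail_vec z) / (1 + t)\<^sup>2" if "t \<in> - {-1}" for t
    using that by (subst cpartial_prepotential(2)) (auto simp: shift_simps z add_eq_0_iff)
  have "((\<lambda>t. - cubic c (tail_vec z) / (1 + t)\<^sup>2) has_field_derivative 2 * cubic c (tail_vec z)) (at 0)"
    by (auto intro!: derivative_eq_intros)
  then have "((\<lambda>t. cpartial None (prepotential c) (z + t *s axis None 1)) has_field_derivative 2 * cubic c (tail_vec z)) (at 0)"
    by (rule has_field_derivative_transform_within_open[of _ _ _ "- {-1}"]) (auto simp: n)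
  then show "prepotential2 c z None None = 2 * cubic c (tail_vec z)"
    unfolding prepotential2_def cpartial_def[of None] by (rule DERIV_imp_deriv)
qed

text \<open>Since \<open>N z\<close> has simple components (\<open>Nz\<close> and \<open>Nz0\<close> in the proof) and \<open>z\<^sup>T N z = -16h\<close>, the rank one correction
  removes \<open>x\<close> from the real parts. Hence \<open>\<R>\<close> consists of the second derivatives of the prepotential at the real part \<open>y\<close>, while
  \<open>\<I>\<close> is block diagonal with blocks \<open>h\<close> and \<open>4hK\<close> after the shift by \<open>y\<close>.\<close>
lemma period_matrix_eq:
  fixes X :: "complex ^ 'n"
  assumes h: "cubic c (Im_vec X) > 0"
  defines "x \<equiv> Im_vec X" and "y \<equiv> Re_vec X"
  shows "period_re c X $ Some \<mu> $ Some \<nu> = polar c y (axis \<mu> 1) (axis \<nu> 1)"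
    "period_re c X $ None $ Some \<nu> = - polar c y y (axis \<nu> 1) / 2"
    "period_re c X $ Some \<mu> $ None = - polar c y y (axis \<mu> 1) / 2"
    "period_re c X $ None $ None = 2 * cubic c y"
    "period_im c X $ Some \<mu> $ Some \<nu> = 4 * cubic c x * Kc c x (axis \<mu> 1) (axis \<nu> 1)"
    "period_im c X $ None $ Some \<nu> = - 4 * cubic c x * Kc c x y (axis \<nu> 1)"
    "period_im c X $ Some \<mu> $ None = - 4 * cubic c x * Kc c x y (axis \<mu> 1)"
    "period_im c X $ None $ None = cubic c x + 4 * cubic c x * Kc c x y y"
proof -
  define hx where "hx = cubic c x"
  have hx: "hx > 0" "polar c x x x = 6 * hx" using h by (simp_all add: hx_def x_def cubic_polar)
  have Xd: "X = real_vec y + \<i> *s real_vec x" unfolding x_def y_def by (rule real_vec_decompose)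
  let ?z = "inhom_point X"
  have z: "?z $ None = 1" "tail_vec ?z = X" by (simp_all add: inhom_point_def tail_vec_def vec_eq_iff)
  note F = prepotential2_eq[OF z(1), unfolded z(2)]
  define N where "N I J = complex_of_real (2 * Im (prepotential2 c ?z I J))" for I J
  have comm1: "polar c x y u = polar c y x u" for u by (rule polar_commute12)
  have comm: "polar c y y x = polar c x y y" "polar c y x x = polar c x x y" "polar c x y x = polar c x x y" "polar c y x y = polar c x y y"
    by (metis polar_commute12 polar_commute23)+
  have XXa: "polar c X X (real_vec a) = complex_of_real (polar c y y a - polar c x x a) + 2 * \<i> * complex_of_real (polar c y x a)" for a
    unfolding Xd by (simp add: polar_lin polar_real_vec comm1 algebra_simps)
  have Xab: "polar c X (real_vec a) (real_vec b) = complex_of_real (polar c y a b) + \<i> * complex_of_real (polar c x a b)" for a b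
    unfolding Xd by (simp add: polar_lin polar_real_vec)
  have XXX: "cubic c X = complex_of_real (polar c y y y - 3 * polar c x x y) / 6 + \<i> * complex_of_real (3 * polar c x y y - 6 * hx) / 6"
    unfolding Xd by (simp add: cubic_polar polar_lin polar_real_vec comm hx) (simp add: field_simps)
  have N: "N (Some \<mu>) (Some \<nu>) = complex_of_real (2 * polar c x (axis \<mu> 1) (axis \<nu> 1))"
    "N None (Some \<nu>) = complex_of_real (- 2 * polar c y x (axis \<nu> 1))"
    "N (Some \<mu>) None = complex_of_real (- 2 * polar c y x (axis \<mu> 1))"
    "N None None = complex_of_real (2 * polar c x y y - 4 * hx)" for \<mu> \<nu>
    by (simp_all add: N_def F axis_real_vec XXa Xab XXX)
  have cs: "(\<Sum>\<nu>\<in>UNIV. complex_of_real (polar c u v (axis \<nu> 1)) * X $ \<nu>) = complex_of_real (polar c u v y) + \<i> * complex_of_real (polar c u v x)" for u v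
  proof -
    have "(\<Sum>\<nu>\<in>UNIV. complex_of_real (polar c u v (axis \<nu> 1)) * X $ \<nu>) = polar c (real_vec u) (real_vec v) X"
      by (subst polar_axis_sum[symmetric]) (simp add: axis_real_vec polar_real_vec)
    also have "\<dots> = polar c (real_vec u) (real_vec v) (real_vec y + \<i> *s real_vec x)" by (simp only: Xd)
    finally show ?thesis by (simp add: polar_lin polar_real_vec)
  qed
  have Nz: "(\<Sum>K\<in>UNIV. N (Some \<mu>) K * ?z $ K) = 2 * \<i> * complex_of_real (polar c x x (axis \<mu> 1))" for \<mu>
  proof -
    have "(\<Sum>K\<in>UNIV. N (Some \<mu>) K * ?z $ K) = complex_of_real (- 2 * polar c y x (axis \<mu> 1))
      + 2 * (\<Sum>\<nu>\<in>UNIV. complex_of_real (polar c x (axis \<mu> 1) (axis \<nu> 1)) * X $ \<nu>)"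
      by (simp add: sum_option N z(1) inhom_point_def sum_distrib_left mult.assoc)
    then show ?thesis unfolding cs using polar_commute23[of c x y "axis \<mu> 1"] polar_commute23[of c x x "axis \<mu> 1"] comm1[of "axis \<mu> 1"] by simp
  qed
  have Nz0: "(\<Sum>K\<in>UNIV. N None K * ?z $ K) = - 4 * complex_of_real hx - 2 * \<i> * complex_of_real (polar c x x y)"
  proof -
    have "(\<Sum>K\<in>UNIV. N None K * ?z $ K) = complex_of_real (2 * polar c x y y - 4 * hx)
      - 2 * (\<Sum>\<nu>\<in>UNIV. complex_of_real (polar c y x (axis \<nu> 1)) * X $ \<nu>)"
      by (simp add: sum_option N z(1) inhom_point_def sum_distrib_left mult.assoc sum_negf)
    then show ?thesis unfolding cs by (simp add: comm)
  qed
  have zNz: "(\<Sum>K\<in>UNIV. \<Sum>L\<in>UNIV. N K L * ?z $ K * ?z $ L) = - 16 * complex_of_real hx"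
  proof -
    have "(\<Sum>K\<in>UNIV. \<Sum>L\<in>UNIV. N K L * ?z $ K * ?z $ L) = (\<Sum>K\<in>UNIV. (\<Sum>L\<in>UNIV. N K L * ?z $ L) * ?z $ K)"
      unfolding sum_distrib_right by (intro sum.cong refl) (simp add: mult_ac)
    also have "\<dots> = (- 4 * complex_of_real hx - 2 * \<i> * complex_of_real (polar c x x y)) + 2 * \<i> * (\<Sum>\<mu>\<in>UNIV. complex_of_real (polar c x x (axis \<mu> 1)) * X $ \<mu>)"
      unfolding Nz0 Nz sum_option[of "\<lambda>K. (\<Sum>L\<in>UNIV. N K L * ?z $ L) * ?z $ K"] z(1)
      by (simp add: inhom_point_def sum_distrib_left mult.assoc)
    finally show ?thesis unfolding cs by (simp add: hx algebra_simps)
  qed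
  have PM: "period_matrix c X $ I $ J = cnj (prepotential2 c ?z I J) + \<i> * ((\<Sum>K\<in>UNIV. N I K * ?z $ K) * (\<Sum>L\<in>UNIV. N J L * ?z $ L)) / (- 16 * complex_of_real hx)" for I J
    unfolding period_matrix_def Let_def N_def[symmetric] zNz by simp
  have K: "Kc c x u v = polar c x x u * polar c x x v / (16 * hx\<^sup>2) - polar c x u v / (4 * hx)" for u v
    by (simp add: Kc_def hx_def diff_divide_distrib)
  have PMs: "period_matrix c X $ Some \<mu> $ Some \<nu> = Complex (polar c y (axis \<mu> 1) (axis \<nu> 1)) (4 * hx * Kc c x (axis \<mu> 1) (axis \<nu> 1))"
    "period_matrix c X $ None $ Some \<nu> = Complex (- polar c y y (axis \<nu> 1) / 2) (- 4 * hx * Kc c x y (axis \<nu> 1))"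
    "period_matrix c X $ Some \<mu> $ None = Complex (- polar c y y (axis \<mu> 1) / 2) (- 4 * hx * Kc c x y (axis \<mu> 1))"
    "period_matrix c X $ None $ None = Complex (2 * cubic c y) (hx + 4 * hx * Kc c x y y)"
    using hx(1)
    unfolding PM Nz Nz0
    by (simp_all add: F axis_real_vec XXa Xab XXX K comm comm1[of "axis _ 1"] complex_eq_iff cubic_polar[of c y] field_simps power2_eq_square)
  show "period_re c X $ Some \<mu> $ Some \<nu> = polar c y (axis \<mu> 1) (axis \<nu> 1)"
    "period_re c X $ None $ Some \<nu> = - polar c y y (axis \<nu> 1) / 2"
    "period_re c X $ Some \<mu> $ None = - polar c y y (axis \<mu> 1) / 2"
    "period_re c X $ None $ None = 2 * cubic c y"
    "period_im c X $ Some \<mu> $ Some \<nu> = 4 * cubic c x * Kc c x (axis \<mu> 1) (axis \<nu> 1)"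
    "period_im c X $ None $ Some \<nu> = - 4 * cubic c x * Kc c x y (axis \<nu> 1)"
    "period_im c X $ Some \<mu> $ None = - 4 * cubic c x * Kc c x y (axis \<mu> 1)"
    "period_im c X $ None $ None = cubic c x + 4 * cubic c x * Kc c x y y"
    by (simp_all add: period_re_def period_im_def PMs hx_def)
qed

end

section \<open>The frame of the q-map metric\<close>

lemma twice_diff_transform:
  assumes "twice_diff p g" "open S" "p \<in> S" "\<And>q. q \<in> S \<Longrightarrow> f q = g q"
  shows "twice_diff p f"
proof -
  obtain T Dg D2g where "second_jet p g T Dg D2g" using assms(1) unfolding twice_diff_def by blast
  note g = second_jetD[OF this]
  show ?thesis
  proof (rule twice_diffI)
    show "open (S \<inter> T)" "p \<in> S \<inter> T" using g(1,2) assms(2,3) by auto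
    show "(f has_derivative Dg q) (at q)" if "q \<in> S \<inter> T" for q
      by (rule has_derivative_transform_within_open[OF g(3) assms(2)]) (use that assms(4) in auto)
  qed (rule g)+
qed

lemma polar_low_lin:
  fixes u v :: "real ^ 'n::finite"
  shows "polar_low c (u + u') v = polar_low c u v + polar_low c u' v" "polar_low c u (v + v') = polar_low c u v + polar_low c u v'"
    "polar_low c (u - u') v = polar_low c u v - polar_low c u' v" "polar_low c u (v - v') = polar_low c u v - polar_low c u v'"
    "polar_low c (a *\<^sub>R u) v = a *\<^sub>R polar_low c u v" "polar_low c u (a *\<^sub>R v) = a *\<^sub>R polar_low c u v"
    "polar_low c 0 v = 0" "polar_low c u 0 = 0"
  by (simp_all add: vector_eq_rdot[symmetric] polar_inner polar_lin polar_scaleR polar_0 inner_add_left inner_diff_left del: vector_eq_rdot)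

lemma polar_low_commute: "polar_low c v u = polar_low c u (v :: real ^ 'n::finite)"
  by (simp add: vector_eq_rdot[symmetric] polar_inner polar_commute12[of c v u] del: vector_eq_rdot)

lemma bounded_bilinear_polar_low: "bounded_bilinear (polar_low c :: real ^ 'n::finite \<Rightarrow> _)"
  unfolding bilinear_conv_bounded_bilinear[symmetric] bilinear_def
  by (auto intro!: linearI simp: polar_low_lin)

lemma cons_vec_inner: "cons_vec a v \<bullet> cons_vec b w = a * b + v \<bullet> w" for v w :: "real ^ 'n::finite"
  by (simp add: inner_vec_def sum_option)

lemma cons_vec_lin: "cons_vec a v + cons_vec b w = cons_vec (a + b) (v + w)" "cons_vec a v - cons_vec b w = cons_vec (a - b) (v - w)" "r *\<^sub>R cons_vec a v = cons_vec (r * a) (r *\<^sub>R v)"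
  for v w :: "real ^ 'n::finite"
  by (simp_all add: cons_vec_def vec_eq_iff split: option.split)

lemma bounded_linear_cons_vec: "bounded_linear (\<lambda>(a, v). cons_vec a (v :: real ^ 'n::finite))"
  by (rule linear_conv_bounded_linear[THEN iffD1], rule linearI) (auto simp: cons_vec_lin)

context fixes c :: "'n::finite \<Rightarrow> 'n \<Rightarrow> 'n \<Rightarrow> real" begin

abbreviation qx :: "'n q_space \<Rightarrow> real ^ 'n" where "qx q \<equiv> Im_vec (fst q)"
abbreviation qy :: "'n q_space \<Rightarrow> real ^ 'n" where "qy q \<equiv> Re_vec (fst q)"
abbreviation qr :: "'n q_space \<Rightarrow> real" where "qr q \<equiv> fst (snd q)"
abbreviation qzt :: "'n q_space \<Rightarrow> real ^ ('n option)" where "qzt q \<equiv> fst (snd (snd (snd q)))"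
abbreviation qz :: "'n q_space \<Rightarrow> real ^ ('n option)" where "qz q \<equiv> snd (snd (snd (snd q)))"

definition qdom :: "'n q_space set" where "qdom = {q. qx q \<in> regular_points c \<and> qr q > 0}"

abbreviation "beta0_at x \<equiv> cubic_jet.beta0 (Kc c x) x"
abbreviation "beta_at x \<equiv> cubic_jet.beta (Kc c x) x"
abbreviation "gam_at x \<equiv> cubic_jet.gam (Kc c x) x"
abbreviation "gam0_at x \<equiv> cubic_jet.gam0 (Kc c x) x"
abbreviation "dbeta0_at x \<equiv> cubic_jet.dbeta0 (Kc c x)"
abbreviation "dbeta_at x \<equiv> cubic_jet.dbeta (Kc c x) x"
abbreviation "dgam_at x \<equiv> cubic_jet.dgam (Kc c x) x"
abbreviation "dgam0_at x \<equiv> cubic_jet.dgam0 (Kc c x)"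

text \<open>The common factor \<open>(2\<rho>h)\<^sup>1\<^sup>/\<^sup>2\<close> normalises the forms \<open>d\<zeta>\<close> and \<open>d\<zeta>t\<close>, and makes the frame depend on
  \<open>\<rho>\<close> and \<open>h\<close>.\<close>
definition radius :: "'n q_space \<Rightarrow> real" where "radius q = sqrt (2 * qr q * cubic c (qx q))"
text \<open>The frame in two steps. The components \<open>tau\<close> and \<open>sig\<close> of the one-forms \<open>d\<zeta>\<close> and \<open>d\<zeta>t + \<R> d\<zeta>\<close> are first
  given at \<open>Re X = 0\<close>. The shift by \<open>y = Re X\<close>, which acts on \<open>d\<zeta>\<close> by \<open>\<tau> \<mapsto> \<tau> + \<tau>\<^sub>0 y\<close> and on \<open>d\<zeta>t\<close> by the
  corresponding symplectic map, polynomial of degree three in \<open>y\<close>, then yields \<open>e_zeta\<close> and \<open>e_zetat\<close>.\<close>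
definition tau0 where "tau0 q z = radius q * inverse (cubic c (qx q)) * beta0_at (qx q) z"
definition tauv where "tauv q z = (radius q * inverse (cubic c (qx q)) / 2) *\<^sub>R beta_at (qx q) z"
definition sig0 where "sig0 q z = radius q * gam0_at (qx q) z"
definition sigv where "sigv q z = (2 * radius q) *\<^sub>R Klow c (qx q) (gam_at (qx q) z)"

definition e_zeta where "e_zeta q z = cons_vec (tau0 q z) (tauv q z + tau0 q z *\<^sub>R qy q)"
definition e_zetat0 where "e_zetat0 q z = sig0 q z - qy q \<bullet> sigv q z + polar_low c (qy q) (qy q) \<bullet> tauv q z / 2 + tau0 q z * (polar_low c (qy q) (qy q) \<bullet> qy q / 6)"
definition e_zetatv where "e_zetatv q z = sigv q z - polar_low c (qy q) (tauv q z) - (tau0 q z / 2) *\<^sub>R polar_low c (qy q) (qy q)"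
definition e_zetat where "e_zetat q z = cons_vec (e_zetat0 q z) (e_zetatv q z)"
definition e_phi where "e_phi q z = - 2 * qr q * fst (fst (snd z)) - (qz q \<bullet> e_zetat q z - qzt q \<bullet> e_zeta q z)"
definition qframe :: "'n q_space \<Rightarrow> (real \<times> (real ^ 'n)) quad \<Rightarrow> 'n q_space" where
  "qframe q z = (cvec (snd (fst z)) (snd (fst (snd z))), - 2 * qr q * fst (fst z), e_phi q z, e_zetat q z, e_zeta q z)"

text \<open>The prefix \<open>D\<close> denotes the derivative in the direction \<open>v\<close>, as a function of \<open>q\<close>, \<open>v\<close> and the frame component \<open>z\<close>. The form
  \<open>half_dlog = d\<rho>/2\<rho>\<close> is the logarithmic derivative of \<open>\<rho>\<^sup>1\<^sup>/\<^sup>2\<close>.\<close>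
definition half_dlog :: "'n q_space \<Rightarrow> 'n q_space \<Rightarrow> real" where "half_dlog q v = qr v / (2 * qr q)"
definition Dtau0 where "Dtau0 q v z = radius q * inverse (cubic c (qx q)) * ((half_dlog q v - 2 * xi_at c (qx q) (qx v)) * beta0_at (qx q) z + dbeta0_at (qx q) (qx v) z)"
definition Dtauv where "Dtauv q v z = (radius q * inverse (cubic c (qx q)) / 2) *\<^sub>R ((half_dlog q v - 2 * xi_at c (qx q) (qx v)) *\<^sub>R beta_at (qx q) z + dbeta_at (qx q) (qx v) z)"
definition Dsig0 where "Dsig0 q v z = radius q * ((half_dlog q v + 2 * xi_at c (qx q) (qx v)) * gam0_at (qx q) z + dgam0_at (qx q) (qx v) z)"
definition Dsigv where "Dsigv q v z = (2 * radius q) *\<^sub>R Klow c (qx q) ((half_dlog q v + 2 * xi_at c (qx q) (qx v)) *\<^sub>R gam_at (qx q) z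
   + 2 *\<^sub>R chris_at c (qx q) (qx v) (gam_at (qx q) z) + dgam_at (qx q) (qx v) z)"
definition De_zeta where "De_zeta q v z = cons_vec (Dtau0 q v z) (Dtauv q v z + Dtau0 q v z *\<^sub>R qy q + tau0 q z *\<^sub>R qy v)"
definition De_zetat0 where "De_zetat0 q v z = Dsig0 q v z - qy v \<bullet> sigv q z - qy q \<bullet> Dsigv q v z + polar c (qy q) (qy v) (tauv q z)
   + polar c (qy q) (qy q) (Dtauv q v z) / 2 + Dtau0 q v z * (polar c (qy q) (qy q) (qy q) / 6) + tau0 q z * polar c (qy q) (qy q) (qy v) / 2"
definition De_zetatv where "De_zetatv q v z = Dsigv q v z - polar_low c (qy v) (tauv q z) - polar_low c (qy q) (Dtauv q v z)
   - (Dtau0 q v z / 2) *\<^sub>R polar_low c (qy q) (qy q) - tau0 q z *\<^sub>R polar_low c (qy q) (qy v)"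
definition De_zetat where "De_zetat q v z = cons_vec (De_zetat0 q v z) (De_zetatv q v z)"
definition De_phi where "De_phi q v z = - 2 * qr v * fst (fst (snd z)) - (qz v \<bullet> e_zetat q z + qz q \<bullet> De_zetat q v z - qzt v \<bullet> e_zeta q z - qzt q \<bullet> De_zeta q v z)"
definition Dqframe :: "'n q_space \<Rightarrow> 'n q_space \<Rightarrow> (real \<times> (real ^ 'n)) quad \<Rightarrow> 'n q_space" where
  "Dqframe q v z = (0, - 2 * qr v * fst (fst z), De_phi q v z, De_zetat q v z, De_zeta q v z)"

lemma bl_qx: "bounded_linear qx" by (intro bounded_linear_compose[OF bounded_linear_Im_vec] bounded_linear_fst)
lemma bounded_linear_Re_vec: "bounded_linear (Re_vec :: complex ^ 'n \<Rightarrow> real ^ 'n)"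
  by (rule linear_conv_bounded_linear[THEN iffD1], rule linearI) (simp_all add: Re_vec_def vec_eq_iff)
lemma bl_qy: "bounded_linear qy" by (intro bounded_linear_compose[OF bounded_linear_Re_vec] bounded_linear_fst)
lemma bl_qr: "bounded_linear qr" by (intro bounded_linear_compose[OF bounded_linear_fst] bounded_linear_snd)
lemma bl_qz: "bounded_linear qz" by (intro bounded_linear_compose[OF bounded_linear_snd] bounded_linear_snd)
lemma bl_qzt: "bounded_linear qzt" by (intro bounded_linear_compose[OF bounded_linear_fst] bounded_linear_compose[OF bounded_linear_snd] bounded_linear_snd)

lemma open_qdom: "open qdom"
proof -
  have "open (qx -` regular_points c)" "open (qr -` {0<..})"
    by (intro open_vimage linear_continuous_on bl_qx bl_qr open_regular open_greaterThan)+
  then have "open (qx -` regular_points c \<inter> qr -` {0<..})" by (rule open_Int)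
  also have "qx -` regular_points c \<inter> qr -` {0<..} = qdom" by (auto simp: qdom_def)
  finally show ?thesis .
qed

lemma qdomD: assumes "q \<in> qdom" shows "qx q \<in> regular_points c" "qr q > 0" "cubic c (qx q) > 0" "radius q > 0" "(radius q)\<^sup>2 = 2 * qr q * cubic c (qx q)"
  using assms by (auto simp: qdom_def regular_points_def radius_def)

lemma qframe_proj: "qx (qframe q z) = snd (fst z)" "qy (qframe q z) = snd (fst (snd z))" "qr (qframe q z) = - 2 * qr q * fst (fst z)"
  "qz (qframe q z) = e_zeta q z" "qzt (qframe q z) = e_zetat q z" "q \<in> qdom \<Longrightarrow> half_dlog q (qframe q z) = - fst (fst z)"
  by (auto simp: qframe_def cvec_simps half_dlog_def dest: qdomD(2))

context fixes q :: "'n q_space" assumes q: "q \<in> qdom" begin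

interpretation J: cubic_jet "Kc c (qx q)" "mc c (qx q)" "qx q" by (rule cubic_jet[OF qdomD(1)[OF q]])

lemma Klow_lin: "Klow c x (u + v) = Klow c x u + Klow c x v" "Klow c x (u - v) = Klow c x u - Klow c x v" "Klow c x (r *\<^sub>R u) = r *\<^sub>R Klow c x u"
  using Klow_linear[of c x] by (simp_all add: linear_add linear_diff linear_scale)

lemma Klow_mc: "Klow c (qx q) (mc c (qx q) u v) = (1 / (8 * cubic c (qx q))) *\<^sub>R polar_low c u v"
  using qdomD(1)[OF q] by (simp add: mc_def Klow_inv)

context fixes u z :: "(real \<times> (real ^ 'n)) quad" begin

abbreviation (input) "bracket \<equiv> J.conn u z - J.conn z u"

lemma torsion_tau0: "Dtau0 q (qframe q u) z - Dtau0 q (qframe q z) u = tau0 q bracket"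
  unfolding tau0_def J.torsion_beta0[symmetric] Dtau0_def qframe_proj qframe_proj(6)[OF q] by (simp add: algebra_simps)

lemma torsion_tauv: "Dtauv q (qframe q u) z - Dtauv q (qframe q z) u = tauv q bracket - tau0 q z *\<^sub>R snd (fst (snd u)) + tau0 q u *\<^sub>R snd (fst (snd z))"
  unfolding tauv_def J.torsion_beta[symmetric] Dtauv_def qframe_proj qframe_proj(6)[OF q] tau0_def by (simp add: algebra_simps)

lemma torsion_sig0: "Dsig0 q (qframe q u) z - Dsig0 q (qframe q z) u = sig0 q bracket + snd (fst (snd u)) \<bullet> sigv q z - snd (fst (snd z)) \<bullet> sigv q u"
  unfolding sig0_def J.torsion_gam0[symmetric] Dsig0_def qframe_proj qframe_proj(6)[OF q] sigv_def
  by (simp add: inner_commute[of "snd _" "Klow _ _ _"] Klow_inner Kc_commute[of c _ _ "snd _"] algebra_simps)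

lemma torsion_sigv: "Dsigv q (qframe q u) z - Dsigv q (qframe q z) u = sigv q bracket + polar_low c (snd (fst (snd u))) (tauv q z) - polar_low c (snd (fst (snd z))) (tauv q u)"
  using qdomD(3)[OF q]
  unfolding sigv_def J.torsion_gam[symmetric] Dsigv_def qframe_proj qframe_proj(6)[OF q] tauv_def
  by (simp add: Klow_lin Klow_mc polar_low_lin algebra_simps) (simp add: field_simps)

lemma torsion_e_zeta: "De_zeta q (qframe q u) z - De_zeta q (qframe q z) u = e_zeta q bracket"
proof -
  have tv: "tauv q bracket = Dtauv q (qframe q u) z - Dtauv q (qframe q z) u + tau0 q z *\<^sub>R snd (fst (snd u)) - tau0 q u *\<^sub>R snd (fst (snd z))"
    using torsion_tauv by (simp add: algebra_simps)
  show ?thesis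
    unfolding De_zeta_def e_zeta_def cons_vec_lin torsion_tau0[symmetric] qframe_proj tv by (simp add: algebra_simps)
qed

lemma torsion_e_zetatv: "De_zetatv q (qframe q u) z - De_zetatv q (qframe q z) u = e_zetatv q bracket"
proof -
  have "De_zetatv q (qframe q u) z - De_zetatv q (qframe q z) u = (Dsigv q (qframe q u) z - Dsigv q (qframe q z) u) - polar_low c (snd (fst (snd u))) (tauv q z) + polar_low c (snd (fst (snd z))) (tauv q u)
    - polar_low c (qy q) (Dtauv q (qframe q u) z - Dtauv q (qframe q z) u) - ((Dtau0 q (qframe q u) z - Dtau0 q (qframe q z) u) / 2) *\<^sub>R polar_low c (qy q) (qy q)
    - tau0 q z *\<^sub>R polar_low c (qy q) (snd (fst (snd u))) + tau0 q u *\<^sub>R polar_low c (qy q) (snd (fst (snd z)))"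
    unfolding De_zetatv_def qframe_proj by (simp add: polar_low_lin diff_divide_distrib algebra_simps)
  also have "\<dots> = e_zetatv q bracket"
    unfolding torsion_sigv torsion_tauv torsion_tau0 e_zetatv_def by (simp add: polar_low_lin algebra_simps)
  finally show ?thesis .
qed

lemma torsion_e_zetat0: "De_zetat0 q (qframe q u) z - De_zetat0 q (qframe q z) u = e_zetat0 q bracket"
proof -
  have "De_zetat0 q (qframe q u) z - De_zetat0 q (qframe q z) u = (Dsig0 q (qframe q u) z - Dsig0 q (qframe q z) u) - snd (fst (snd u)) \<bullet> sigv q z + snd (fst (snd z)) \<bullet> sigv q u
    - qy q \<bullet> (Dsigv q (qframe q u) z - Dsigv q (qframe q z) u) + polar c (qy q) (snd (fst (snd u))) (tauv q z) - polar c (qy q) (snd (fst (snd z))) (tauv q u)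
    + polar c (qy q) (qy q) (Dtauv q (qframe q u) z - Dtauv q (qframe q z) u) / 2 + (Dtau0 q (qframe q u) z - Dtau0 q (qframe q z) u) * (polar c (qy q) (qy q) (qy q) / 6)
    + tau0 q z * polar c (qy q) (qy q) (snd (fst (snd u))) / 2 - tau0 q u * polar c (qy q) (qy q) (snd (fst (snd z))) / 2"
    unfolding De_zetat0_def qframe_proj by (simp add: polar_lin inner_diff_right diff_divide_distrib algebra_simps)
  also have "\<dots> = e_zetat0 q bracket"
    unfolding torsion_sig0 torsion_sigv torsion_tauv torsion_tau0 e_zetat0_def
    by (simp add: polar_lin polar_scaleR inner_add_right inner_diff_right inner_commute[of "qy q" "polar_low _ _ _"] polar_inner
       polar_commute23[of c _ "tauv _ _" "qy q"] polar_commute12[of c "tauv _ _" "qy q"] polar_commute12[of c "snd _" "qy q"] polar_commute23[of c _ "snd _" "qy q"] diff_divide_distrib add_divide_distrib algebra_simps)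
  finally show ?thesis .
qed

text \<open>The shift by \<open>y\<close> is symplectic, hence disappears from the pairing.\<close>
lemma e_zeta_pairing: "e_zeta q u \<bullet> e_zetat q z - e_zetat q u \<bullet> e_zeta q z =
   2 * qr q * (J.beta0 u * J.gam0 z + Kc c (qx q) (J.beta u) (J.gam z) - J.beta0 z * J.gam0 u - Kc c (qx q) (J.beta z) (J.gam u))"
proof -
  have 1: "tau0 q a * sig0 q b = 2 * qr q * (J.beta0 a * J.gam0 b)" for a b
    using qdomD(3,5)[OF q] by (simp add: tau0_def sig0_def field_simps power2_eq_square)
  have 2: "sigv q b \<bullet> tauv q a = 2 * qr q * Kc c (qx q) (J.beta a) (J.gam b)" for a b
    using qdomD(3,5)[OF q] by (simp add: tauv_def sigv_def Klow_inner Kc_commute[of c _ "J.gam b"] field_simps power2_eq_square)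
  have "e_zeta q u \<bullet> e_zetat q z - e_zetat q u \<bullet> e_zeta q z = tau0 q u * sig0 q z - tau0 q z * sig0 q u + sigv q z \<bullet> tauv q u - sigv q u \<bullet> tauv q z"
    by (simp add: e_zeta_def e_zetat_def cons_vec_inner e_zetat0_def e_zetatv_def inner_add_left inner_add_right inner_diff_left inner_diff_right polar_inner
        inner_commute[of _ "polar_low _ _ _"] inner_commute[of _ "sigv _ _"]
        polar_commute23[of c _ "tauv _ _" "qy q"] polar_commute12[of c "tauv _ _" "qy q"] polar_commute12[of c "snd _" "qy q"] polar_commute23[of c _ "snd _" "qy q"] polar_commute23[of c _ "tauv q z" "tauv q u"] algebra_simps)
  then show ?thesis unfolding 1 2 by (simp add: algebra_simps)
qed

text \<open>The vanishing of the torsion of \<open>conn\<close>, from the structure equations of its components.\<close>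
lemma torsion_qframe: "Dqframe q (qframe q u) z - Dqframe q (qframe q z) u = qframe q bracket"
proof -
  have "De_phi q (qframe q u) z - De_phi q (qframe q z) u = e_phi q bracket"
  proof -
    have "De_phi q (qframe q u) z - De_phi q (qframe q z) u = 2 * qr q * (2 * (fst (fst u) * fst (fst (snd z)) - fst (fst z) * fst (fst (snd u))))
      - 2 * (e_zeta q u \<bullet> e_zetat q z - e_zetat q u \<bullet> e_zeta q z) - (qz q \<bullet> (De_zetat q (qframe q u) z - De_zetat q (qframe q z) u) - qzt q \<bullet> (De_zeta q (qframe q u) z - De_zeta q (qframe q z) u))"
      unfolding De_phi_def qframe_proj by (simp add: inner_diff_right inner_commute algebra_simps)
    also have "De_zetat q (qframe q u) z - De_zetat q (qframe q z) u = e_zetat q bracket"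
      by (simp add: De_zetat_def e_zetat_def cons_vec_lin torsion_e_zetat0 torsion_e_zetatv)
    also have "De_zeta q (qframe q u) z - De_zeta q (qframe q z) u = e_zeta q bracket" by (rule torsion_e_zeta)
    also have "2 * qr q * (2 * (fst (fst u) * fst (fst (snd z)) - fst (fst z) * fst (fst (snd u)))) - 2 * (e_zeta q u \<bullet> e_zetat q z - e_zetat q u \<bullet> e_zeta q z)
       = 2 * qr q * (- fst (fst (snd bracket)))"
      unfolding e_zeta_pairing J.torsion_eta[symmetric] by (simp add: algebra_simps)
    finally show ?thesis by (simp add: e_phi_def algebra_simps)
  qed
  moreover have "De_zetat q (qframe q u) z - De_zetat q (qframe q z) u = e_zetat q bracket"
    by (simp add: De_zetat_def e_zetat_def cons_vec_lin torsion_e_zetat0 torsion_e_zetatv)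
  moreover have "cvec 0 0 = 0" by (simp add: cvec_def vec_eq_iff complex_eq_iff)
  ultimately show ?thesis
    by (simp only: Dqframe_def qframe_def[of q bracket] diff_Pair torsion_e_zeta J.torsion_base qframe_proj)  simp
qed

end
end
end

section \<open>Differentiability of the frame\<close>

lemma has_derivative_cons_vec:
  fixes g :: "'q::real_normed_vector \<Rightarrow> real ^ 'n::finite"
  assumes "(f has_derivative f') (at q)" "(g has_derivative g') (at q)"
  shows "((\<lambda>q. cons_vec (f q) (g q)) has_derivative (\<lambda>v. cons_vec (f' v) (g' v))) (at q)"
  using bounded_linear.has_derivative[OF bounded_linear_cons_vec has_derivative_Pair[OF assms]] by simp

lemma has_derivative_polar_low:
  fixes f g :: "'q::real_normed_vector \<Rightarrow> real ^ 'n::finite"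
  assumes "(f has_derivative f') (at q)" "(g has_derivative g') (at q)"
  shows "((\<lambda>q. polar_low c (f q) (g q)) has_derivative (\<lambda>v. polar_low c (f q) (g' v) + polar_low c (f' v) (g q))) (at q)"
  using bounded_bilinear.FDERIV[OF bounded_bilinear_polar_low assms] .

context fixes c :: "'n::finite \<Rightarrow> 'n \<Rightarrow> 'n \<Rightarrow> real" begin

context fixes q :: "'n q_space" assumes q: "q \<in> qdom c" begin

lemmas d_linear = bounded_linear_imp_has_derivative[OF bl_qx, of "at q"] bounded_linear_imp_has_derivative[OF bl_qy, of "at q"]
  bounded_linear_imp_has_derivative[OF bl_qr, of "at q"] bounded_linear_imp_has_derivative[OF bl_qz, of "at q"] bounded_linear_imp_has_derivative[OF bl_qzt, of "at q"]

lemma D_qx: "(F has_derivative D) (at (qx q)) \<Longrightarrow> ((\<lambda>q. F (qx q)) has_derivative (\<lambda>v. D (qx v))) (at q)"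
  by (rule has_derivative_compose[OF d_linear(1)])

lemmas x_regular = qdomD(1)[OF q]

lemma D_beta0: "((\<lambda>q. beta0_at c (qx q) z) has_derivative (\<lambda>v. dbeta0_at c (qx q) (qx v) z)) (at q)"
  apply (rule D_qx, rule has_derivative_on_regular[OF x_regular])
   apply (simp only: cubic_jet.beta0_def[OF cubic_jet])
  apply (rule has_derivative_eq_rhs, (rule has_derivative_add has_derivative_const D_xi[OF x_regular])+)
  apply (simp add: fun_eq_iff cubic_jet.dbeta0_def[OF cubic_jet[OF x_regular]])
  done

lemma D_gam0: "((\<lambda>q. gam0_at c (qx q) z) has_derivative (\<lambda>v. dgam0_at c (qx q) (qx v) z)) (at q)"
  apply (rule D_qx, rule has_derivative_on_regular[OF x_regular])
   apply (simp only: cubic_jet.gam0_def[OF cubic_jet])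
  apply (rule has_derivative_eq_rhs, (rule has_derivative_diff has_derivative_const D_xi[OF x_regular])+)
  apply (simp add: fun_eq_iff cubic_jet.dgam0_def[OF cubic_jet[OF x_regular]])
  done

lemma D_beta: "((\<lambda>q. beta_at c (qx q) z) has_derivative (\<lambda>v. dbeta_at c (qx q) (qx v) z)) (at q)"
  apply (rule D_qx, rule has_derivative_on_regular[OF x_regular])
   apply (simp only: cubic_jet.beta_def[OF cubic_jet])
  apply (rule has_derivative_eq_rhs, (rule has_derivative_diff has_derivative_add has_derivative_scaleR has_derivative_mult has_derivative_const has_derivative_ident D_xi[OF x_regular])+)
  apply (simp add: fun_eq_iff cubic_jet.dbeta_def[OF cubic_jet[OF x_regular]])
  done

lemma D_gam: "((\<lambda>q. gam_at c (qx q) z) has_derivative (\<lambda>v. dgam_at c (qx q) (qx v) z)) (at q)"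
  apply (rule D_qx, rule has_derivative_on_regular[OF x_regular])
   apply (simp only: cubic_jet.gam_def[OF cubic_jet])
  apply (rule has_derivative_eq_rhs, (rule has_derivative_add has_derivative_diff has_derivative_scaleR has_derivative_mult has_derivative_const has_derivative_ident D_xi[OF x_regular])+)
  apply (simp add: fun_eq_iff cubic_jet.dgam_def[OF cubic_jet[OF x_regular]])
  done

text \<open>The derivative of \<open>h\<close> is \<open>4h xi\<close>.\<close>
lemma D_radius: "(radius c has_derivative (\<lambda>v. radius c q * (half_dlog q v + 2 * xi_at c (qx q) (qx v)))) (at q)"
proof -
  have p: "2 * qr q * cubic c (qx q) > 0" using qdomD[OF q] by simp
  have "((\<lambda>q. 2 * qr q * cubic c (qx q)) has_derivative (\<lambda>v. 2 * qr q * (4 * xi_at c (qx q) (qx v) * cubic c (qx q)) + 2 * qr v * cubic c (qx q))) (at q)"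
    by (rule has_derivative_eq_rhs, (rule has_derivative_mult has_derivative_const d_linear(3) D_qx D_cubic[OF x_regular])+) (simp add: fun_eq_iff)
  from DERIV_compose_FDERIV[where f = sqrt and g = "\<lambda>q. 2 * qr q * cubic c (qx q)", OF DERIV_real_sqrt[OF p] this]
  show ?thesis
    unfolding radius_def[abs_def]
    by (rule has_derivative_eq_rhs)
       (use qdomD[OF q] real_sqrt_mult_self[of "2 * qr q * cubic c (qx q)"] in \<open>auto simp: fun_eq_iff half_dlog_def field_simps simp del: real_sqrt_mult_self\<close>)
qed

lemma D_inverse_cubic: "((\<lambda>q. inverse (cubic c (qx q))) has_derivative (\<lambda>v. - 4 * xi_at c (qx q) (qx v) * inverse (cubic c (qx q)))) (at q)"
  by (rule has_derivative_eq_rhs[OF Deriv.has_derivative_inverse[OF _ D_qx[OF D_cubic[OF x_regular]]]])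
     (use qdomD[OF q] in \<open>auto simp: fun_eq_iff\<close>)

lemma D_tau0: "((\<lambda>q. tau0 c q z) has_derivative (\<lambda>v. Dtau0 c q v z)) (at q)"
  unfolding tau0_def
  by (rule has_derivative_eq_rhs, (rule has_derivative_mult D_radius D_inverse_cubic D_beta0)+)
     (simp add: fun_eq_iff Dtau0_def algebra_simps)

lemma D_tauv: "((\<lambda>q. tauv c q z) has_derivative (\<lambda>v. Dtauv c q v z)) (at q)"
  unfolding tauv_def divide_inverse
  by (rule has_derivative_eq_rhs, (rule has_derivative_scaleR has_derivative_mult has_derivative_const D_radius D_inverse_cubic D_beta)+)
     (simp add: fun_eq_iff Dtauv_def algebra_simps)

lemma D_sig0: "((\<lambda>q. sig0 c q z) has_derivative (\<lambda>v. Dsig0 c q v z)) (at q)"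
  unfolding sig0_def
  by (rule has_derivative_eq_rhs, (rule has_derivative_mult D_radius D_gam0)+)
     (simp add: fun_eq_iff Dsig0_def algebra_simps)

lemma D_Klow_gam: "((\<lambda>q. Klow c (qx q) (gam_at c (qx q) z)) has_derivative
   (\<lambda>v. Klow c (qx q) (2 *\<^sub>R chris_at c (qx q) (qx v) (gam_at c (qx q) z) + dgam_at c (qx q) (qx v) z))) (at q)"
  by (rule has_derivative_eq_rhs[OF has_derivative_linear_family[OF open_qdom q Klow_linear D_qx[OF D_Klow[OF x_regular]] D_gam]])
     (simp add: fun_eq_iff Klow_lin[OF q])

lemma D_sigv: "((\<lambda>q. sigv c q z) has_derivative (\<lambda>v. Dsigv c q v z)) (at q)"
  unfolding sigv_def
  by (rule has_derivative_eq_rhs, (rule has_derivative_scaleR has_derivative_mult has_derivative_const D_radius D_Klow_gam)+)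
     (simp add: fun_eq_iff Dsigv_def Klow_lin[OF q] algebra_simps)

lemma D_e_zeta: "((\<lambda>q. e_zeta c q z) has_derivative (\<lambda>v. De_zeta c q v z)) (at q)"
  unfolding e_zeta_def
  by (rule has_derivative_eq_rhs, (rule has_derivative_cons_vec has_derivative_add has_derivative_scaleR D_tau0 D_tauv d_linear)+)
     (simp add: fun_eq_iff De_zeta_def algebra_simps)

lemma D_e_zetat0: "((\<lambda>q. e_zetat0 c q z) has_derivative (\<lambda>v. De_zetat0 c q v z)) (at q)"
  unfolding e_zetat0_def divide_inverse polar_inner
  apply (rule has_derivative_eq_rhs, (rule has_derivative_add has_derivative_diff has_derivative_inner has_derivative_mult has_derivative_const has_derivative_polar
         D_sig0 D_sigv D_tau0 D_tauv d_linear)+)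
  apply (rule ext)
  subgoal for v
    using polar_commute12[of c "qy v" "qy q" "tauv c q z"] polar_commute12[of c "qy v" "qy q" "qy q"] polar_commute23[of c "qy q" "qy v" "qy q"]
    by (simp add: De_zetat0_def field_simps)
  done

lemma D_e_zetatv: "((\<lambda>q. e_zetatv c q z) has_derivative (\<lambda>v. De_zetatv c q v z)) (at q)"
  unfolding e_zetatv_def divide_inverse
  apply (rule has_derivative_eq_rhs, (rule has_derivative_diff has_derivative_scaleR has_derivative_mult has_derivative_const has_derivative_polar_low
         D_sigv D_tau0 D_tauv d_linear)+)
  apply (rule ext)
  subgoal for v
    using polar_low_commute[of c "qy v" "qy q"] by (simp add: De_zetatv_def algebra_simps flip: scaleR_2)
  done

lemma D_e_zetat: "((\<lambda>q. e_zetat c q z) has_derivative (\<lambda>v. De_zetat c q v z)) (at q)"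
  unfolding e_zetat_def De_zetat_def by (rule has_derivative_cons_vec D_e_zetat0 D_e_zetatv)+

lemma D_e_phi: "((\<lambda>q. e_phi c q z) has_derivative (\<lambda>v. De_phi c q v z)) (at q)"
  unfolding e_phi_def
  by (rule has_derivative_eq_rhs, (rule has_derivative_diff has_derivative_mult has_derivative_inner has_derivative_const D_e_zeta D_e_zetat d_linear)+)
     (simp add: fun_eq_iff De_phi_def algebra_simps)

lemma D_qframe: "((\<lambda>q. qframe c q z) has_derivative (\<lambda>v. Dqframe c q v z)) (at q)"
  unfolding qframe_def
  by (rule has_derivative_eq_rhs, (rule has_derivative_Pair has_derivative_mult has_derivative_const D_e_zeta D_e_zetat D_e_phi d_linear)+)
     (simp add: fun_eq_iff Dqframe_def algebra_simps)

end

context fixes p :: "'n q_space" assumes p: "p \<in> qdom c" begin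

lemma td_diff: assumes "twice_diff p f" "twice_diff p g" shows "twice_diff p (\<lambda>q. f q - g q)"
  using twice_diff_add[OF assms(1) twice_diff_linear_compose[OF bounded_linear_minus[OF bounded_linear_ident] assms(2)]] by simp

lemma td_cons_vec:
  fixes g :: "_ \<Rightarrow> real ^ 'm::finite"
  assumes "twice_diff p f" "twice_diff p g" shows "twice_diff p (\<lambda>q. cons_vec (f q) (g q))"
proof -
  have 1: "bounded_linear (\<lambda>a. cons_vec a (0 :: real ^ 'm))" "bounded_linear (\<lambda>v. cons_vec 0 (v :: real ^ 'm))"
    by (rule linear_conv_bounded_linear[THEN iffD1], rule linearI; simp add: cons_vec_lin)+
  show ?thesis
    using twice_diff_add[OF twice_diff_linear_compose[OF 1(1) assms(1)] twice_diff_linear_compose[OF 1(2) assms(2)]] by (simp add: cons_vec_lin)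
qed

lemma td_Pair: assumes "twice_diff p f" "twice_diff p g" shows "twice_diff p (\<lambda>q. (f q, g q))"
  using twice_diff_add[OF
     twice_diff_linear_compose[OF bounded_linear_Pair[OF bounded_linear_ident bounded_linear_zero] assms(1)]
     twice_diff_linear_compose[OF bounded_linear_Pair[OF bounded_linear_zero bounded_linear_ident] assms(2)]] by simp

lemmas td_rules = twice_diff_const twice_diff_add td_diff td_cons_vec td_Pair
  twice_diff_linear_compose[OF bounded_linear_divide]
  twice_diff_bilinear[OF bounded_bilinear_polar_low] twice_diff_bilinear[OF bounded_bilinear_inner]
  twice_diff_bilinear[OF bounded_bilinear_mult] twice_diff_bilinear[OF bounded_bilinear_scaleR]
  twice_diff_bounded_linear[OF bl_qx] twice_diff_bounded_linear[OF bl_qy] twice_diff_bounded_linear[OF bl_qr]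
  twice_diff_bounded_linear[OF bl_qz] twice_diff_bounded_linear[OF bl_qzt]

lemma td_cubic: "twice_diff p (\<lambda>q. cubic c (qx q))"
  unfolding cubic_polar polar_inner[symmetric] by (rule td_rules)+

lemma td_inverse_cubic: "twice_diff p (\<lambda>q. inverse (cubic c (qx q)))"
  by (rule twice_diff_inverse[OF td_cubic]) (use qdomD[OF p] in simp)

lemma td_radius: "twice_diff p (radius c)"
  unfolding radius_def[abs_def]
  by (rule twice_diff_sqrt, (rule td_rules td_cubic)+) (use qdomD[OF p] in simp)

lemma td_xi: "twice_diff p (\<lambda>q. xi_at c (qx q) u)"
proof (rule twice_diff_transform[OF _ open_qdom p])
  show "twice_diff p (\<lambda>q. (polar_low c (qx q) (qx q) \<bullet> u) / 8 * inverse (cubic c (qx q)))"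
    by (rule td_rules td_inverse_cubic)+
  show "xi_at c (qx q) u = (polar_low c (qx q) (qx q) \<bullet> u) / 8 * inverse (cubic c (qx q))" if "q \<in> qdom c" for q
    by (simp add: xi_polar qdomD(1)[OF that] polar_inner inverse_eq_divide)
qed

lemma td_beta0: "twice_diff p (\<lambda>q. beta0_at c (qx q) z)"
  apply (rule twice_diff_transform[OF _ open_qdom p])
   prefer 2 apply (rule cubic_jet.beta0_def[OF cubic_jet], erule qdomD(1))
  apply (rule td_rules td_xi)+
  done

lemma td_gam0: "twice_diff p (\<lambda>q. gam0_at c (qx q) z)"
  apply (rule twice_diff_transform[OF _ open_qdom p])
   prefer 2 apply (rule cubic_jet.gam0_def[OF cubic_jet], erule qdomD(1))
  apply (rule td_rules td_xi)+
  done

lemma td_beta: "twice_diff p (\<lambda>q. beta_at c (qx q) z)"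
  apply (rule twice_diff_transform[OF _ open_qdom p])
   prefer 2 apply (rule cubic_jet.beta_def[OF cubic_jet], erule qdomD(1))
  apply (rule td_rules td_xi)+
  done

lemma td_gam: "twice_diff p (\<lambda>q. gam_at c (qx q) z)"
  apply (rule twice_diff_transform[OF _ open_qdom p])
   prefer 2 apply (rule cubic_jet.gam_def[OF cubic_jet], erule qdomD(1))
  apply (rule td_rules td_xi)+
  done

lemma td_Klow: assumes "twice_diff p f" shows "twice_diff p (\<lambda>q. Klow c (qx q) (f q))"
proof -
  have "Klow c x u = (1 / 4) *\<^sub>R (((polar_low c x x \<bullet> u) / 4 * (inverse (cubic c x) * inverse (cubic c x))) *\<^sub>R polar_low c x x - inverse (cubic c x) *\<^sub>R polar_low c x u)" for x u
    by (simp add: Klow_def polar_inner power2_eq_square inverse_eq_divide)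
  then show ?thesis by (simp only:) (rule td_rules td_inverse_cubic assms)+
qed

lemma td_components: "twice_diff p (\<lambda>q. tau0 c q z)" "twice_diff p (\<lambda>q. tauv c q z)" "twice_diff p (\<lambda>q. sig0 c q z)" "twice_diff p (\<lambda>q. sigv c q z)"
  unfolding tau0_def tauv_def sig0_def sigv_def
  by (rule td_rules td_inverse_cubic td_radius td_beta0 td_beta td_gam0 td_gam td_Klow)+

lemma td_e_zeta: "twice_diff p (\<lambda>q. e_zeta c q z)" and td_e_zetat: "twice_diff p (\<lambda>q. e_zetat c q z)"
  unfolding e_zeta_def e_zetat_def e_zetat0_def e_zetatv_def by (rule td_rules td_components)+

lemma td_qframe: "twice_diff p (\<lambda>q. qframe c q z)"
  unfolding qframe_def e_phi_def by (rule td_rules td_e_zeta td_e_zetat)+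

text \<open>The closure rules for \<open>twice_diff\<close> apply to each component of the frame.\<close>
lemma second_derivative_qframe:
  "\<exists>D2. \<forall>u. (\<forall>v. ((\<lambda>q. Dqframe c q v u) has_derivative (\<lambda>w. D2 w v u)) (at p)) \<and> (\<forall>v w. D2 v w u = D2 w v u)"
proof -
  have "\<forall>u. \<exists>D. (\<forall>v. ((\<lambda>q. Dqframe c q v u) has_derivative (\<lambda>w. D w v)) (at p)) \<and> (\<forall>v w. D v w = D w v)"
    using twice_diff_second_derivative[OF td_qframe open_qdom p D_qframe] by simp
  from choice[OF this] obtain D where "\<forall>u. (\<forall>v. ((\<lambda>q. Dqframe c q v u) has_derivative (\<lambda>w. D u w v)) (at p)) \<and> (\<forall>v w. D u v w = D u w v)" by blast
  then show ?thesis by (intro exI[of _ "\<lambda>w v u. D u w v"])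
qed

end
end

section \<open>The q-map metric in the frame\<close>

context fixes c :: "'n::finite \<Rightarrow> 'n \<Rightarrow> 'n \<Rightarrow> real" begin

text \<open>The contact form \<open>d\<phi>t + \<zeta>d\<zeta>t - \<zeta>td\<zeta>\<close>.\<close>
definition eta_form :: "'n q_space \<Rightarrow> 'n q_space \<Rightarrow> real" where
  "eta_form q u = fst (snd (snd u)) + qz q \<bullet> qzt u - qzt q \<bullet> qz u"

text \<open>The one-forms \<open>d\<zeta>t + \<R> d\<zeta>\<close>.\<close>
definition theta_form :: "'n q_space \<Rightarrow> 'n q_space \<Rightarrow> real ^ ('n option)" where
  "theta_form q u = qzt u + period_re c (fst q) *v qz u"

lemma sum_form_prod:
  fixes M :: "real ^ ('m::finite) ^ 'm"
  shows "(\<Sum>A\<in>UNIV. \<Sum>B\<in>UNIV. M $ A $ B * form_prod (\<lambda>u. \<alpha> u $ A) (\<lambda>u. \<alpha> u $ B) v w) = (\<alpha> v \<bullet> (M *v \<alpha> w) + \<alpha> w \<bullet> (M *v \<alpha> v)) / 2"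
  unfolding inner_vec_def matrix_vector_mult_def form_prod_def
  by (simp add: sum_distrib_left sum_divide_distrib add_divide_distrib distrib_left sum.distrib mult_ac)

lemma q_metric_expand:
  "q_metric c q v w = r_metric c (fst q) (fst v) (fst w) + (qr v * qr w) / (4 * (qr q)\<^sup>2) + (eta_form q v * eta_form q w) / (4 * (qr q)\<^sup>2)
    + (qz v \<bullet> (period_im c (fst q) *v qz w) + qz w \<bullet> (period_im c (fst q) *v qz v)) / (4 * qr q)
    + (theta_form q v \<bullet> (matrix_inv (period_im c (fst q)) *v theta_form q w) + theta_form q w \<bullet> (matrix_inv (period_im c (fst q)) *v theta_form q v)) / (4 * qr q)"
proof -
  obtain X r ph zt z where q: "q = (X, r, ph, zt, z)" by (metis prod.exhaust)
  have th: "d\<zeta>t A u + (\<Sum>K\<in>UNIV. period_re c X $ A $ K * d\<zeta> K u) = theta_form q u $ A" for A u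
    by (simp add: q theta_form_def d\<zeta>t_def d\<zeta>_def case_prod_unfold matrix_vector_mult_def)
  have et: "d\<phi> u + (\<Sum>A\<in>UNIV. z $ A * d\<zeta>t A u - zt $ A * d\<zeta> A u) = eta_form q u" for u
    by (simp add: q eta_form_def d\<zeta>t_def d\<zeta>_def d\<phi>_def case_prod_unfold inner_vec_def sum_subtractf)
  have zz: "d\<zeta> A = (\<lambda>u. qz u $ A)" for A by (simp add: d\<zeta>_def case_prod_unfold)
  have r: "form_prod d\<rho> d\<rho> v w = qr v * qr w" "form_prod (eta_form q) (eta_form q) v w = eta_form q v * eta_form q w"
    by (simp_all add: form_prod_def d\<rho>_def case_prod_unfold)
  have X: "dX v = fst v" for v by (simp add: dX_def case_prod_unfold)
  show ?thesis
    unfolding q_metric_def q case_prod_conv Let_def th[unfolded q] et[unfolded q] r[unfolded q] X sum_form_prod fst_conv snd_conv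
    unfolding zz sum_form_prod by (simp add: field_simps)
qed

lemma cons_tail_vec: "cons_vec (b $ None) (tail_vec b) = b"
  by (simp add: vec_eq_iff cons_vec_def tail_vec_def split: option.split)

lemma Kc_axis: "Kc c x u (axis \<nu> 1) = Klow c x u $ \<nu>"
  unfolding Klow_inner[symmetric] by (simp add: inner_axis)

lemma Kc_axis_sum: "(\<Sum>\<nu>\<in>UNIV. Kc c x u (axis \<nu> 1) * v $ \<nu>) = Kc c x u v"
  by (simp add: Kc_axis) (simp add: Klow_inner[symmetric] inner_vec_def)

lemma polar_axis: "polar c u v (axis \<nu> 1) = polar_low c u v $ \<nu>" for u v :: "real ^ 'n"
  unfolding polar_inner[symmetric] by (simp add: inner_axis)

context fixes q :: "'n q_space" assumes q: "q \<in> qdom c" begin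

interpretation J: cubic_jet "Kc c (qx q)" "mc c (qx q)" "qx q" by (rule cubic_jet[OF qdomD(1)[OF q]])

abbreviation (input) "hq \<equiv> cubic c (qx q)"

lemma period_im_mult:
  "period_im c (fst q) *v b = cons_vec (hq * b $ None - 4 * hq * Kc c (qx q) (qy q) (tail_vec b - b $ None *\<^sub>R qy q))
     ((4 * hq) *\<^sub>R Klow c (qx q) (tail_vec b - b $ None *\<^sub>R qy q))"
proof -
  note P = period_matrix_eq[OF qdomD(3)[OF q]]
  have "(period_im c (fst q) *v b) $ None = (hq + 4 * hq * Kc c (qx q) (qy q) (qy q)) * b $ None + (\<Sum>\<nu>\<in>UNIV. (- 4 * hq * Kc c (qx q) (qy q) (axis \<nu> 1)) * b $ Some \<nu>)"
    by (simp add: matrix_vector_mult_def sum_option P)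
  also have "(\<Sum>\<nu>\<in>UNIV. (- 4 * hq * Kc c (qx q) (qy q) (axis \<nu> 1)) * b $ Some \<nu>) = - 4 * hq * Kc c (qx q) (qy q) (tail_vec b)"
    unfolding Kc_axis_sum[of "qx q" "qy q" "tail_vec b", symmetric] sum_distrib_left by (intro sum.cong refl) simp
  finally have n: "(period_im c (fst q) *v b) $ None = hq * b $ None - 4 * hq * Kc c (qx q) (qy q) (tail_vec b - b $ None *\<^sub>R qy q)"
    by (simp add: J.K_lin algebra_simps)
  have s: "(period_im c (fst q) *v b) $ Some \<mu> = ((4 * hq) *\<^sub>R Klow c (qx q) (tail_vec b - b $ None *\<^sub>R qy q)) $ \<mu>" for \<mu>
  proof -
    have "(period_im c (fst q) *v b) $ Some \<mu> = - 4 * hq * Kc c (qx q) (qy q) (axis \<mu> 1) * b $ None + (\<Sum>\<nu>\<in>UNIV. (4 * hq * Kc c (qx q) (axis \<mu> 1) (axis \<nu> 1)) * b $ Some \<nu>)"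
      by (simp add: matrix_vector_mult_def sum_option P)
    also have "(\<Sum>\<nu>\<in>UNIV. (4 * hq * Kc c (qx q) (axis \<mu> 1) (axis \<nu> 1)) * b $ Some \<nu>) = 4 * hq * Kc c (qx q) (tail_vec b) (axis \<mu> 1)"
      unfolding Kc_commute[of c "qx q" "tail_vec b" "axis \<mu> 1"] Kc_axis_sum[of "qx q" "axis \<mu> 1" "tail_vec b", symmetric] sum_distrib_left
      by (intro sum.cong refl) simp
    finally show ?thesis by (simp add: Kc_axis Klow_lin[OF q] algebra_simps)
  qed
  show ?thesis by (simp add: vec_eq_iff cons_vec_def n s split: option.split)
qed

text \<open>After the shift by \<open>y\<close> the matrix \<open>\<I>\<close> is the orthogonal sum of \<open>h\<close> and \<open>4hK\<close>.\<close>
lemma period_im_pairing: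
  "cons_vec a (u + a *\<^sub>R qy q) \<bullet> (period_im c (fst q) *v cons_vec b (v + b *\<^sub>R qy q)) = hq * (a * b) + 4 * hq * Kc c (qx q) u v"
  by (simp add: period_im_mult cons_vec_inner inner_commute[of _ "Klow _ _ _"] Klow_inner J.K_lin Kc_commute[of c _ "qy q" v] Kc_commute[of c _ v u] algebra_simps)

lemma period_im_inverse: "matrix_inv (period_im c (fst q)) *v (period_im c (fst q) *v w) = w"
proof -
  have "b = 0" if "period_im c (fst q) *v b = 0" for b
  proof -
    have "(4 * hq) *\<^sub>R Klow c (qx q) (tail_vec b - b $ None *\<^sub>R qy q) = 0"
      using arg_cong[OF that[unfolded period_im_mult], of tail_vec] by (simp add: vec_eq_iff)
    then have "Klow c (qx q) (tail_vec b - b $ None *\<^sub>R qy q) = 0" using qdomD(3)[OF q] by simp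
    then have "Kc c (qx q) (tail_vec b - b $ None *\<^sub>R qy q) w = 0" for w by (simp flip: Klow_inner)
    then have v: "tail_vec b - b $ None *\<^sub>R qy q = 0" by (rule Kc_nondeg[OF qdomD(1)[OF q]])
    have "b $ None = 0"
      using arg_cong[OF that[unfolded period_im_mult v], of "\<lambda>z. z $ None"] qdomD(3)[OF q] by (simp add: J.K_lin)
    with v have "b = cons_vec 0 0" using cons_tail_vec[of b] by simp
    then show "b = 0" by (simp add: vec_eq_iff cons_vec_def split: option.split)
  qed
  then have "inj ((*v) (period_im c (fst q)))" by (simp add: linear_injective_0)
  then obtain B where B: "B ** period_im c (fst q) = mat 1" using matrix_left_invertible_injective by blast
  have "matrix_inv (period_im c (fst q)) = B" by (rule matrix_inv_eqI[OF matrix_left_right_inverse[THEN iffD1, OF B]])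
  then show ?thesis by (simp add: matrix_vector_mul_assoc B)
qed

text \<open>The solution \<open>\<omega>\<close> of \<open>\<I> \<omega> = \<theta>\<close> for the value \<open>\<theta>\<close> of \<open>theta_form\<close> on the frame. With it, the summand with \<open>\<I>\<^sup>-\<^sup>1\<close> is computed
  without inverting the matrix.\<close>
definition theta_dual :: "(real \<times> (real ^ 'n)) quad \<Rightarrow> real ^ ('n option)" where
  "theta_dual u = cons_vec (radius c q * J.gam0 u / hq) ((radius c q / (2 * hq)) *\<^sub>R J.gam u + (radius c q * J.gam0 u / hq) *\<^sub>R qy q)"

lemma theta_form_qframe: "theta_form q (qframe c q u) = period_im c (fst q) *v theta_dual u"
proof -
  note P = period_matrix_eq[OF qdomD(3)[OF q]]
  have pv: "(\<Sum>\<nu>\<in>UNIV. polar c u v (axis \<nu> 1) * b $ Some \<nu>) = polar c u v (tail_vec b)" for u v :: "real ^ 'n" and b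
    using polar_axis_sum[of c u v "tail_vec b"] by simp
  have R0: "(period_re c (fst q) *v b) $ None = 2 * cubic c (qy q) * b $ None - polar c (qy q) (qy q) (tail_vec b) / 2" for b
    by (simp add: matrix_vector_mult_def sum_option P sum_negf sum_divide_distrib pv[of "qy q" "qy q" b, symmetric])
  have Rs: "(period_re c (fst q) *v b) $ Some \<mu> = - polar_low c (qy q) (qy q) $ \<mu> / 2 * b $ None + polar_low c (qy q) (tail_vec b) $ \<mu>" for b \<mu>
    by (simp add: matrix_vector_mult_def sum_option P polar_axis[symmetric] pv polar_commute23[of c "qy q" "axis \<mu> 1" "tail_vec b"])
  have "theta_form q (qframe c q u) = cons_vec (sig0 c q u - qy q \<bullet> sigv c q u) (sigv c q u)"
    by (simp add: vec_eq_iff theta_form_def qframe_proj R0 Rs cons_vec_def[of "_ - _"] split: option.split)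
       (simp add: e_zetat_def e_zeta_def e_zetat0_def e_zetatv_def polar_lin polar_scaleR polar_low_lin polar_inner cubic_polar algebra_simps)
  also have "\<dots> = period_im c (fst q) *v theta_dual u"
    using qdomD[OF q]
    by (simp add: period_im_mult theta_dual_def sig0_def sigv_def Klow_lin[OF q] J.K_lin inner_commute[of "qy q" "Klow _ _ _"] Klow_inner Kc_commute[of c _ "qy q" "J.gam u"] field_simps)
  finally show ?thesis .
qed

lemma eta_form_qframe: "eta_form q (qframe c q u) = - 2 * qr q * fst (fst (snd u))"
  by (simp add: eta_form_def qframe_def e_phi_def)

text \<open>The summands with \<open>d\<zeta>\<close> and with \<open>\<theta>\<close> have the form \<open>2\<rho>\<close> times the norms of \<open>(beta0, beta)\<close> and
  \<open>(gam0, gam)\<close>, and \<open>frame_form_dual\<close> assembles them.\<close>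
lemma q_metric_qframe: "q_metric c q (qframe c q u) (qframe c q z) = J.frame_form u z"
proof -
  have h: "hq > 0" "qr q > 0" "radius c q * radius c q = 2 * qr q * hq" using qdomD[OF q] by (simp_all add: power2_eq_square)
  have rr: "radius c q * (radius c q * w) = 2 * (qr q * (hq * w))" for w using h(3) by (simp add: mult.assoc[symmetric])
  have r: "r_metric c (fst q) (fst (qframe c q u)) (fst (qframe c q z)) = Kc c (qx q) (snd (fst u)) (snd (fst z)) + Kc c (qx q) (snd (fst (snd u))) (snd (fst (snd z)))"
    using qdomD(1)[OF q] by (simp add: r_metric_eq qframe_proj)
  have z: "e_zeta c q a \<bullet> (period_im c (fst q) *v e_zeta c q b) = 2 * qr q * (J.beta0 a * J.beta0 b + Kc c (qx q) (J.beta a) (J.beta b))" for a b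
    unfolding e_zeta_def period_im_pairing tau0_def tauv_def using h(1) by (simp add: J.K_lin rr field_simps)
  have s: "(period_im c (fst q) *v theta_dual a) \<bullet> theta_dual b = 2 * qr q * (J.gam0 a * J.gam0 b + Kc c (qx q) (J.gam a) (J.gam b))" for a b
    unfolding theta_dual_def inner_commute[of "period_im _ _ *v _"] period_im_pairing using h(1) by (simp add: J.K_lin rr Kc_commute[of c _ "J.gam b" "J.gam a"] field_simps)
  show ?thesis
    unfolding q_metric_expand r qframe_proj eta_form_qframe z theta_form_qframe period_im_inverse s J.frame_form_dual
    using h by (simp add: Kc_commute[of c _ "J.gam z" "J.gam u"] Kc_commute[of c _ "J.beta z" "J.beta u"] field_simps power2_eq_square)
qed

lemma linear_qframe: "linear (qframe c q)"
proof -
  have l: "J.beta0 (u + v) = J.beta0 u + J.beta0 v" "J.beta0 (r *\<^sub>R u) = r * J.beta0 u" "J.gam0 (u + v) = J.gam0 u + J.gam0 v" "J.gam0 (r *\<^sub>R u) = r * J.gam0 u"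
     "J.beta (u + v) = J.beta u + J.beta v" "J.beta (r *\<^sub>R u) = r *\<^sub>R J.beta u" "J.gam (u + v) = J.gam u + J.gam v" "J.gam (r *\<^sub>R u) = r *\<^sub>R J.gam u" for u v r
    by (simp_all add: J.beta0_def J.gam0_def J.beta_def J.gam_def J.xi_lin algebra_simps)
  have l2: "tau0 c q (u + v) = tau0 c q u + tau0 c q v" "tau0 c q (r *\<^sub>R u) = r * tau0 c q u"
     "sig0 c q (u + v) = sig0 c q u + sig0 c q v" "sig0 c q (r *\<^sub>R u) = r * sig0 c q u"
     "tauv c q (u + v) = tauv c q u + tauv c q v" "tauv c q (r *\<^sub>R u) = r *\<^sub>R tauv c q u"
     "sigv c q (u + v) = sigv c q u + sigv c q v" "sigv c q (r *\<^sub>R u) = r *\<^sub>R sigv c q u" for u v r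
    by (simp_all add: tau0_def tauv_def sig0_def sigv_def l Klow_lin[OF q] algebra_simps)
  have l3: "e_zeta c q (u + v) = e_zeta c q u + e_zeta c q v" "e_zeta c q (r *\<^sub>R u) = r *\<^sub>R e_zeta c q u"
    "e_zetat c q (u + v) = e_zetat c q u + e_zetat c q v" "e_zetat c q (r *\<^sub>R u) = r *\<^sub>R e_zetat c q u" for u v r
    by (simp_all add: e_zeta_def e_zetat_def e_zetat0_def e_zetatv_def l2 cons_vec_lin polar_low_lin inner_add_right add_divide_distrib algebra_simps)
  show ?thesis
    by (rule linearI) (simp_all add: qframe_def e_phi_def l3 inner_add_right cvec_def vec_eq_iff complex_eq_iff algebra_simps)
qed

text \<open>Injectivity follows from the nondegeneracy of the frame metric, and both spaces have dimension \<open>4n + 4\<close>.\<close>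
lemma bij_qframe: "bij (qframe c q)"
proof -
  have "u = 0" if "qframe c q u = 0" for u
  proof -
    have "J.frame_form u z = 0" for z
      unfolding q_metric_qframe[symmetric] that q_metric_expand
      by (simp add: eta_form_def theta_form_def r_metric_def form_prod_def)
    then show "u = 0" using J.scalar_product_frame_form unfolding scalar_product_def by blast
  qed
  then have "inj (qframe c q)" using linear_injective_0[OF linear_qframe] by blast
  moreover have "DIM('n q_space) = DIM((real \<times> (real ^ 'n)) quad)" by simp
  ultimately show ?thesis
    using linear_injective_imp_surjective[OF linear_qframe] by (simp add: bij_def)
qed

end

text \<open>The frame \<open>qframe\<close> with the connection \<open>conn\<close> satisfies the structure equations.\<close>
theorem q_metric_norm:
  assumes p: "p \<in> qdom c" and basis: "cubic_jet_basis (Kc c (qx p)) (mc c (qx p)) (qx p) f"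
  shows "riemann_norm_sq (q_metric c) p = cubic_jet_basis.frame_norm (Kc c (qx p)) (mc c (qx p)) (qx p) f"
proof -
  define W where "W q = conn_at c (qx q)" for q :: "'n q_space"
  define G where "G q = cubic_jet.frame_form (Kc c (qx q))" for q :: "'n q_space"
  define DW where "DW v = dconn_at c (qx p) (qx v)" for v :: "'n q_space"
  obtain D2 where D2: "\<And>u v. ((\<lambda>q. Dqframe c q v u) has_derivative (\<lambda>w. D2 w v u)) (at p)" "\<And>u v w. D2 v w u = D2 w v u"
    using second_derivative_qframe[OF p] by blast
  interpret F: metric_frame "q_metric c" "qdom c" p "qframe c" "Dqframe c" D2 "\<lambda>q. inv (qframe c q)" G W DW
  proof (rule metric_frame.intro)
    show "open (qdom c)" by (rule open_qdom)
    fix q :: "'n q_space" assume q: "q \<in> qdom c"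
    interpret J: cubic_jet "Kc c (qx q)" "mc c (qx q)" "qx q" by (rule cubic_jet[OF qdomD(1)[OF q]])
    note b = bij_qframe[OF q]
    show "linear (qframe c q)" by (rule linear_qframe[OF q])
    show "inv (qframe c q) (qframe c q u) = u" for u using b by (simp add: bij_is_inj)
    show ee: "qframe c q (inv (qframe c q) v) = v" for v using b by (simp add: bij_is_surj surj_f_inv_f)
    show "scalar_product (G q)" unfolding G_def by (rule J.scalar_product_frame_form)
    show "bilinear (W q)" unfolding W_def by (rule J.bilinear_conn)
    show "q_metric c q v w = G q (inv (qframe c q) v) (inv (qframe c q) w)" for v w
      using q_metric_qframe[OF q, of "inv (qframe c q) v" "inv (qframe c q) w"] by (simp add: G_def ee)
    have x: "snd (fst (inv (qframe c q) v)) = qx v" for v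
      using qframe_proj(1)[of c q "inv (qframe c q) v"] by (simp add: ee)
    show "((\<lambda>q. G q z z') has_derivative (\<lambda>v. G q (W q (inv (qframe c q) v) z) z' + G q z (W q (inv (qframe c q) v) z'))) (at q)" for z z'
    proof -
      have frame_form: "G y z z' = fst (fst z) * fst (fst z') + fst (fst (snd z)) * fst (fst (snd z')) + fst (fst (snd (snd z))) * fst (fst (snd (snd z')))
        + fst (snd (snd (snd z))) * fst (snd (snd (snd z'))) + Kc c (qx y) (snd (fst z)) (snd (fst z')) + Kc c (qx y) (snd (fst (snd z))) (snd (fst (snd z')))
        + Kc c (qx y) (snd (fst (snd (snd z)))) (snd (fst (snd (snd z')))) + Kc c (qx y) (snd (snd (snd (snd z)))) (snd (snd (snd (snd z'))))" if "y \<in> qdom c" for y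
        by (simp add: G_def cubic_jet.frame_form_def[OF cubic_jet[OF qdomD(1)[OF that]]] cubic_jet.ext_form_def[OF cubic_jet[OF qdomD(1)[OF that]]])
      show ?thesis
        apply (rule has_derivative_transform_within_open[OF _ open_qdom q frame_form[symmetric]])
         prefer 2 apply assumption
        apply (rule has_derivative_eq_rhs, (rule has_derivative_add has_derivative_const D_qx[OF q D_K[OF qdomD(1)[OF q]]])+)
        apply (simp add: fun_eq_iff G_def W_def J.conn_compatible x)
        done
    qed
    show "((\<lambda>q. qframe c q u) has_derivative (\<lambda>v. Dqframe c q v u)) (at q)" for u by (rule D_qframe[OF q])
    show "Dqframe c q (qframe c q u) v - Dqframe c q (qframe c q v) u = qframe c q (W q u v - W q v u)" for u v
      unfolding W_def by (rule torsion_qframe[OF q])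
  next
    show "((\<lambda>q. W q u z) has_derivative (\<lambda>v. DW v u z)) (at p)" for u z
      unfolding W_def DW_def by (rule D_qx[OF p D_conn[OF qdomD(1)[OF p]]])
  qed (use p D2 in auto)
  interpret B: cubic_jet_basis "Kc c (qx p)" "mc c (qx p)" "qx p" f by (rule basis)
  have curv: "F.curv = B.curv_frame"
    unfolding F.curv_def[abs_def] B.curv_frame_def[abs_def] W_def DW_def by (simp add: qframe_proj)
  show ?thesis
    using F.riemann_norm_sq_eq[where A = "UNIV \<times> {0,1,2,3}" and \<epsilon> = "\<lambda>\<alpha>. slot (snd \<alpha>) (B.bas (fst \<alpha>))"]
    unfolding curv G_def by (simp only: B.frame_form_complete B.frame_norm_def)
qed

end

section \<open>The scalar curvature and the tensor S in a frame\<close>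

context cubic_jet_basis begin

text \<open>The components of \<open>\<sigma>\<close> in the shape of the definition of \<open>S\<close>. The second derivatives of \<open>h\<close> are \<open>cform x\<close> up to the factor
  \<open>8h\<close>, and the contraction over \<open>f\<close> is Parseval's identity.\<close>
lemma sigma_comp_expand:
  "sigma_comp i j k l = (\<Sum>d\<in>UNIV. cform (f j) (f k) (f d) * cform (f d) (f i) (f l)) - 4 * (cform x (f j) (f k) * cform x (f i) (f l))
    + ((\<Sum>d\<in>UNIV. cform (f i) (f k) (f d) * cform (f d) (f j) (f l)) - 4 * (cform x (f i) (f k) * cform x (f j) (f l)))
    + ((\<Sum>d\<in>UNIV. cform (f i) (f j) (f d) * cform (f d) (f k) (f l)) - 4 * (cform x (f i) (f j) * cform x (f k) (f l)))
    + 2 * xi (f i) * cform (f j) (f k) (f l) + 2 * xi (f j) * cform (f k) (f l) (f i) + 2 * xi (f k) * cform (f l) (f i) (f j) + 2 * xi (f l) * cform (f i) (f j) (f k)"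
proof -
  have s: "(\<Sum>d\<in>UNIV. cform u v (f d) * cform (f d) w z) = K (m u v) (m w z)" for u v w z
    unfolding parseval[of "m u v" "m w z"] by (intro sum.cong refl) (metis cform_def cform_swap12 cform_swap23)
  have "K (f i) (m (f k) (m (f l) (f j))) = K (m (f i) (f k)) (m (f j) (f l))"
    "K (f i) (m (f l) (m (f k) (f j))) = K (m (f j) (f k)) (m (f i) (f l))"
    "K (f i) (m (f j) (m (f k) (f l))) = K (m (f i) (f j)) (m (f k) (f l))"
    by (metis K_m m_commute K_commute)+
  moreover have "K (f i) (m (f a) (f b)) = cform (f i) (f a) (f b)" for a b by (metis K_m cform_def)
  ultimately show ?thesis
    unfolding s sigma_comp_def sigma_def K_lin
    by (simp add: cform_x K_to K_commute cform_swap12 cform_swap23 algebra_simps del: K_to(1,2))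
qed

end

context fixes c :: "'n::finite \<Rightarrow> 'n \<Rightarrow> 'n \<Rightarrow> real" begin

lemma polar_sum:
  fixes u v w :: "real ^ 'n"
  shows "polar c (\<Sum>a\<in>A. g a) v w = (\<Sum>a\<in>A. polar c (g a) v w)"
    "polar c u (\<Sum>a\<in>A. g a) w = (\<Sum>a\<in>A. polar c u (g a) w)"
    "polar c u v (\<Sum>a\<in>A. g a) = (\<Sum>a\<in>A. polar c u v (g a))"
  by (induction A rule: infinite_finite_induct) (simp_all add: polar_lin polar_0)

lemma polar_expand:
  fixes u v w :: "real ^ 'n"
  shows "polar c u v w = (\<Sum>\<mu>\<in>UNIV. \<Sum>\<nu>\<in>UNIV. \<Sum>\<sigma>\<in>UNIV. u $ \<mu> * v $ \<nu> * w $ \<sigma> * polar c (axis \<mu> 1) (axis \<nu> 1) (axis \<sigma> 1))"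
proof -
  have b: "(\<Sum>\<mu>\<in>UNIV. u $ \<mu> *\<^sub>R axis \<mu> 1) = u" for u :: "real ^ 'n"
    by (simp add: basis_expansion flip: scalar_mult_eq_scaleR)
  have "polar c u v w = polar c (\<Sum>\<mu>\<in>UNIV. u $ \<mu> *\<^sub>R axis \<mu> 1) (\<Sum>\<nu>\<in>UNIV. v $ \<nu> *\<^sub>R axis \<nu> 1) (\<Sum>\<sigma>\<in>UNIV. w $ \<sigma> *\<^sub>R axis \<sigma> 1)"
    by (simp only: b)
  then show ?thesis unfolding polar_sum(1) unfolding polar_sum(2) unfolding polar_sum(3) polar_scaleR by (simp add: sum_distrib_left mult_ac)
qed

lemma frame_components:
  fixes x :: "real ^ 'n"
  assumes f: "\<And>a \<mu>. matrix_inv e $ \<mu> $ a = f a $ \<mu>"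
  shows "frame1 c e x a = polar c x x (f a) / 2" "frame2 c e x a b = polar c x (f a) (f b)" "frame3 c e x a b d = polar c (f a) (f b) (f d)"
proof -
  have b: "(\<Sum>\<mu>\<in>UNIV. u $ \<mu> *\<^sub>R axis \<mu> 1) = u" for u :: "real ^ 'n"
    by (simp add: basis_expansion flip: scalar_mult_eq_scaleR)
  show "frame1 c e x a = polar c x x (f a) / 2"
    by (subst b[of "f a", symmetric]) (simp add: frame1_def f cubic1_polar polar_sum polar_scaleR sum_divide_distrib)
  have "polar c x (f a) (f b) = polar c x (\<Sum>\<mu>\<in>UNIV. f a $ \<mu> *\<^sub>R axis \<mu> 1) (\<Sum>\<nu>\<in>UNIV. f b $ \<nu> *\<^sub>R axis \<nu> 1)" by (simp only: b)
  then show "frame2 c e x a b = polar c x (f a) (f b)"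
    unfolding polar_sum(2) unfolding polar_sum(3) polar_scaleR by (simp add: frame2_def f cubic2_polar sum_distrib_left mult_ac)
  show "frame3 c e x a b d = polar c (f a) (f b) (f d)"
    unfolding polar_expand[of "f a"] by (simp add: frame3_def f cubic3_polar)
qed

text \<open>The inverse metric is \<open>\<Sum>\<^sub>a f\<^sub>a \<otimes> f\<^sub>a\<close>, so that the contraction is the squared norm of the cubic form in the frame.\<close>
lemma cubic3_contraction:
  fixes f :: "'m::finite \<Rightarrow> real ^ 'n"
  assumes K': "\<And>\<mu> \<nu>. K' $ \<mu> $ \<nu> = (\<Sum>a\<in>UNIV. f a $ \<mu> * f a $ \<nu>)"
  shows "(\<Sum>\<alpha>\<in>UNIV. \<Sum>\<beta>\<in>UNIV. \<Sum>\<gamma>\<in>UNIV. \<Sum>\<alpha>'\<in>UNIV. \<Sum>\<beta>'\<in>UNIV. \<Sum>\<gamma>'\<in>UNIV.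
          cubic3 c \<alpha> \<beta> \<gamma> x * K' $ \<alpha> $ \<alpha>' * K' $ \<beta> $ \<beta>' * K' $ \<gamma> $ \<gamma>' * cubic3 c \<alpha>' \<beta>' \<gamma>' x)
    = (\<Sum>a\<in>UNIV. \<Sum>b\<in>UNIV. \<Sum>d\<in>UNIV. (polar c (f a) (f b) (f d))\<^sup>2)"
proof -
  have r: "(\<Sum>i\<in>UNIV. \<Sum>j\<in>UNIV. \<Sum>k\<in>UNIV. F i j k) = (\<Sum>t\<in>UNIV. F (fst t) (fst (snd t)) (snd (snd t)))" for F :: "'k::finite \<Rightarrow> 'k \<Rightarrow> 'k \<Rightarrow> real"
    by (simp add: sum.cartesian_product case_prod_unfold UNIV_Times_UNIV[symmetric] del: UNIV_Times_UNIV)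
  have k: "K' $ \<alpha> = (\<Sum>a\<in>UNIV. f a $ \<alpha> *\<^sub>R f a)" for \<alpha> by (simp add: vec_eq_iff K')
  let ?T = "\<lambda>\<alpha> \<beta> \<gamma>. polar c (axis \<alpha> 1) (axis \<beta> 1) (axis \<gamma> 1)"
  have "(\<Sum>\<alpha>'\<in>UNIV. \<Sum>\<beta>'\<in>UNIV. \<Sum>\<gamma>'\<in>UNIV. cubic3 c \<alpha> \<beta> \<gamma> x * K' $ \<alpha> $ \<alpha>' * K' $ \<beta> $ \<beta>' * K' $ \<gamma> $ \<gamma>' * cubic3 c \<alpha>' \<beta>' \<gamma>' x)
     = (\<Sum>a\<in>UNIV. \<Sum>b\<in>UNIV. \<Sum>d\<in>UNIV. ?T \<alpha> \<beta> \<gamma> * (f a $ \<alpha> * f b $ \<beta> * f d $ \<gamma> * polar c (f a) (f b) (f d)))" (is "?L \<alpha> \<beta> \<gamma> = ?R \<alpha> \<beta> \<gamma>") for \<alpha> \<beta> \<gamma>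
  proof -
    have "?L \<alpha> \<beta> \<gamma> = ?T \<alpha> \<beta> \<gamma> * polar c (K' $ \<alpha>) (K' $ \<beta>) (K' $ \<gamma>)"
      unfolding polar_expand[of "K' $ \<alpha>"] cubic3_polar sum_distrib_left by (simp add: mult.assoc)
    also have "\<dots> = ?R \<alpha> \<beta> \<gamma>"
      unfolding k polar_sum(1) unfolding polar_sum(2) unfolding polar_sum(3) polar_scaleR sum_distrib_left by (simp add: mult_ac)
    finally show ?thesis .
  qed
  then have "(\<Sum>\<alpha>\<in>UNIV. \<Sum>\<beta>\<in>UNIV. \<Sum>\<gamma>\<in>UNIV. ?L \<alpha> \<beta> \<gamma>) = (\<Sum>\<alpha>\<in>UNIV. \<Sum>\<beta>\<in>UNIV. \<Sum>\<gamma>\<in>UNIV. ?R \<alpha> \<beta> \<gamma>)" by (simp only:)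
  also have "\<dots> = (\<Sum>a\<in>UNIV. \<Sum>b\<in>UNIV. \<Sum>d\<in>UNIV. \<Sum>\<alpha>\<in>UNIV. \<Sum>\<beta>\<in>UNIV. \<Sum>\<gamma>\<in>UNIV. ?T \<alpha> \<beta> \<gamma> * (f a $ \<alpha> * f b $ \<beta> * f d $ \<gamma> * polar c (f a) (f b) (f d)))"
    unfolding r by (rule sum.swap)
  also have "\<dots> = (\<Sum>a\<in>UNIV. \<Sum>b\<in>UNIV. \<Sum>d\<in>UNIV. polar c (f a) (f b) (f d) * polar c (f a) (f b) (f d))"
  proof (intro sum.cong refl)
    fix a b d
    show "(\<Sum>\<alpha>\<in>UNIV. \<Sum>\<beta>\<in>UNIV. \<Sum>\<gamma>\<in>UNIV. ?T \<alpha> \<beta> \<gamma> * (f a $ \<alpha> * f b $ \<beta> * f d $ \<gamma> * polar c (f a) (f b) (f d))) = polar c (f a) (f b) (f d) * polar c (f a) (f b) (f d)"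
      by (subst (4) polar_expand) (simp add: sum_distrib_left mult_ac)
  qed
  finally show ?thesis by (simp add: power2_eq_square)
qed

context
  fixes X :: "complex ^ 'n" and e :: "real ^ 'n ^ 'n"
  assumes X: "Im_vec X \<in> regular_points c" and e: "\<And>\<mu> \<nu>. (\<Sum>a\<in>UNIV. e $ a $ \<mu> * e $ a $ \<nu>) = kaehler_matrix c X $ \<mu> $ \<nu>"
begin

definition frame_vector :: "'n \<Rightarrow> real ^ 'n" where "frame_vector a = (\<chi> \<mu>. matrix_inv e $ \<mu> $ a)"

lemma frame_vector_basis: "cubic_jet_basis (Kc c (Im_vec X)) (mc c (Im_vec X)) (Im_vec X) frame_vector"
  using frame_basis(1)[of X c e] X e by (simp add: frame_vector_def[abs_def])

interpretation B: cubic_jet_basis "Kc c (Im_vec X)" "mc c (Im_vec X)" "Im_vec X" frame_vector by (rule frame_vector_basis)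

lemma cform_polar: "B.cform u v w = polar c u v w / (8 * cubic c (Im_vec X))"
  by (simp add: B.cform_def Kc_mc X)

lemma r_scal_frame: "r_scal c X = - 2 * real CARD('n) * (real CARD('n) + 1) + 2 * B.cform_norm_sq"
proof -
  have h: "cubic c (Im_vec X) > 0" using X by (simp add: regular_points_def)
  have K': "matrix_inv (kaehler_matrix c X) $ \<mu> $ \<nu> = (\<Sum>a\<in>UNIV. frame_vector a $ \<mu> * frame_vector a $ \<nu>)" for \<mu> \<nu>
    using frame_basis(2)[of X c e] X e by (simp add: frame_vector_def)
  have P: "polar c u v w = 8 * cubic c (Im_vec X) * B.cform u v w" for u v w using h by (simp add: cform_polar)
  show ?thesis
    using h unfolding r_scal_def Let_def cubic3_contraction[OF K'] P B.cform_norm_sq_def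
    by (simp add: power_mult_distrib sum_distrib_left[symmetric] field_simps)
qed

text \<open>The prefactor \<open>exp 2\<K> = 1/(64h\<^sup>2)\<close> cancels the scalings by \<open>8h\<close>.\<close>
lemma S_tensor_frame: "S_tensor c e X i j k l = - B.sigma_comp i j k l / 2"
proof -
  have h: "cubic c (Im_vec X) > 0" using X by (simp add: regular_points_def)
  have P: "polar c u v w = 8 * cubic c (Im_vec X) * B.cform u v w" for u v w using h by (simp add: cform_polar)
  have x: "B.cform (Im_vec X) (Im_vec X) u = B.xi u" for u by (simp add: cform_polar xi_polar X)
  \<comment> \<open>The logarithm has its proper value because \<open>h\<close> is positive.\<close>
  have E: "exp (2 * kaehler_potential c X) = 1 / (64 * (cubic c (Im_vec X))\<^sup>2)"
  proof -
    have "exp (2 * kaehler_potential c X) = (inverse (exp (ln (8 * cubic c (Im_vec X)))))\<^sup>2"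
      by (simp add: kaehler_potential_def exp_minus[symmetric] exp_double[symmetric])
    also have "exp (ln (8 * cubic c (Im_vec X))) = 8 * cubic c (Im_vec X)" using h by simp
    finally show ?thesis by (simp add: power2_eq_square field_simps)
  qed
  have f: "matrix_inv e $ \<mu> $ a = frame_vector a $ \<mu>" for a \<mu> by (simp add: frame_vector_def)
  let ?h = "cubic c (Im_vec X)"
  have s: "(\<Sum>d\<in>UNIV. 8 * ?h * B.cform u v (frame_vector d) * (8 * ?h * B.cform (frame_vector d) w z)) =
      (64 * ?h\<^sup>2) * (\<Sum>d\<in>UNIV. B.cform u v (frame_vector d) * B.cform (frame_vector d) w z)" for u v w z
    unfolding sum_distrib_left by (intro sum.cong refl) (simp add: power2_eq_square)
  have "S_tensor c e X i j k l = - (1 / 2) * (1 / (64 * ?h\<^sup>2)) * (64 * ?h\<^sup>2 * B.sigma_comp i j k l)"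
    unfolding S_tensor_def Let_def frame_components[where f = frame_vector, OF f] P x E s B.sigma_comp_expand
    by (intro arg_cong2[where f = "(*)"] refl) (simp add: power2_eq_square algebra_simps)
  then show ?thesis using h by simp
qed

end
end

section \<open>The norm of the Riemann tensor\<close>

theorem corollary21:
  fixes c :: "'n::finite \<Rightarrow> 'n \<Rightarrow> 'n \<Rightarrow> real"
    and H :: "(real ^ 'n) set"
    and e :: "complex ^ 'n \<Rightarrow> real ^ 'n ^ 'n"
    and p :: "'n q_space"
  assumes "projective_special_real c H"
    and "\<forall>X\<in>r_manifold H. \<forall>\<mu> \<nu>.
      (\<Sum>a\<in>UNIV. e X $ a $ \<mu> * e X $ a $ \<nu>) = kaehler_matrix c X $ \<mu> $ \<nu>"
    and "p \<in> q_manifold H"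
  shows "riemann_norm_sq (q_metric c) p =
    64 * (real CARD('n) + 1) * (4 * real CARD('n) + 3) + 160 * r_scal c (fst p) +
    6 * riemann_norm_sq (r_metric c) (fst p) +
    128 * (\<Sum>i\<in>UNIV. \<Sum>j\<in>UNIV. \<Sum>k\<in>UNIV. \<Sum>l\<in>UNIV. (S_tensor c (e (fst p)) (fst p) i j k l)\<^sup>2)"
proof -
  let ?X = "fst p"
  have r: "?X \<in> r_manifold H" "fst (snd p) > 0" using assms(3) by (auto simp: q_manifold_def)
  then have x: "Im_vec ?X \<in> regular_points c" using cone_subset_regular[OF assms(1)] by (auto simp: r_manifold_def)
  have p: "p \<in> qdom c" using x r(2) by (simp add: qdom_def)
  have e: "(\<Sum>a\<in>UNIV. e ?X $ a $ \<mu> * e ?X $ a $ \<nu>) = kaehler_matrix c ?X $ \<mu> $ \<nu>" for \<mu> \<nu>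
    using assms(2) r(1) by blast
  note basis = frame_vector_basis[OF x e]
  interpret B: cubic_jet_basis "Kc c (Im_vec ?X)" "mc c (Im_vec ?X)" "Im_vec ?X" "frame_vector (e ?X)" by (rule basis)
  have "(\<Sum>i\<in>UNIV. \<Sum>j\<in>UNIV. \<Sum>k\<in>UNIV. \<Sum>l\<in>UNIV. (S_tensor c (e ?X) ?X i j k l)\<^sup>2)
    = (\<Sum>i\<in>UNIV. \<Sum>j\<in>UNIV. \<Sum>k\<in>UNIV. \<Sum>l\<in>UNIV. (B.sigma_comp i j k l)\<^sup>2) / 4"
    by (simp add: S_tensor_frame[OF x e] power_divide sum_divide_distrib)
  then show ?thesis
    unfolding q_metric_norm[OF p basis] B.frame_norm_formula r_metric_norm[OF x basis] r_scal_frame[OF x e]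
    by simp
qed

end
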